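(* Let $L\in L^{1+\varepsilon}(\mu)$, for some $\varepsilon>0$, be $\mu$-almost surely strictly positive with $E[L]=1$, represented as $L=\rho(-\delta v)$ with $v\in L^0_a(\mu,H)$, and let $V=I_W+v$. Let $T=I_W+\nabla\varphi$ be the Monge transport map from $\mu$ to $\nu=L\cdot\mu$ and let $B=V\circ T$, which is a Brownian motion under $\mu$. The map $V$ is not invertible, i.e., the equation $$U_t=W_t-\int_0^t\dot v_s\circ U\,ds$$ has no strong solution, if and only if the equation $$T_t=B_t-\int_0^t\dot v_s\circ T\,ds$$ has no strong solution.
   Context: $W=C_0([0,1],\mathbb R^d)$ is the classical Wiener space with Wiener measure $\mu$, $E$ is expectation under $\mu$, $W_t(w)=w(t)$ is the canonical Brownian motion, $(\mathcal F_t)_{t\in[0,1]}$ its filtration. $H$ is the Cameron–Martin space of absolutely continuous $h:[0,1]\to\mathbb R^d$ with $h(0)=0$ and $|h|_H^2=\int_0^1|\dot h_s|^2ds<\infty$. $L^0_a(\mu,H)$ is the set of measurable $v:W\to H$, $v(t,w)=\int_0^t\dot v_s(w)\,ds$, with $\dot v$ adapted to $(\mathcal F_t)$, and $\rho(-\delta v)=\exp\left(-\int_0^1(\dot v_s,dW_s)-\frac12\int_0^1|\dot v_s|^2ds\right)$. $\nabla$ is the Sobolev (Malliavin) derivative in the directions of $H$, $\mathbb D_{2,1}$ the Sobolev space of real functionals in $L^2(\mu)$ with derivative in $L^2(\mu,H)$. A function $\varphi$ is $1$-convex if $h\mapsto\varphi(x+h)+\frac12|h|_H^2$ is convex on $H$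 with values in $L^0(\mu)$. Monge transport map: for $L\in L\log L(\mu)$ there is a $1$-convex $\varphi\in\mathbb D_{2,1}$, unique up to a constant, such that $T=I_W+\nabla\varphi$ maps $\mu$ to $\nu=L\cdot\mu$ and is the unique solution of the Monge problem between $\mu$ and $\nu$ with cost $|x-y|_H^2$; $T_t(w)=T(w)(t)$. The map $T$ satisfies $T_t=B_t-\int_0^t\dot v_s\circ T\,ds$ with $B=V\circ T$, and $B$ is a Brownian motion with respect to the filtration generated by $T$. A strong solution of such an equation is a solution adapted to the filtration of the driving Brownian motion ($(W_t)$ in the first equation, $(B_t)$ in the second). Invertible means $\mu$-almost surely invertible: there is a measurable $S:W\to W$ with $S\mu\ll\mu$, $V\mu\ll\mu$ and $S\circ V=V\circ S=I_W$ $\mu$-a.s. $I_W$ is the identity map of $W$. *)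

theory Defs
  imports "HOL-Probability.Probability"
begin

section \<open>The Wiener space\<close>

text \<open>
  Paths \<open>[0,1] \<rightarrow> \<real>\<^sup>d\<close>, with \<open>d = CARD('n)\<close>, are functions on \<open>real\<close> that vanish outside \<open>{0..1}\<close>;
  thus equality of paths is equality of functions.
\<close>

type_synonym 'n wpath = "real \<Rightarrow> (real, 'n) vec"

definition wiener_paths :: "('n::finite) wpath set" where
  "wiener_paths = {w. continuous_on {0..1} w \<and> w 0 = 0 \<and> (\<forall>t. t \<notin> {0..1} \<longrightarrow> w t = 0)}"

text \<open>
  The \<open>\<sigma>\<close>-algebra generated by the evaluations, which on continuous paths is the Borel
  \<open>\<sigma>\<close>-algebra of the uniform norm.  Only \<open>space\<close> and \<open>sets\<close> of this measure are meaningful.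
\<close>

definition wiener_algebra :: "('n::finite) wpath measure" where
  "wiener_algebra = restrict_space (\<Pi>\<^sub>M t\<in>UNIV. borel) wiener_paths"

text \<open>
  A probability measure on path space under which the coordinate process has independent
  Gaussian increments.  There is exactly one such measure.
\<close>

definition wiener_measure :: "('n::finite) wpath measure \<Rightarrow> bool" where
  "wiener_measure \<mu> \<longleftrightarrow>
     prob_space \<mu> \<and> sets \<mu> = sets wiener_algebra \<and>
     (\<forall>k (t :: nat \<Rightarrow> real).
        0 \<le> t 0 \<and> (\<forall>j<k. t j < t (Suc j)) \<and> t k \<le> 1 \<longrightarrow>
          prob_space.indep_vars \<mu> (\<lambda>_. borel)
            (\<lambda>(j, i) w. (w (t (Suc j)) - w (t j)) $ i) ({..<k} \<times> (UNIV :: 'n set)) \<and>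
          (\<forall>j<k. \<forall>i. distributed \<mu> lborel (\<lambda>w. (w (t (Suc j)) - w (t j)) $ i)
             (\<lambda>x. ennreal (normal_density 0 (sqrt (t (Suc j) - t j)) x))))"

text \<open>
  Random elements are measurable with respect to \<open>completion \<mu>\<close>, and filtrations contain the
  null sets of \<open>completion \<mu>\<close>.  This is the augmented filtration generated by the
  path-valued variable \<open>X\<close>; the canonical filtration is the one of \<open>\<lambda>w. w\<close>.
\<close>

definition aug_filtration ::
  "('n::finite) wpath measure \<Rightarrow> ('n wpath \<Rightarrow> 'n wpath) \<Rightarrow> real \<Rightarrow> 'n wpath measure" where
  "aug_filtration \<mu> X t =
     sigma (space \<mu>)
       ({(\<lambda>w. X w s) -` A \<inter> space \<mu> | s A. s \<in> {0..t} \<and> A \<in> sets borel}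
        \<union> null_sets (completion \<mu>))"

text \<open>A map of the Wiener space under which the image of \<open>\<mu>\<close> is absolutely continuous.\<close>

definition abs_cont_map :: "('n::finite) wpath measure \<Rightarrow> ('n wpath \<Rightarrow> 'n wpath) \<Rightarrow> bool" where
  "abs_cont_map \<mu> X \<longleftrightarrow>
     X \<in> measurable (completion \<mu>) \<mu> \<and>
     absolutely_continuous \<mu> (distr (completion \<mu>) \<mu> X)"

definition ae_invertible :: "('n::finite) wpath measure \<Rightarrow> ('n wpath \<Rightarrow> 'n wpath) \<Rightarrow> bool" where
  "ae_invertible \<mu> V \<longleftrightarrow>
     abs_cont_map \<mu> V \<and>
     (\<exists>S. abs_cont_map \<mu> S \<and> (AE w in \<mu>. S (V w) = w) \<and> (AE w in \<mu>. V (S w) = w))"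


section \<open>The Cameron--Martin space\<close>

definition square_integrable01 :: "(real \<Rightarrow> real ^ ('n::finite)) \<Rightarrow> bool" where
  "square_integrable01 g \<longleftrightarrow>
     set_borel_measurable borel {0..1} g \<and> set_integrable lborel {0..1} (\<lambda>s. (norm (g s))\<^sup>2)"

definition primitive01 :: "(real \<Rightarrow> real ^ ('n::finite)) \<Rightarrow> 'n wpath" where
  "primitive01 g = (\<lambda>t. if t \<in> {0..1} then (LBINT s:{0..t}. g s) else 0)"

definition cm_space :: "('n::finite) wpath set" where
  "cm_space = {primitive01 g | g. square_integrable01 g}"

text \<open>
  The squared norm \<open>|h|\<^sub>H\<^sup>2\<close>, extended by \<open>\<infinity>\<close> outside the Cameron--Martin space.  The densities of
  a path agree almost everywhere, so the infimum ranges over one value at most; the infimum of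
  the empty set is \<open>\<infinity>\<close>.
\<close>

definition cm_energy :: "('n::finite) wpath \<Rightarrow> ennreal" where
  "cm_energy h =
     (INF g \<in> {g. square_integrable01 g \<and> primitive01 g = h}.
        \<integral>\<^sup>+ s\<in>{0..1}. ennreal ((norm (g s))\<^sup>2) \<partial>lborel)"


section \<open>Adapted drifts and the exponential density\<close>

definition adapted_drift ::
  "('n::finite) wpath measure \<Rightarrow> (real \<Rightarrow> 'n wpath \<Rightarrow> real ^ 'n) \<Rightarrow> bool" where
  "adapted_drift \<mu> u \<longleftrightarrow>
     (\<lambda>(s, w). u s w) \<in> borel_measurable (restrict_space borel {0..1} \<Otimes>\<^sub>M completion \<mu>) \<and>
     (\<forall>w\<in>space \<mu>. square_integrable01 (\<lambda>s. u s w)) \<and>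
     (\<forall>s\<in>{0..1}. u s \<in> borel_measurable (aug_filtration \<mu> (\<lambda>w. w) s))"

definition drift_shift ::
  "(real \<Rightarrow> 'n wpath \<Rightarrow> real ^ 'n) \<Rightarrow> ('n::finite) wpath \<Rightarrow> 'n wpath" where
  "drift_shift u w = (\<lambda>t. w t + primitive01 (\<lambda>s. u s w) t)"

definition converges_in_prob ::
  "'a measure \<Rightarrow> (nat \<Rightarrow> 'a \<Rightarrow> real) \<Rightarrow> ('a \<Rightarrow> real) \<Rightarrow> bool" where
  "converges_in_prob M X Y \<longleftrightarrow>
     (\<forall>e>0. (\<lambda>n. measure M {w \<in> space M. \<bar>X n w - Y w\<bar> > e}) \<longlonglongrightarrow> 0)"

text \<open>\<open>u\<close> is a simple adapted process and \<open>J\<close> its stochastic integral over \<open>[0,1]\<close>.\<close>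

definition simple_ito ::
  "('n::finite) wpath measure \<Rightarrow> (real \<Rightarrow> 'n wpath \<Rightarrow> real ^ 'n) \<Rightarrow> ('n wpath \<Rightarrow> real) \<Rightarrow> bool"
where
  "simple_ito \<mu> u J \<longleftrightarrow>
     (\<exists>k (t :: nat \<Rightarrow> real) \<xi>.
        0 \<le> t 0 \<and> (\<forall>j<k. t j \<le> t (Suc j)) \<and> t k \<le> 1 \<and>
        (\<forall>j<k. \<xi> j \<in> borel_measurable (aug_filtration \<mu> (\<lambda>w. w) (t j)) \<and>
               bounded (\<xi> j ` space \<mu>)) \<and>
        u = (\<lambda>s w. \<Sum>j<k. indicat_real {t j<..t (Suc j)} s *\<^sub>R \<xi> j w) \<and>
        J = (\<lambda>w. \<Sum>j<k. \<xi> j w \<bullet> (w (t (Suc j)) - w (t j))))"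

text \<open>
  \<open>J = \<integral>\<^sub>0\<^sup>1 (u\<^sub>s, dW\<^sub>s)\<close>: the Ito integral of an adapted drift that is square integrable
  pathwise, as the limit in probability of integrals of simple processes.
\<close>

definition has_ito_integral ::
  "('n::finite) wpath measure \<Rightarrow> (real \<Rightarrow> 'n wpath \<Rightarrow> real ^ 'n) \<Rightarrow> ('n wpath \<Rightarrow> real) \<Rightarrow> bool"
where
  "has_ito_integral \<mu> u J \<longleftrightarrow>
     adapted_drift \<mu> u \<and> J \<in> borel_measurable (completion \<mu>) \<and>
     (\<exists>un Jn. (\<forall>n. simple_ito \<mu> (un n) (Jn n)) \<and>
        converges_in_prob (completion \<mu>)
          (\<lambda>n w. LBINT s:{0..1}. (norm (un n s w - u s w))\<^sup>2) (\<lambda>_. 0) \<and>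
        converges_in_prob (completion \<mu>) Jn J)"

text \<open>\<open>L = \<rho>(-\<delta>u)\<close>, an equality of classes of random variables.\<close>

definition is_rho ::
  "('n::finite) wpath measure \<Rightarrow> (real \<Rightarrow> 'n wpath \<Rightarrow> real ^ 'n) \<Rightarrow> ('n wpath \<Rightarrow> real) \<Rightarrow> bool"
where
  "is_rho \<mu> u L \<longleftrightarrow>
     (\<exists>J. has_ito_integral \<mu> u J \<and>
        (AE w in \<mu>. L w = exp (- J w - 1/2 * (LBINT s:{0..1}. (norm (u s w))\<^sup>2))))"


section \<open>The Sobolev derivative\<close>

text \<open>
  Cylindrical functionals \<open>F w = f (w (t 0), \<dots>, w (t (k-1)))\<close> with \<open>f\<close> bounded and continuously
  differentiable with bounded derivatives, and their derivative
  \<open>\<nabla>F w = (\<Sum>j<k. (\<partial>\<^sub>j f) (w (t 0), \<dots>) \<cdot> min (t j))\<close>, the path \<open>s \<mapsto> min s (t j)\<close> representing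
  evaluation at \<open>t j\<close> in the Cameron--Martin space.  Points of \<open>(\<real>\<^sup>d)\<^sup>k\<close> are sequences of which
  only the first \<open>k\<close> entries matter; continuity refers to the product topology.
\<close>

definition cylindrical_deriv ::
  "(('n::finite) wpath \<Rightarrow> real) \<Rightarrow> ('n wpath \<Rightarrow> 'n wpath) \<Rightarrow> bool" where
  "cylindrical_deriv F DF \<longleftrightarrow>
     (\<exists>k (t :: nat \<Rightarrow> real) (f :: (nat \<Rightarrow> real ^ 'n) \<Rightarrow> real)
        (g :: nat \<Rightarrow> (nat \<Rightarrow> real ^ 'n) \<Rightarrow> real ^ 'n).
        (\<forall>j<k. t j \<in> {0..1}) \<and>
        (\<forall>x y. (\<forall>j<k. x j = y j) \<longrightarrow> f x = f y) \<and>
        continuous_on UNIV f \<and> bounded (range f) \<and>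
        (\<forall>j<k. continuous_on UNIV (g j) \<and> bounded (range (g j)) \<and>
           (\<forall>x. ((\<lambda>y. f (x(j := y))) has_derivative (\<lambda>y. g j x \<bullet> y)) (at (x j)))) \<and>
        F = (\<lambda>w. f (\<lambda>j. w (t j))) \<and>
        DF = (\<lambda>w s. if s \<in> {0..1} then \<Sum>j<k. min s (t j) *\<^sub>R g j (\<lambda>j. w (t j)) else 0))"

text \<open>
  \<open>\<phi> \<in> D\<^bsub>2,1\<^esub>\<close> with \<open>\<nabla>\<phi> = D\<close>: the closure in \<open>L\<^sup>2(\<mu>) \<times> L\<^sup>2(\<mu>, H)\<close> of the derivative on cylindrical
  functionals (starting from polynomials or from smooth functions yields the same closure).
\<close>

definition has_sobolev_deriv ::
  "('n::finite) wpath measure \<Rightarrow> ('n wpath \<Rightarrow> real) \<Rightarrow> ('n wpath \<Rightarrow> 'n wpath) \<Rightarrow> bool" where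
  "has_sobolev_deriv \<mu> \<phi> D \<longleftrightarrow>
     \<phi> \<in> borel_measurable (completion \<mu>) \<and> integrable (completion \<mu>) (\<lambda>w. (\<phi> w)\<^sup>2) \<and>
     D \<in> measurable (completion \<mu>) \<mu> \<and> (\<integral>\<^sup>+ w. cm_energy (D w) \<partial>completion \<mu>) < \<infinity> \<and>
     (\<exists>F DF. (\<forall>n. cylindrical_deriv (F n) (DF n)) \<and>
        (\<lambda>n. \<integral>\<^sup>+ w. ennreal ((F n w - \<phi> w)\<^sup>2) \<partial>completion \<mu>) \<longlonglongrightarrow> 0 \<and>
        (\<lambda>n. \<integral>\<^sup>+ w. cm_energy (\<lambda>s. DF n w s - D w s) \<partial>completion \<mu>) \<longlonglongrightarrow> 0)"

text \<open>
  Convexity of \<open>h \<mapsto> \<phi>(\<sqdot> + h) + |h|\<^sub>H\<^sup>2 / 2\<close> as a map into \<open>L\<^sup>0(\<mu>)\<close>: the exceptional null set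
  may depend on \<open>h\<close>, \<open>k\<close> and \<open>a\<close>.
\<close>

definition one_convex :: "('n::finite) wpath measure \<Rightarrow> ('n wpath \<Rightarrow> real) \<Rightarrow> bool" where
  "one_convex \<mu> \<phi> \<longleftrightarrow>
     (let \<Phi> = (\<lambda>h x. \<phi> (\<lambda>s. x s + h s) + 1/2 * enn2real (cm_energy h)) in
      \<forall>h\<in>cm_space. \<forall>k\<in>cm_space. \<forall>a\<in>{0..1::real}.
        AE x in \<mu>. \<Phi> (\<lambda>s. a *\<^sub>R h s + (1 - a) *\<^sub>R k s) x \<le> a * \<Phi> h x + (1 - a) * \<Phi> k x)"


section \<open>The Monge problem\<close>

definition transports ::
  "('n::finite) wpath measure \<Rightarrow> 'n wpath measure \<Rightarrow> ('n wpath \<Rightarrow> 'n wpath) \<Rightarrow> bool" where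
  "transports \<mu> \<nu> T \<longleftrightarrow>
     T \<in> measurable (completion \<mu>) \<mu> \<and> distr (completion \<mu>) \<mu> T = \<nu>"

definition monge_cost ::
  "('n::finite) wpath measure \<Rightarrow> ('n wpath \<Rightarrow> 'n wpath) \<Rightarrow> ennreal" where
  "monge_cost \<mu> T = (\<integral>\<^sup>+ w. cm_energy (\<lambda>s. w s - T w s) \<partial>completion \<mu>)"

definition unique_monge_solution ::
  "('n::finite) wpath measure \<Rightarrow> 'n wpath measure \<Rightarrow> ('n wpath \<Rightarrow> 'n wpath) \<Rightarrow> bool" where
  "unique_monge_solution \<mu> \<nu> T \<longleftrightarrow>
     transports \<mu> \<nu> T \<and>
     (\<forall>S. transports \<mu> \<nu> S \<longrightarrow> monge_cost \<mu> T \<le> monge_cost \<mu> S) \<and>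
     (\<forall>S. transports \<mu> \<nu> S \<and> monge_cost \<mu> S = monge_cost \<mu> T \<longrightarrow> (AE w in \<mu>. S w = T w))"

definition monge_transport_map ::
  "('n::finite) wpath measure \<Rightarrow> 'n wpath measure \<Rightarrow> ('n wpath \<Rightarrow> real) \<Rightarrow>
   ('n wpath \<Rightarrow> 'n wpath) \<Rightarrow> bool" where
  "monge_transport_map \<mu> \<nu> \<phi> T \<longleftrightarrow>
     one_convex \<mu> \<phi> \<and>
     (\<exists>D. has_sobolev_deriv \<mu> \<phi> D \<and> (AE w in \<mu>. T w = (\<lambda>t. w t + D w t))) \<and>
     unique_monge_solution \<mu> \<nu> T"


section \<open>Strong solutions\<close>

text \<open>
  \<open>U\<close> solves \<open>U\<^sub>t = X\<^sub>t - \<integral>\<^sub>0\<^sup>t u\<^sub>s \<circ> U ds\<close> and is adapted to the filtration of the driving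
  process \<open>X\<close>.  The drift \<open>u\<close> is a class of processes modulo \<open>\<mu>\<close>-null sets, and \<open>u\<^sub>s \<circ> U\<close> is well
  defined on classes exactly when the image of \<open>\<mu>\<close> under \<open>U\<close> is absolutely continuous.
\<close>

definition strong_solution ::
  "('n::finite) wpath measure \<Rightarrow> (real \<Rightarrow> 'n wpath \<Rightarrow> real ^ 'n) \<Rightarrow>
   ('n wpath \<Rightarrow> 'n wpath) \<Rightarrow> ('n wpath \<Rightarrow> 'n wpath) \<Rightarrow> bool" where
  "strong_solution \<mu> u X U \<longleftrightarrow>
     abs_cont_map \<mu> U \<and>
     (\<forall>t\<in>{0..1}. (\<lambda>w. U w t) \<in> borel_measurable (aug_filtration \<mu> X t)) \<and>
     (AE w in \<mu>. \<forall>t\<in>{0..1}. U w t = X w t - (LBINT s:{0..t}. u s (U w)))"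

end

theory Submission
  imports Defs
begin

text \<open>
  Everything rests on two uniqueness-in-law statements.  First, \<open>V\<close> is a Brownian motion under
  \<open>\<nu> = L \<cdot> \<mu>\<close> for the canonical filtration: this is immediate for simple drifts (a shift of Gaussian
  densities on each cell of the grid) and passes to the limit by Scheffe's lemma because \<open>E[L] = 1\<close>.
  Hence \<open>B = V \<circ> T\<close> has law \<open>\<mu>\<close>.  Second, every strong solution \<open>X\<close>, whatever Brownian motion \<open>B\<close>
  drives it, has law \<open>\<nu>\<close>: Girsanov for the simple drifts \<open>-u\<^sub>n \<circ> X\<close> and Fatou's lemma give
  \<open>E[F(X) / L(X)] \<le> E[F]\<close> for \<open>F \<ge> 0\<close>, so the law of \<open>X\<close> is bounded by \<open>\<nu>\<close>, and both have mass one.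

  The three properties are then proved in a cycle.  An inverse of \<open>V\<close> solves the equation driven by
  \<open>W\<close>, and it is adapted.  If \<open>U\<close> solves that equation, then \<open>U \<circ> B\<close> solves the one driven by \<open>B\<close>.
  Finally a solution \<open>X\<close> driven by \<open>B\<close> factors as \<open>X = U \<circ> B\<close>, and \<open>V \<circ> X = B\<close> with \<open>X\<close> of law
  \<open>\<nu> \<sim> \<mu>\<close> makes \<open>U\<close> a two-sided inverse of \<open>V\<close>.
\<close>

section \<open>Gaussian vectors\<close>

text \<open>Why one limit yields an identity and the other only an inequality: the exponentials of
  the simple drifts converge almost surely in both cases, but along a solution \<open>X\<close> the
  limit is \<open>1 / L(X)\<close>, and that this has mean one amounts to the claim itself. Why an
  inverse of \<open>V\<close> cannot look ahead, although it is a functional of the whole driving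
  path: \<open>V\<close> is a Brownian motion under \<nu> for the canonical filtration and not
  merely for the one it generates. Whatever the original path reveals up to time \<open>r\<close> is
  therefore independent of the later increments of \<open>V\<close>. Why absolute continuity
  accompanies every map: the drift is a class modulo null sets, and its simple approximations
  converge only almost surely. Evaluating them along another map makes sense, and their convergence
  survives, as soon as null sets have null preimages. The same property allows maps to be composed
  that are measurable only with respect to the completion.\<close>

definition gauss_vec :: "real \<Rightarrow> (real ^ 'n::finite) measure" where
  "gauss_vec d = distr (\<Pi>\<^sub>M i\<in>(UNIV::'n set). density lborel (\<lambda>x. ennreal (normal_density 0 (sqrt d) x)))
     borel (\<lambda>x. \<chi> i. x i)"

lemma measurable_vec_lambda_PiM:
  "(\<lambda>x. \<chi> i. x i) \<in> (\<Pi>\<^sub>M i\<in>(UNIV::'n::finite set). (borel :: real measure)) \<rightarrow>\<^sub>M (borel :: (real ^ 'n) measure)"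
proof (rule borel_measurable_euclidean_space[THEN iffD2], rule ballI)
  fix b :: "real ^ 'n" assume "b \<in> Basis"
  then obtain i where b: "b = axis i 1" by (auto simp: Basis_vec_def)
  have "(\<lambda>x. (\<chi> i. x i) \<bullet> b) = (\<lambda>x. x i)"
    by (auto simp: b inner_axis)
  then show "(\<lambda>x. (\<chi> i. x i) \<bullet> b) \<in> (\<Pi>\<^sub>M i\<in>(UNIV::'n set). borel) \<rightarrow>\<^sub>M borel"
    by simp
qed

lemma sets_gauss_vec [simp, measurable_cong]: "sets (gauss_vec d) = sets borel"
  and space_gauss_vec [simp]: "space (gauss_vec d) = UNIV"
  by (simp_all add: gauss_vec_def)

lemma measurable_gauss_vec_aux [measurable]:
  "(\<lambda>x. \<chi> i. x i) \<in> (\<Pi>\<^sub>M i\<in>(UNIV::'n::finite set). density lborel (\<lambda>x. ennreal (normal_density 0 s x)))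
      \<rightarrow>\<^sub>M (borel :: (real ^ 'n) measure)"
proof -
  have "sets (\<Pi>\<^sub>M i\<in>(UNIV::'n set). density lborel (\<lambda>x. ennreal (normal_density 0 s x)))
      = sets (\<Pi>\<^sub>M i\<in>(UNIV::'n set). (borel :: real measure))"
    by (intro sets_PiM_cong) auto
  from measurable_vec_lambda_PiM show ?thesis
    by (simp only: measurable_cong_sets[OF \<open>sets _ = _\<close> refl])
qed

lemma prob_space_gauss_vec: "d > 0 \<Longrightarrow> prob_space (gauss_vec d)"
  unfolding gauss_vec_def
  by (intro prob_space.prob_space_distr prob_space_PiM prob_space_normal_density) auto

text \<open>Completing the square. This is Girsanov's theorem in dimension one for the constant
  drift \<open>c\<close> over a time span \<open>d\<close>: under the weighted law,
  \<open>x + d * c\<close> is again centred with variance \<open>d\<close>.\<close>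

lemma normal_density_shift:
  assumes "d > 0"
  shows "normal_density 0 (sqrt d) x * exp (- c * x - d * c\<^sup>2 / 2) = normal_density 0 (sqrt d) (x + d * c)"
proof -
  have "- x\<^sup>2 / (2 * d) + (- c * x - d * c\<^sup>2 / 2) = - (x + d * c)\<^sup>2 / (2 * d)"
    using assms by (simp add: field_simps power2_eq_square)
  then show ?thesis using assms
    by (simp add: normal_density_def flip: exp_add)
qed

lemma nn_integral_normal_shift:
  assumes "d > 0" and [measurable]: "g \<in> borel_measurable borel"
  shows "(\<integral>\<^sup>+ x. g (x + d * c) * ennreal (exp (- c * x - d * c\<^sup>2 / 2)) \<partial>density lborel (\<lambda>x. ennreal (normal_density 0 (sqrt d) x)))
    = (\<integral>\<^sup>+ x. g x \<partial>density lborel (\<lambda>x. ennreal (normal_density 0 (sqrt d) x)))"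
proof -
  have "(\<integral>\<^sup>+ x. g (x + d * c) * ennreal (exp (- c * x - d * c\<^sup>2 / 2)) \<partial>density lborel (\<lambda>x. ennreal (normal_density 0 (sqrt d) x)))
     = (\<integral>\<^sup>+ x. ennreal (normal_density 0 (sqrt d) x * exp (- c * x - d * c\<^sup>2 / 2)) * g (x + d * c) \<partial>lborel)"
    by (subst nn_integral_density) (auto simp: ennreal_mult' ac_simps intro!: nn_integral_cong)
  also have "\<dots> = (\<integral>\<^sup>+ x. ennreal (normal_density 0 (sqrt d) (d * c + 1 * x)) * g (d * c + 1 * x) \<partial>lborel)"
    by (simp only: normal_density_shift[OF assms(1)]) (simp add: ac_simps)
  also have "\<dots> = (\<integral>\<^sup>+ x. ennreal (normal_density 0 (sqrt d) x) * g x \<partial>lborel)"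
    by (subst nn_integral_real_affine[where c=1 and t="d*c"]) auto
  finally show ?thesis by (subst (2) nn_integral_density) auto
qed

text \<open>Both the exponential weight and the shift factor over the coordinates. Hence the
  weighted and shifted product measure can be compared with the original one on boxes, where the
  one-dimensional formula applies to each factor.\<close>

lemma nn_integral_gauss_vec_shift:
  fixes c :: "real ^ 'n::finite"
  assumes d: "d > 0" and g [measurable]: "g \<in> borel_measurable borel"
  shows "(\<integral>\<^sup>+ x. g (x + d *\<^sub>R c) * ennreal (exp (- (c \<bullet> x) - d * (norm c)\<^sup>2 / 2)) \<partial>gauss_vec d)
    = (\<integral>\<^sup>+ x. g x \<partial>gauss_vec d)"
proof -
  let ?n = "density lborel (\<lambda>x. ennreal (normal_density 0 (sqrt d) x))"
  interpret n: prob_space ?n using d by (intro prob_space_normal_density) auto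
  interpret P: product_sigma_finite "\<lambda>_::'n. ?n" ..
  let ?P = "\<Pi>\<^sub>M i\<in>(UNIV::'n set). ?n"
  let ?e = "\<lambda>x. \<Prod>i\<in>UNIV. ennreal (exp (- (c $ i) * x i - d * (c $ i)\<^sup>2 / 2))"
  let ?s = "\<lambda>x. \<lambda>i\<in>(UNIV::'n set). x i + d * c $ i"
  have e: "?e x = ennreal (exp (- (c \<bullet> (\<chi> i. x i)) - d * (norm c)\<^sup>2 / 2))" for x
  proof -
    have "?e x = ennreal (exp (\<Sum>i\<in>UNIV. - (c $ i) * x i - d * (c $ i)\<^sup>2 / 2))"
      by (simp add: prod_ennreal exp_sum)
    also have "(\<Sum>i\<in>UNIV. - (c $ i) * x i - d * (c $ i)\<^sup>2 / 2) = - (c \<bullet> (\<chi> i. x i)) - d * (norm c)\<^sup>2 / 2"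
    proof -
      have "(norm c)\<^sup>2 = (\<Sum>i\<in>UNIV. (c $ i)\<^sup>2)"
        by (simp only: power2_norm_eq_inner) (simp add: inner_vec_def power2_eq_square)
      then show ?thesis
        by (simp add: sum_subtractf inner_vec_def sum_negf sum_distrib_left sum_divide_distrib)
    qed
    finally show ?thesis .
  qed
  have [measurable]: "?s \<in> ?P \<rightarrow>\<^sub>M ?P"
    by (intro measurable_restrict) measurable
  have "distr (density ?P ?e) ?P ?s = ?P"
  proof (rule P.PiM_eqI)
    fix A :: "'n \<Rightarrow> real set" assume "\<And>i. i \<in> UNIV \<Longrightarrow> A i \<in> sets ?n"
    then have A [measurable]: "A i \<in> sets borel" for i by auto
    have "emeasure (distr (density ?P ?e) ?P ?s) (Pi\<^sub>E UNIV A)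
       = (\<integral>\<^sup>+x. indicator (Pi\<^sub>E UNIV A) x \<partial>distr (density ?P ?e) ?P ?s)"
      by (intro nn_integral_indicator[symmetric]) (auto intro!: sets_PiM_I_finite)
    also have "\<dots> = (\<integral>\<^sup>+x. ?e x * indicator (Pi\<^sub>E UNIV A) (?s x) \<partial>?P)"
    proof -
      have [measurable]: "Pi\<^sub>E UNIV A \<in> sets ?P" by (intro sets_PiM_I_finite) auto
      have [measurable]: "?e \<in> borel_measurable ?P" by measurable
      show ?thesis
        by (subst nn_integral_distr) (auto simp: nn_integral_density)
    qed
    also have "\<dots> = (\<integral>\<^sup>+x. (\<Prod>i\<in>UNIV. indicator (A i) (x i + d * c $ i) * ennreal (exp (- (c $ i) * x i - d * (c $ i)\<^sup>2 / 2))) \<partial>?P)"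
    proof (intro nn_integral_cong)
      fix x
      have "indicator (Pi\<^sub>E UNIV A) (?s x) = (\<Prod>i\<in>UNIV. indicator (A i) (x i + d * c $ i) :: ennreal)"
        by (simp add: indicator_def PiE_iff Pi_iff)
      then show "?e x * indicator (Pi\<^sub>E UNIV A) (?s x) = (\<Prod>i\<in>UNIV. indicator (A i) (x i + d * c $ i) * ennreal (exp (- (c $ i) * x i - d * (c $ i)\<^sup>2 / 2)))"
        by (simp add: prod.distrib mult.commute)
    qed
    also have "\<dots> = (\<Prod>i\<in>UNIV. \<integral>\<^sup>+x. indicator (A i) (x + d * c $ i) * ennreal (exp (- (c $ i) * x - d * (c $ i)\<^sup>2 / 2)) \<partial>?n)"
      by (rule P.product_nn_integral_prod) auto
    also have "\<dots> = (\<Prod>i\<in>UNIV. emeasure ?n (A i))"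
      by (intro prod.cong refl, subst nn_integral_normal_shift[OF d]) auto
    finally show "emeasure (distr (density ?P ?e) ?P ?s) (Pi\<^sub>E UNIV A) = (\<Prod>i\<in>UNIV. emeasure ?n (A i))" .
  qed auto
  note eq = this
  have "(\<integral>\<^sup>+ x. g x \<partial>gauss_vec d) = (\<integral>\<^sup>+ x. g (\<chi> i. x i) \<partial>?P)"
    unfolding gauss_vec_def by (subst nn_integral_distr) auto
  also have "\<dots> = (\<integral>\<^sup>+ x. g (\<chi> i. x i) \<partial>distr (density ?P ?e) ?P ?s)"
    by (simp only: eq)
  also have "\<dots> = (\<integral>\<^sup>+ x. ?e x * g (\<chi> i. ?s x i) \<partial>?P)"
  proof -
    have [measurable]: "?e \<in> borel_measurable ?P" by measurable
    show ?thesis by (subst nn_integral_distr) (auto simp: nn_integral_density)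
  qed
  also have "\<dots> = (\<integral>\<^sup>+ x. g ((\<chi> i. x i) + d *\<^sub>R c) * ennreal (exp (- (c \<bullet> (\<chi> i. x i)) - d * (norm c)\<^sup>2 / 2)) \<partial>?P)"
    by (intro nn_integral_cong, simp only: e) (simp add: mult.commute plus_vec_def scaleR_vec_def)
  also have "\<dots> = (\<integral>\<^sup>+ x. g (x + d *\<^sub>R c) * ennreal (exp (- (c \<bullet> x) - d * (norm c)\<^sup>2 / 2)) \<partial>gauss_vec d)"
    unfolding gauss_vec_def by (subst nn_integral_distr) auto
  finally show ?thesis ..
qed

section \<open>Processes with independent Gaussian increments\<close>

text \<open>
  The increments of \<open>X\<close> after time \<open>t\<close> are those of a Brownian motion with respect to \<open>G\<close>; this is
  only demanded over intervals without an element of \<open>E\<close> in the interior.  After a change of measure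
  by a simple drift, \<open>E\<close> is the grid of the drift.
\<close>

definition bm_from ::
  "'a measure \<Rightarrow> (real \<Rightarrow> 'a measure) \<Rightarrow> (real \<Rightarrow> 'a \<Rightarrow> real ^ 'n::finite) \<Rightarrow> real \<Rightarrow> real set \<Rightarrow> bool" where
  "bm_from M G X t E \<longleftrightarrow> prob_space M \<and> 0 \<le> t \<and>
     (\<forall>r\<in>{0..1}. subalgebra M (G r) \<and> X r \<in> borel_measurable (G r)) \<and>
     (\<forall>a b. 0 \<le> a \<and> a \<le> b \<and> b \<le> 1 \<longrightarrow> sets (G a) \<subseteq> sets (G b)) \<and>
     (\<forall>a b. t \<le> a \<and> a < b \<and> b \<le> 1 \<and> {a<..<b} \<inter> E = {} \<longrightarrow> (\<forall>A\<in>sets (G a). \<forall>C\<in>sets borel.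
        emeasure M (A \<inter> {w\<in>space M. X b w - X a w \<in> C}) = emeasure M A * emeasure (gauss_vec (b - a)) C))"

lemma bm_fromD:
  assumes "bm_from M G X t E"
  shows "prob_space M" "0 \<le> t"
    "\<And>r. 0 \<le> r \<Longrightarrow> r \<le> 1 \<Longrightarrow> subalgebra M (G r)"
    "\<And>r. 0 \<le> r \<Longrightarrow> r \<le> 1 \<Longrightarrow> X r \<in> borel_measurable (G r)"
    "\<And>a b. 0 \<le> a \<Longrightarrow> a \<le> b \<Longrightarrow> b \<le> 1 \<Longrightarrow> subalgebra (G b) (G a)"
    "\<And>a b A C. t \<le> a \<Longrightarrow> a < b \<Longrightarrow> b \<le> 1 \<Longrightarrow> {a<..<b} \<inter> E = {} \<Longrightarrow> A \<in> sets (G a) \<Longrightarrow> C \<in> sets borel \<Longrightarrow>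
        emeasure M (A \<inter> {w\<in>space M. X b w - X a w \<in> C}) = emeasure M A * emeasure (gauss_vec (b - a)) C"
proof -
  show "subalgebra (G b) (G a)" if "0 \<le> a" "a \<le> b" "b \<le> 1" for a b
  proof -
    have "subalgebra M (G a)" "subalgebra M (G b)" "sets (G a) \<subseteq> sets (G b)"
      using assms that unfolding bm_from_def by auto
    then show ?thesis by (auto simp: subalgebra_def)
  qed
qed (use assms in \<open>auto simp: bm_from_def\<close>)

lemma bm_from_mono:
  assumes "bm_from M G X t E" "t \<le> t'" "E \<subseteq> E'"
  shows "bm_from M G X t' E'"
proof -
  have "{a<..<b} \<inter> E = {}" if "{a<..<b} \<inter> E' = {}" for a b :: real
    using that assms(3) by blast
  moreover have "t \<le> a" if "t' \<le> a" for a using that assms(2) by simp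
  ultimately show ?thesis using assms(1,2) unfolding bm_from_def by (meson order.trans)
qed

lemma bm_from_measurable:
  assumes "bm_from M G X t E" "0 \<le> r" "r \<le> s" "s \<le> 1"
  shows "X r \<in> borel_measurable (G s)"
  using bm_fromD(4)[OF assms(1), of r] bm_fromD(5)[OF assms(1), of r s] assms(2-)
  by (auto intro: measurable_from_subalg)

lemma bm_from_measurable_M:
  assumes "bm_from M G X t E" "0 \<le> r" "r \<le> 1"
  shows "X r \<in> borel_measurable M"
  using bm_fromD(4)[OF assms(1), of r] bm_fromD(3)[OF assms(1), of r] assms(2-)
  by (auto intro: measurable_from_subalg)

text \<open>On rectangles the independence clause of \<open>bm_from\<close> says that
  \<open>w\<close>, seen through \<open>G a\<close>, and the increment have a product law. Tonelli
  then integrates the increment out while everything known at time \<open>a\<close> stays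
  frozen.\<close>

lemma bm_from_nn_integral:
  fixes X :: "real \<Rightarrow> 'a \<Rightarrow> real ^ 'n::finite"
  assumes bm: "bm_from M G X t E" and ab: "t \<le> a" "a < b" "b \<le> 1" "{a<..<b} \<inter> E = {}"
    and \<Phi>: "(\<lambda>(w, y). \<Phi> w y) \<in> borel_measurable (G a \<Otimes>\<^sub>M borel)"
  shows "(\<integral>\<^sup>+w. \<Phi> w (X b w - X a w) \<partial>M) = (\<integral>\<^sup>+w. \<integral>\<^sup>+y. \<Phi> w y \<partial>gauss_vec (b - a) \<partial>M)"
proof -
  let ?R = "restr_to_subalg M (G a)" and ?g = "gauss_vec (b - a) :: (real ^ 'n) measure"
  let ?D = "distr M (G a \<Otimes>\<^sub>M borel) (\<lambda>w. (w, X b w - X a w))"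
  have a: "0 \<le> a" "a \<le> 1" using bm_fromD(2)[OF bm] ab by auto
  note sub = bm_fromD(3)[OF bm a]
  interpret M: prob_space M by (rule bm_fromD(1)[OF bm])
  interpret R: prob_space ?R
    by (rule prob_space_restr_to_subalg[OF sub M.prob_space_axioms])
  interpret g: prob_space ?g using ab by (intro prob_space_gauss_vec) auto
  have [measurable]: "X a \<in> borel_measurable M" "X b \<in> borel_measurable M"
    using a ab by (auto intro!: bm_from_measurable_M[OF bm])
  have id [measurable]: "(\<lambda>w. w) \<in> M \<rightarrow>\<^sub>M G a"
    using sub by (auto simp: measurable_def subalgebra_def)
  have [measurable_cong]: "sets ?R = sets (G a)" by (rule sets_restr_to_subalg[OF sub])
  have "?R \<Otimes>\<^sub>M ?g = ?D"
  proof (rule pair_measure_eqI)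
    fix A B assume A: "A \<in> sets ?R" and B: "B \<in> sets ?g"
    then have A': "A \<in> sets (G a)" and B': "B \<in> sets borel" by (simp_all add: sets_restr_to_subalg[OF sub])
    have "emeasure ?D (A \<times> B) = emeasure M (A \<inter> {w\<in>space M. X b w - X a w \<in> B})"
      using A' B' sub by (subst emeasure_distr) (auto intro!: arg_cong[where f="emeasure M"] simp: subalgebra_def)
    then show "emeasure ?R A * emeasure ?g B = emeasure ?D (A \<times> B)"
      using bm_fromD(6)[OF bm ab A' B'] by (simp add: emeasure_restr_to_subalg[OF sub A'])
  qed (auto intro!: sets_pair_measure_cong R.sigma_finite_measure g.sigma_finite_measure simp: sets_restr_to_subalg[OF sub])
  note eq = this
  have \<Phi>' [measurable]: "(\<lambda>(w, y). \<Phi> w y) \<in> borel_measurable (?R \<Otimes>\<^sub>M ?g)"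
    using \<Phi> by (subst measurable_cong_sets[OF sets_pair_measure_cong refl]) (auto simp: sets_restr_to_subalg[OF sub])
  have "(\<integral>\<^sup>+w. \<Phi> w (X b w - X a w) \<partial>M) = (\<integral>\<^sup>+p. (\<lambda>(w, y). \<Phi> w y) p \<partial>?D)"
    using \<Phi> by (subst nn_integral_distr) auto
  also have "\<dots> = (\<integral>\<^sup>+p. (\<lambda>(w, y). \<Phi> w y) p \<partial>(?R \<Otimes>\<^sub>M ?g))" by (simp only: eq)
  also have "\<dots> = (\<integral>\<^sup>+w. \<integral>\<^sup>+y. \<Phi> w y \<partial>?g \<partial>?R)"
    by (subst g.nn_integral_fst[symmetric]) (use \<Phi>' in auto)
  also have "\<dots> = (\<integral>\<^sup>+w. \<integral>\<^sup>+y. \<Phi> w y \<partial>?g \<partial>M)"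
  proof (rule nn_integral_subalgebra2[OF sub])
    have "(\<lambda>w. \<integral>\<^sup>+y. \<Phi> w y \<partial>?g) \<in> borel_measurable ?R"
      using g.borel_measurable_nn_integral[OF \<Phi>'] by simp
    then show "(\<lambda>w. \<integral>\<^sup>+y. \<Phi> w y \<partial>?g) \<in> borel_measurable (G a)"
      by (rule measurable_in_subalg'[OF sub])
  qed
  finally show ?thesis .
qed

lemma prod_insert_fun_upd:
  assumes "finite T" "a \<notin> T"
  shows "(\<Prod>r\<in>insert a T. (g(a := h)) r (x r)) = h (x a) * (\<Prod>r\<in>T. g r (x r))"
  using assms by (simp add: prod.insert) (intro arg_cong2[where f="(*)"] prod.cong refl, auto)

text \<open>
  The law of the increments is removed from the latest time of the cylinder by conditioning, which
  turns the factor at that time into one at the preceding time.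
\<close>

proposition bm_from_cylinder_eq:
  fixes X1 :: "real \<Rightarrow> 'a \<Rightarrow> real ^ 'n::finite" and X2 :: "real \<Rightarrow> 'b \<Rightarrow> real ^ 'n"
    and g :: "real \<Rightarrow> real ^ 'n \<Rightarrow> ennreal"
  assumes bm1: "bm_from M1 G1 X1 t E" and bm2: "bm_from M2 G2 X2 t E"
    and t: "t \<le> 1" and E: "finite E"
    and Z1: "Z1 \<in> borel_measurable (G1 t)" and Z2: "Z2 \<in> borel_measurable (G2 t)"
    and base: "\<And>T (g :: real \<Rightarrow> real ^ 'n \<Rightarrow> ennreal). finite T \<Longrightarrow> T \<subseteq> {0..t} \<Longrightarrow> (\<And>r. g r \<in> borel_measurable borel) \<Longrightarrow>
      (\<integral>\<^sup>+w. Z1 w * (\<Prod>r\<in>T. g r (X1 r w)) \<partial>M1) = (\<integral>\<^sup>+w. Z2 w * (\<Prod>r\<in>T. g r (X2 r w)) \<partial>M2)"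
    and T: "finite T" "T \<subseteq> {0..1}" and g: "\<And>r. g r \<in> borel_measurable borel"
  shows "(\<integral>\<^sup>+w. Z1 w * (\<Prod>r\<in>T. g r (X1 r w)) \<partial>M1) = (\<integral>\<^sup>+w. Z2 w * (\<Prod>r\<in>T. g r (X2 r w)) \<partial>M2)"
proof -
  have t0: "0 \<le> t" by (rule bm_fromD(2)[OF bm1])
  \<comment> \<open>The last condition makes \<open>T\<close> contain every grid point after
    \<open>t\<close> that lies below one of its elements. Then no grid point separates the latest
    time from its predecessor, and the increment between them has its Gaussian law.\<close>
  have "(\<integral>\<^sup>+w. Z1 w * (\<Prod>r\<in>T. g r (X1 r w)) \<partial>M1) = (\<integral>\<^sup>+w. Z2 w * (\<Prod>r\<in>T. g r (X2 r w)) \<partial>M2)"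
    if "finite T" "T \<subseteq> {0..1}" "\<And>r. g r \<in> borel_measurable borel"
      "\<And>e s. e \<in> E \<Longrightarrow> t < e \<Longrightarrow> s \<in> T \<Longrightarrow> e \<le> s \<Longrightarrow> e \<in> T"
    for T and g :: "real \<Rightarrow> real ^ 'n \<Rightarrow> ennreal"
    using that
  proof (induction "card {r\<in>T. t < r}" arbitrary: T g)
    case 0
    then have "{r\<in>T. t < r} = {}" by simp
    then have "r \<le> t" if "r \<in> T" for r using that by (auto simp: not_less)
    then have "T \<subseteq> {0..t}" using 0(3) by fastforce
    then show ?case using 0 by (intro base) auto
  next
    case (Suc n)
    note [measurable] = Suc.prems(3)
    define b where "b = Max T"
    have "{r\<in>T. t < r} \<noteq> {}" using Suc(2) by (metis card.empty nat.distinct(1))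
    then obtain r0 where r0: "r0 \<in> T" "t < r0" by auto
    have b: "b \<in> T" "\<And>r. r \<in> T \<Longrightarrow> r \<le> b" using r0 Suc.prems(1) by (auto simp: b_def intro!: Max_in)
    have tb: "t < b" using b(2)[OF r0(1)] r0(2) by simp
    have b1: "b \<le> 1" using b Suc.prems by auto
    \<comment> \<open>Adding \<open>t\<close> provides a predecessor of \<open>b\<close> even when
      \<open>b\<close> is the smallest element of \<open>T\<close>.\<close>
    define S where "S = insert t (T - {b})"
    define a where "a = Max S"
    have finS: "finite S" using Suc.prems by (auto simp: S_def)
    have "S \<noteq> {}" by (simp add: S_def)
    have a: "a \<in> S" "\<And>r. r \<in> S \<Longrightarrow> r \<le> a"
      using Max_in[OF finS \<open>S \<noteq> {}\<close>] Max_ge[OF finS] by (simp_all add: a_def)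
    have ta: "t \<le> a" using a(2)[of t] by (auto simp: S_def)
    have ab: "a < b" using a(1) b tb by (auto simp: S_def less_le)
    have cell: "{a<..<b} \<inter> E = {}"
    proof (rule ccontr)
      assume "{a<..<b} \<inter> E \<noteq> {}"
      then obtain e where e: "e \<in> {a<..<b}" "e \<in> E" by blast
      then have "e \<in> T" using Suc.prems(4)[of e b] b ta by auto
      then have "e \<in> S" using e by (auto simp: S_def)
      then show False using a(2)[of e] e by auto
    qed
    define k where "k x = (\<integral>\<^sup>+y. g b (x + y) \<partial>gauss_vec (b - a))" for x
    interpret \<gamma>: prob_space "gauss_vec (b - a) :: (real ^ 'n) measure"
      using ab by (intro prob_space_gauss_vec) auto
    have k [measurable]: "k \<in> borel_measurable borel"
      unfolding k_def by measurable
    \<comment> \<open>The factor 1 covers the case that the predecessor \<open>a\<close> is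
      \<open>t\<close> itself and was not a time of the cylinder.\<close>
    define g' where "g' = g(a := (\<lambda>x. (if a \<in> T then g a x else 1) * k x))"
    let ?T' = "insert a (T - {b})"
    have g' [measurable]: "g' r \<in> borel_measurable borel" for r
      by (auto simp: g'_def)
    have step: "(\<integral>\<^sup>+w. Z w * (\<Prod>r\<in>T. g r (X r w)) \<partial>M) = (\<integral>\<^sup>+w. Z w * (\<Prod>r\<in>?T'. g' r (X r w)) \<partial>M)"
      if bm: "bm_from M G X t E" and Z: "Z \<in> borel_measurable (G t)"
      for M :: "'c measure" and G X Z
    proof -
      have [measurable]: "X r \<in> borel_measurable (G a)" if "r \<in> T - {b}" for r
      proof (rule bm_from_measurable[OF bm])
        show "0 \<le> r" "r \<le> a" "a \<le> 1" using that Suc.prems(2) a(2)[of r] ab b1 by (auto simp: S_def)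
      qed
      have [measurable]: "X a \<in> borel_measurable (G a)"
        using ta t0 ab b1 by (intro bm_from_measurable[OF bm]) auto
      have [measurable]: "Z \<in> borel_measurable (G a)"
        using bm_fromD(5)[OF bm t0 ta] ab b1 Z by (auto intro: measurable_from_subalg)
      define \<Phi> where "\<Phi> w y = Z w * ((\<Prod>r\<in>T-{b}. g r (X r w)) * g b (X a w + y))" for w y
      have \<Phi>: "(\<lambda>(w, y). \<Phi> w y) \<in> borel_measurable (G a \<Otimes>\<^sub>M borel)"
        unfolding \<Phi>_def by measurable
      have "(\<integral>\<^sup>+w. Z w * (\<Prod>r\<in>T. g r (X r w)) \<partial>M) = (\<integral>\<^sup>+w. \<Phi> w (X b w - X a w) \<partial>M)"
        using Suc.prems(1) b(1) by (auto simp: \<Phi>_def prod.remove[of T b] ac_simps intro!: nn_integral_cong)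
      also have "\<dots> = (\<integral>\<^sup>+w. \<integral>\<^sup>+y. \<Phi> w y \<partial>gauss_vec (b - a) \<partial>M)"
        by (rule bm_from_nn_integral[OF bm ta ab b1 cell \<Phi>])
      also have "\<dots> = (\<integral>\<^sup>+w. Z w * ((\<Prod>r\<in>T-{b}. g r (X r w)) * k (X a w)) \<partial>M)"
        unfolding \<Phi>_def k_def by (simp add: nn_integral_cmult mult.assoc)
      also have "\<dots> = (\<integral>\<^sup>+w. Z w * (\<Prod>r\<in>?T'. g' r (X r w)) \<partial>M)"
      proof (intro nn_integral_cong arg_cong2[where f="(*)"] refl)
        fix w
        have T': "?T' = insert a (T - {b} - {a})" by auto
        have "(\<Prod>r\<in>?T'. g' r (X r w)) = (if a \<in> T then g a (X a w) else 1) * k (X a w) * (\<Prod>r\<in>T-{b}-{a}. g r (X r w))"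
          unfolding T' g'_def using Suc.prems(1) by (subst prod_insert_fun_upd) auto
        also have "\<dots> = (\<Prod>r\<in>T-{b}. g r (X r w)) * k (X a w)"
        proof (cases "a \<in> T")
          case True
          then have "a \<in> T - {b}" using ab by auto
          then have "(\<Prod>r\<in>T-{b}. g r (X r w)) = g a (X a w) * (\<Prod>r\<in>T-{b}-{a}. g r (X r w))"
            using Suc.prems(1) by (intro prod.remove) auto
          then show ?thesis using True by (simp add: ac_simps)
        qed (auto simp: ac_simps)
        finally show "(\<Prod>r\<in>T-{b}. g r (X r w)) * k (X a w) = (\<Prod>r\<in>?T'. g' r (X r w))" ..
      qed
      finally show ?thesis .
    qed
    have "{r \<in> ?T'. t < r} = {r\<in>T. t < r} - {b}"
      using a(1) ab by (auto simp: S_def)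
    moreover have "b \<in> {r\<in>T. t < r}" using b tb by auto
    ultimately have "card {r \<in> ?T'. t < r} = n" using Suc(2) Suc.prems(1) by simp
    then have "(\<integral>\<^sup>+w. Z1 w * (\<Prod>r\<in>?T'. g' r (X1 r w)) \<partial>M1) = (\<integral>\<^sup>+w. Z2 w * (\<Prod>r\<in>?T'. g' r (X2 r w)) \<partial>M2)"
    proof (intro Suc.hyps(1)[OF sym])
      show "?T' \<subseteq> {0..1}" using Suc.prems(2) ta t0 ab b1 by auto
      fix e s assume e: "e \<in> E" "t < e" "s \<in> ?T'" "e \<le> s"
      have "s \<le> a" using e(3) a(2) by (auto simp: S_def)
      then have "e \<noteq> b" "e \<le> b" using e ab by auto
      then show "e \<in> ?T'" using Suc.prems(4)[of e b] e b by auto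
    qed (use Suc.prems g' in auto)
    then show ?case using step[OF bm1 Z1] step[OF bm2 Z2] by simp
  qed
  note main = this
  \<comment> \<open>Enlarging \<open>T\<close> by all grid points, with the factor 1 there, changes
    no integral and secures the extra condition of \<open>main\<close>.\<close>
  let ?T = "T \<union> {e\<in>E. 0 \<le> e \<and> e \<le> 1}"
  let ?g = "\<lambda>r. if r \<in> T then g r else (\<lambda>_. 1)"
  have pr: "(\<Prod>r\<in>?T. ?g r (x r)) = (\<Prod>r\<in>T. g r (x r))" for x
    by (rule prod.mono_neutral_cong_right) (use T E in auto)
  have "(\<integral>\<^sup>+w. Z1 w * (\<Prod>r\<in>?T. ?g r (X1 r w)) \<partial>M1) = (\<integral>\<^sup>+w. Z2 w * (\<Prod>r\<in>?T. ?g r (X2 r w)) \<partial>M2)"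
    by (rule main) (use T E g t0 in auto)
  then show ?thesis by (simp only: pr)
qed

section \<open>Girsanov's theorem for simple drifts\<close>

definition simple_proc :: "(nat \<Rightarrow> real) \<Rightarrow> nat \<Rightarrow> (nat \<Rightarrow> 'a \<Rightarrow> real ^ 'n::finite) \<Rightarrow> real \<Rightarrow> 'a \<Rightarrow> real ^ 'n" where
  "simple_proc t k \<xi> s w = (\<Sum>j<k. indicat_real {t j<..t (Suc j)} s *\<^sub>R \<xi> j w)"

definition simple_drift :: "(nat \<Rightarrow> real) \<Rightarrow> nat \<Rightarrow> (nat \<Rightarrow> 'a \<Rightarrow> real ^ 'n::finite) \<Rightarrow> real \<Rightarrow> 'a \<Rightarrow> real ^ 'n" where
  "simple_drift t k \<xi> r w = (LBINT s:{0..r}. simple_proc t k \<xi> s w)"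

text \<open>The exponential martingale of the drift, evaluated at time \<open>r\<close>. The clamped
  time stops each increment of \<open>X\<close> at \<open>r\<close> and makes it vanish on cells
  that begin after \<open>r\<close>.\<close>

definition simple_exp :: "(nat \<Rightarrow> real) \<Rightarrow> nat \<Rightarrow> (nat \<Rightarrow> 'a \<Rightarrow> real ^ 'n::finite) \<Rightarrow> (real \<Rightarrow> 'a \<Rightarrow> real ^ 'n) \<Rightarrow> real \<Rightarrow> 'a \<Rightarrow> real" where
  "simple_exp t k \<xi> X r w =
     exp (- (\<Sum>j<k. \<xi> j w \<bullet> (X (max (t j) (min (t (Suc j)) r)) w - X (t j) w))
          - 1/2 * (LBINT s:{0..r}. (norm (simple_proc t k \<xi> s w))\<^sup>2))"

lemma norm_simple_proc_le: "norm (simple_proc t k \<xi> s w) \<le> (\<Sum>j<k. norm (\<xi> j w))"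
  unfolding simple_proc_def
  by (rule order.trans[OF norm_sum], rule sum_mono) (simp split: split_indicator)

lemma simple_proc_borel [measurable]: "(\<lambda>s. simple_proc t k \<xi> s w) \<in> borel_measurable borel"
  unfolding simple_proc_def by measurable

lemma set_integrable_simple_proc:
  fixes \<xi> :: "nat \<Rightarrow> 'a \<Rightarrow> real ^ 'n::finite"
  assumes [measurable]: "S \<in> sets borel" and "S \<subseteq> {0..1}"
  shows "set_integrable lborel S (\<lambda>s. simple_proc t k \<xi> s w)"
    and "set_integrable lborel S (\<lambda>s. (norm (simple_proc t k \<xi> s w))\<^sup>2)"
proof -
  have fin: "emeasure lborel S < \<infinity>"
    using emeasure_mono[OF assms(2), of lborel] by (auto simp: le_less_trans)
  show "set_integrable lborel S (\<lambda>s. simple_proc t k \<xi> s w)"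
    unfolding set_integrable_def
    by (rule integrableI_bounded_set_indicator[where B="\<Sum>j<k. norm (\<xi> j w)"])
       (use fin in \<open>auto intro!: AE_I2 norm_simple_proc_le\<close>)
  show "set_integrable lborel S (\<lambda>s. (norm (simple_proc t k \<xi> s w))\<^sup>2)"
    unfolding set_integrable_def
    by (rule integrableI_bounded_set_indicator[where B="(\<Sum>j<k. norm (\<xi> j w))\<^sup>2"])
       (use fin in \<open>auto intro!: AE_I2 power_mono norm_simple_proc_le\<close>)
qed

lemma set_integral_add_cell:
  fixes f :: "real \<Rightarrow> 'b::euclidean_space"
  assumes "0 \<le> a" "a < b" and f: "set_integrable lborel {0..b} f" and c: "\<And>s. a < s \<Longrightarrow> s \<le> b \<Longrightarrow> f s = c"
  shows "(LBINT s:{0..b}. f s) = (LBINT s:{0..a}. f s) + (b - a) *\<^sub>R c"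
proof -
  have "{0..b} = {0..a} \<union> {a<..b}" "{0..a} \<inter> {a<..b} = {}" using assms by auto
  then have "(LBINT s:{0..b}. f s) = (LBINT s:{0..a}. f s) + (LBINT s:{a<..b}. f s)"
    using assms by (simp only:, intro set_integral_Un) (auto intro: set_integrable_subset[OF f])
  also have "(LBINT s:{a<..b}. f s) = (LBINT s:{a<..b}. c)"
    by (rule set_lebesgue_integral_cong) (auto intro: c)
  also have "\<dots> = (b - a) *\<^sub>R c"
    using assms by (simp add: set_lebesgue_integral_def)
  finally show ?thesis .
qed

lemma set_integral_singleton [simp]:
  fixes f :: "real \<Rightarrow> 'b::euclidean_space"
  shows "(LBINT s:{a}. f s) = 0"
proof -
  have "(\<lambda>s. indicat_real {a} s *\<^sub>R f s) = (\<lambda>s. indicat_real {a} s *\<^sub>R f a)"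
    by (auto simp: indicator_def)
  then show ?thesis by (simp add: set_lebesgue_integral_def)
qed

locale simple_girsanov =
  fixes M :: "'a measure" and G and X :: "real \<Rightarrow> 'a \<Rightarrow> real ^ 'n::finite"
    and t :: "nat \<Rightarrow> real" and k :: nat and \<xi> :: "nat \<Rightarrow> 'a \<Rightarrow> real ^ 'n"
  assumes bm: "bm_from M G X 0 {}"
    and t0: "0 \<le> t 0" and tmono: "\<And>j. j < k \<Longrightarrow> t j \<le> t (Suc j)" and tk: "t k \<le> 1"
    and \<xi>: "\<And>j. j < k \<Longrightarrow> \<xi> j \<in> borel_measurable (G (t j))"
begin

abbreviation "c \<equiv> simple_proc t k \<xi>"
abbreviation "D \<equiv> simple_drift t k \<xi>"
abbreviation "N \<equiv> simple_exp t k \<xi> X"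
abbreviation "Y \<equiv> \<lambda>r w. X r w + D r w"

lemma t_le: "i \<le> j \<Longrightarrow> j \<le> k \<Longrightarrow> t i \<le> t j"
  by (induction j) (auto simp: le_Suc_eq intro: order.trans[OF _ tmono])

lemma t_range: "j \<le> k \<Longrightarrow> 0 \<le> t j \<and> t j \<le> 1"
  using t_le[of 0 j] t_le[of j k] t0 tk by auto

lemma \<xi>_measurable: "j < k \<Longrightarrow> t j \<le> r \<Longrightarrow> r \<le> 1 \<Longrightarrow> \<xi> j \<in> borel_measurable (G r)"
  using bm_fromD(5)[OF bm, of "t j" r] \<xi>[of j] t_range[of j] by (auto intro: measurable_from_subalg)

lemma X_measurable: "0 \<le> r \<Longrightarrow> r \<le> s \<Longrightarrow> s \<le> 1 \<Longrightarrow> X r \<in> borel_measurable (G s)"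
  by (rule bm_from_measurable[OF bm])

text \<open>On \<open>{0..r}\<close> only cells begun by time \<open>r\<close> contribute, and their
  coefficients are known at time \<open>r\<close>. Dropping the others from the sum is what gives
  measurability for \<open>G r\<close> instead of the final \<sigma>-algebra.\<close>

lemma c_measurable_pair:
  assumes "0 \<le> r" "r \<le> 1"
  shows "(\<lambda>(w, s). indicator {0..r} s *\<^sub>R c s w) \<in> borel_measurable (G r \<Otimes>\<^sub>M borel)"
proof -
  have "(\<lambda>(w, s). indicator {0..r} s *\<^sub>R (\<Sum>j\<in>{j\<in>{..<k}. t j \<le> r}. indicat_real {t j<..t (Suc j)} s *\<^sub>R \<xi> j w))
      \<in> borel_measurable (G r \<Otimes>\<^sub>M borel)"
  proof -
    have [measurable]: "\<xi> j \<in> borel_measurable (G r)" if "j \<in> {j\<in>{..<k}. t j \<le> r}" for j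
      using that assms by (auto intro: \<xi>_measurable)
    show ?thesis by measurable
  qed
  also have "(\<lambda>(w, s). indicator {0..r} s *\<^sub>R (\<Sum>j\<in>{j\<in>{..<k}. t j \<le> r}. indicat_real {t j<..t (Suc j)} s *\<^sub>R \<xi> j w))
     = (\<lambda>(w, s). indicator {0..r} s *\<^sub>R c s w)"
    unfolding simple_proc_def
    by (auto simp: fun_eq_iff indicator_def intro!: sum.mono_neutral_cong_left)
  finally show ?thesis .
qed

lemma D_measurable [measurable]:
  assumes "0 \<le> r" "r \<le> 1"
  shows "D r \<in> borel_measurable (G r)"
proof -
  have [measurable]: "(\<lambda>(w, s). indicator {0..r} s *\<^sub>R c s w) \<in> borel_measurable (G r \<Otimes>\<^sub>M lborel)"
    using c_measurable_pair[OF assms] by simp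
  show ?thesis unfolding simple_drift_def[abs_def] set_lebesgue_integral_def by measurable
qed

lemma N_measurable:
  assumes "0 \<le> r" "r \<le> 1"
  shows "N r \<in> borel_measurable (G r)"
proof -
  have [measurable]: "(\<lambda>(w, s). indicator {0..r} s *\<^sub>R c s w) \<in> borel_measurable (G r \<Otimes>\<^sub>M lborel)"
    using c_measurable_pair[OF assms] by simp
  have eq: "indicator {0..r} s *\<^sub>R (norm (c s w))\<^sup>2 = (norm (indicator {0..r} s *\<^sub>R c s w))\<^sup>2" for s w
    by (auto simp: indicator_def)
  have 1: "(\<lambda>w. LBINT s:{0..r}. (norm (c s w))\<^sup>2) \<in> borel_measurable (G r)"
    unfolding set_lebesgue_integral_def eq by measurable
  have 2: "(\<lambda>w. \<xi> j w \<bullet> (X (max (t j) (min (t (Suc j)) r)) w - X (t j) w)) \<in> borel_measurable (G r)" if j: "j < k" for j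
  proof (cases "t j \<le> r")
    case True
    have [measurable]: "\<xi> j \<in> borel_measurable (G r)" using \<xi>_measurable j True assms by auto
    have [measurable]: "X (max (t j) (min (t (Suc j)) r)) \<in> borel_measurable (G r)" "X (t j) \<in> borel_measurable (G r)"
      using True assms t_range[of j] j by (auto intro!: X_measurable)
    show ?thesis by measurable
  next
    case False
    then have "max (t j) (min (t (Suc j)) r) = t j" by auto
    then show ?thesis by simp
  qed
  show ?thesis unfolding simple_exp_def[abs_def]
    using 1 2 by (intro borel_measurable_exp[THEN measurable_compose_rev] borel_measurable_diff borel_measurable_uminus borel_measurable_sum borel_measurable_times) auto
qed

text \<open>Between consecutive grid points the drift is constant and already known at
  \<open>a\<close>. Its value is read off at the right end \<open>b\<close>, because cells are open
  on the left: at \<open>a\<close> itself the process still has the value of the preceding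
  cell.\<close>

lemma cell:
  assumes ab: "0 \<le> a" "a < b" "b \<le> 1" "{a<..<b} \<inter> t ` {..k} = {}"
  shows "\<And>s w. a < s \<Longrightarrow> s \<le> b \<Longrightarrow> c s w = c b w"
    and "c b \<in> borel_measurable (G a)"
    and "\<And>w. Y b w - Y a w = X b w - X a w + (b - a) *\<^sub>R c b w"
    and "\<And>w. N b w = N a w * exp (- (c b w \<bullet> (X b w - X a w)) - (b - a) * (norm (c b w))\<^sup>2 / 2)"
proof -
  have out: "t j \<le> a \<or> b \<le> t j" if "j \<le> k" for j
    using ab(4) that by force
  show cs: "c s w = c b w" if "a < s" "s \<le> b" for s w
    unfolding simple_proc_def
  proof (intro sum.cong refl arg_cong2[where f="(*\<^sub>R)"])
    fix j assume "j \<in> {..<k}"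
    then show "indicat_real {t j<..t (Suc j)} s = indicat_real {t j<..t (Suc j)} b"
      using out[of j] out[of "Suc j"] that by (auto simp: indicator_def)
  qed
  show "c b \<in> borel_measurable (G a)"
  proof -
    have "(\<lambda>w. indicat_real {t j<..t (Suc j)} b *\<^sub>R \<xi> j w) \<in> borel_measurable (G a)" if j: "j < k" for j
    proof (cases "t j \<le> a")
      case True
      have [measurable]: "\<xi> j \<in> borel_measurable (G a)" using \<xi>_measurable j True ab by auto
      show ?thesis by measurable
    next
      case False
      then show ?thesis using out[of j] j by (auto simp: indicator_def)
    qed
    then show ?thesis unfolding simple_proc_def[abs_def] by (intro borel_measurable_sum) simp
  qed
  have D: "D b w = D a w + (b - a) *\<^sub>R c b w" for w
    unfolding simple_drift_def
    by (rule set_integral_add_cell, fact ab, fact ab, rule set_integrable_simple_proc, simp, use ab in simp, rule cs)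
  then show "Y b w - Y a w = X b w - X a w + (b - a) *\<^sub>R c b w" for w by simp
  have Q: "(LBINT s:{0..b}. (norm (c s w))\<^sup>2) = (LBINT s:{0..a}. (norm (c s w))\<^sup>2) + (b - a) *\<^sub>R (norm (c b w))\<^sup>2" for w
    by (rule set_integral_add_cell, fact ab, fact ab, rule set_integrable_simple_proc, simp, use ab in simp, rule arg_cong[where f="\<lambda>x. (norm x)\<^sup>2"], rule cs)
  have S: "(\<Sum>j<k. \<xi> j w \<bullet> (X (max (t j) (min (t (Suc j)) b)) w - X (t j) w))
     = (\<Sum>j<k. \<xi> j w \<bullet> (X (max (t j) (min (t (Suc j)) a)) w - X (t j) w)) + c b w \<bullet> (X b w - X a w)" for w
    unfolding simple_proc_def inner_sum_left sum.distrib[symmetric]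
  proof (intro sum.cong refl)
    fix j assume j: "j \<in> {..<k}"
    consider "b \<le> t j" | "t (Suc j) \<le> a" "t j \<le> a" | "t j \<le> a" "b \<le> t (Suc j)"
      using out[of j] out[of "Suc j"] tmono[of j] j by force
    then show "\<xi> j w \<bullet> (X (max (t j) (min (t (Suc j)) b)) w - X (t j) w) =
       \<xi> j w \<bullet> (X (max (t j) (min (t (Suc j)) a)) w - X (t j) w) + (indicat_real {t j<..t (Suc j)} b *\<^sub>R \<xi> j w) \<bullet> (X b w - X a w)"
    proof cases
      case 1
      then have "max (t j) (min (t (Suc j)) b) = t j" "max (t j) (min (t (Suc j)) a) = t j" "b \<notin> {t j<..t (Suc j)}"
        using ab tmono[of j] j by auto
      then show ?thesis by simp
    next
      case 2
      then have "max (t j) (min (t (Suc j)) b) = t (Suc j)" "max (t j) (min (t (Suc j)) a) = t (Suc j)" "b \<notin> {t j<..t (Suc j)}"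
        using ab tmono[of j] j by auto
      then show ?thesis by simp
    next
      case 3
      then have "max (t j) (min (t (Suc j)) b) = b" "max (t j) (min (t (Suc j)) a) = a" "b \<in> {t j<..t (Suc j)}"
        using ab tmono[of j] j by auto
      then show ?thesis by (simp add: inner_diff_right)
    qed
  qed
  show "N b w = N a w * exp (- (c b w \<bullet> (X b w - X a w)) - (b - a) * (norm (c b w))\<^sup>2 / 2)" for w
    unfolding simple_exp_def S Q exp_add[symmetric] by (simp add: field_simps)
qed

text \<open>Once the past up to \<open>a\<close> is frozen, \<open>c b w\<close> is a constant, and
  the new factor of \<open>N\<close> is exactly the weight of the Gaussian shift formula. The
  shifted increment is thus a centred Gaussian independent of the past, and \<open>N a\<close> is
  what remains of the density.\<close>

lemma cell_integral:
  assumes ab: "0 \<le> a" "a < b" "b \<le> 1" "{a<..<b} \<inter> t ` {..k} = {}"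
    and [measurable]: "Z \<in> borel_measurable (G a)" "g \<in> borel_measurable borel"
  shows "(\<integral>\<^sup>+w. Z w * g (Y b w - Y a w) * ennreal (N b w) \<partial>M)
    = (\<integral>\<^sup>+w. Z w * ennreal (N a w) \<partial>M) * (\<integral>\<^sup>+y. g y \<partial>gauss_vec (b - a))"
proof -
  have [measurable]: "N a \<in> borel_measurable (G a)" using ab by (intro N_measurable) auto
  note [measurable] = cell(2)[OF ab]
  define \<Phi> where "\<Phi> w y = Z w * ennreal (N a w) * (g (y + (b - a) *\<^sub>R c b w) *
     ennreal (exp (- (c b w \<bullet> y) - (b - a) * (norm (c b w))\<^sup>2 / 2)))" for w y
  have \<Phi>: "(\<lambda>(w, y). \<Phi> w y) \<in> borel_measurable (G a \<Otimes>\<^sub>M borel)"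
    unfolding \<Phi>_def by measurable
  have ZN: "(\<lambda>w. Z w * ennreal (N a w)) \<in> borel_measurable M"
    using ab by (intro measurable_from_subalg[OF bm_fromD(3)[OF bm, of a]]) auto
  have "(\<integral>\<^sup>+w. Z w * g (Y b w - Y a w) * ennreal (N b w) \<partial>M) = (\<integral>\<^sup>+w. \<Phi> w (X b w - X a w) \<partial>M)"
    unfolding \<Phi>_def cell(3,4)[OF ab]
    by (intro nn_integral_cong) (simp add: ennreal_mult' simple_exp_def ac_simps)
  also have "\<dots> = (\<integral>\<^sup>+w. \<integral>\<^sup>+y. \<Phi> w y \<partial>gauss_vec (b - a) \<partial>M)"
    by (rule bm_from_nn_integral[OF bm _ _ _ _ \<Phi>]) (use ab in auto)
  also have "\<dots> = (\<integral>\<^sup>+w. Z w * ennreal (N a w) * (\<integral>\<^sup>+y. g y \<partial>gauss_vec (b - a)) \<partial>M)"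
    unfolding \<Phi>_def
    by (intro nn_integral_cong, subst nn_integral_cmult, simp, subst nn_integral_gauss_vec_shift) (use ab in auto)
  also have "\<dots> = (\<integral>\<^sup>+w. Z w * ennreal (N a w) \<partial>M) * (\<integral>\<^sup>+y. g y \<partial>gauss_vec (b - a))"
    by (rule nn_integral_multc[OF ZN])
  finally show ?thesis .
qed

text \<open>Without an interior grid point this is \<open>cell_integral\<close> for the constant
  function 1. Otherwise the interval is split at a grid point, which lowers the number of interior
  grid points on both sides. Only nonnegative integrals occur, so Tonelli takes the place of
  integrability.\<close>

lemma martingale:
  assumes "0 \<le> a" "a \<le> b" "b \<le> 1" and Z: "Z \<in> borel_measurable (G a)"
  shows "(\<integral>\<^sup>+w. Z w * ennreal (N b w) \<partial>M) = (\<integral>\<^sup>+w. Z w * ennreal (N a w) \<partial>M)"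
  using assms
proof (induction "card ({a<..<b} \<inter> t ` {..k})" arbitrary: a b rule: less_induct)
  case less
  show ?case
  proof (cases "a < b")
    case ab: True
    show ?thesis
    proof (cases "{a<..<b} \<inter> t ` {..k} = {}")
      case True
      interpret \<gamma>: prob_space "gauss_vec (b - a) :: (real ^ 'n) measure" using ab by (intro prob_space_gauss_vec) auto
      show ?thesis
        using cell_integral[of a b Z "\<lambda>_. 1"] less True ab \<gamma>.emeasure_space_1 by simp
    next
      case False
      then obtain e where e: "a < e" "e < b" "e \<in> t ` {..k}" by (metis disjoint_iff greaterThanLessThan_iff)
      have 1: "card ({a<..<e} \<inter> t ` {..k}) < card ({a<..<b} \<inter> t ` {..k})"
        by (rule psubset_card_mono) (use e in auto)
      have 2: "card ({e<..<b} \<inter> t ` {..k}) < card ({a<..<b} \<inter> t ` {..k})"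
        by (rule psubset_card_mono) (use e in auto)
      have Ze: "Z \<in> borel_measurable (G e)"
        using less.prems e by (intro measurable_from_subalg[OF bm_fromD(5)[OF bm, of a e]]) auto
      show ?thesis
        using less.hyps[OF 1] less.hyps[OF 2] less.prems e Ze by simp
    qed
  qed (use less in auto)
qed

lemma N_0: "N 0 w = 1"
proof -
  have "max (t j) (min (t (Suc j)) 0) = t j" if "j < k" for j
    using t_range[of j] that by auto
  then have "(\<Sum>j<k. \<xi> j w \<bullet> (X (max (t j) (min (t (Suc j)) 0)) w - X (t j) w)) = 0" by simp
  then show ?thesis unfolding simple_exp_def by simp
qed

lemma integral_N:
  "(\<integral>\<^sup>+w. ennreal (N 1 w) \<partial>M) = 1"
proof -
  interpret prob_space M by (rule bm_fromD(1)[OF bm])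
  show ?thesis using martingale[of 0 1 "\<lambda>_. 1"] by (simp add: N_0 emeasure_space_1)
qed

text \<open>An event known at \<open>b\<close> does not distinguish the densities \<open>N 1\<close>
  and \<open>N b\<close>. The cell formula then splits off the increment and leaves
  \<open>N a\<close>, which is traded back for \<open>N 1\<close>. This treats one cell at a time,
  so the grid remains as the exceptional set.\<close>

theorem bm_from_simple_girsanov:
  "bm_from (density M (\<lambda>w. ennreal (N 1 w))) G Y 0 (t ` {..k})"
proof -
  have sub: "subalgebra M (G r)" if "0 \<le> r" "r \<le> 1" for r
    using bm_fromD(3)[OF bm] that by auto
  have N1 [measurable]: "N 1 \<in> borel_measurable M"
    by (rule measurable_from_subalg[OF sub N_measurable]) auto
  have Y: "Y r \<in> borel_measurable (G r)" if "0 \<le> r" "r \<le> 1" for r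
    using that D_measurable[of r] X_measurable[of r r] by auto
  let ?Q = "density M (\<lambda>w. ennreal (N 1 w))"
  have "prob_space ?Q"
    by (rule prob_spaceI) (simp add: emeasure_density integral_N cong: nn_integral_cong)
  moreover have "emeasure ?Q (A \<inter> {w\<in>space M. Y b w - Y a w \<in> C}) = emeasure ?Q A * emeasure (gauss_vec (b - a)) C"
    if ab: "0 \<le> a" "a < b" "b \<le> 1" "{a<..<b} \<inter> t ` {..k} = {}" and A: "A \<in> sets (G a)" and C [measurable]: "C \<in> sets borel"
    for a b A C
  proof -
    have [measurable]: "A \<in> sets M" using A sub[of a] ab by (auto simp: subalgebra_def)
    have Ab: "A \<in> sets (G b)" using A bm_fromD(5)[OF bm, of a b] ab by (auto simp: subalgebra_def)
    have [measurable]: "Y a \<in> borel_measurable (G b)" "Y b \<in> borel_measurable (G b)"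
      using measurable_from_subalg[OF bm_fromD(5)[OF bm, of a b] Y[of a]] Y[of b] ab by auto
    have [measurable]: "Y a \<in> borel_measurable M" "Y b \<in> borel_measurable M"
      using ab by (auto intro!: measurable_from_subalg[OF sub Y])
    have "emeasure ?Q (A \<inter> {w\<in>space M. Y b w - Y a w \<in> C})
       = (\<integral>\<^sup>+w. indicator A w * indicator C (Y b w - Y a w) * ennreal (N 1 w) \<partial>M)"
      by (subst emeasure_density) (auto intro!: nn_integral_cong simp: indicator_def)
    also have "\<dots> = (\<integral>\<^sup>+w. indicator A w * indicator C (Y b w - Y a w) * ennreal (N b w) \<partial>M)"
      by (rule martingale) (use ab Ab in auto)
    also have "\<dots> = (\<integral>\<^sup>+w. indicator A w * ennreal (N a w) \<partial>M) * emeasure (gauss_vec (b - a)) C"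
      by (subst cell_integral[OF ab]) (use A in auto)
    also have "(\<integral>\<^sup>+w. indicator A w * ennreal (N a w) \<partial>M) = (\<integral>\<^sup>+w. indicator A w * ennreal (N 1 w) \<partial>M)"
      by (rule martingale[symmetric]) (use ab A in auto)
    also have "\<dots> = emeasure ?Q A"
      by (subst emeasure_density) (auto intro!: nn_integral_cong simp: mult.commute)
    finally show ?thesis .
  qed
  ultimately show ?thesis
    using bm Y unfolding bm_from_def by (auto simp: subalgebra_def)
qed

end

section \<open>Measures on the path space\<close>

lemma space_wiener_algebra: "space wiener_algebra = wiener_paths"
  by (simp add: wiener_algebra_def space_restrict_space space_PiM)

lemma space_wpath: "sets \<mu> = sets wiener_algebra \<Longrightarrow> space \<mu> = wiener_paths"
  using sets_eq_imp_space_eq space_wiener_algebra by metis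

lemma measurable_wpathI:
  assumes \<mu>: "sets \<mu> = sets wiener_algebra"
    and X: "\<And>w. w \<in> space M \<Longrightarrow> X w \<in> wiener_paths"
    and r: "\<And>r. 0 \<le> r \<Longrightarrow> r \<le> 1 \<Longrightarrow> (\<lambda>w. X w r) \<in> borel_measurable M"
  shows "X \<in> M \<rightarrow>\<^sub>M \<mu>"
proof -
  have "(\<lambda>w. X w r) \<in> borel_measurable M" for r
  proof (cases "r \<in> {0..1}")
    case False
    then have "X w r = 0" if "w \<in> space M" for w using X[OF that] unfolding wiener_paths_def by blast
    then show ?thesis by (simp cong: measurable_cong)
  qed (use r in auto)
  then have "X \<in> M \<rightarrow>\<^sub>M (\<Pi>\<^sub>M t\<in>UNIV. borel)"
    by (intro measurable_PiM_single') auto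
  then have "X \<in> M \<rightarrow>\<^sub>M wiener_algebra"
    unfolding wiener_algebra_def using X by (intro measurable_restrict_space2) auto
  then show ?thesis using measurable_cong_sets[OF refl \<mu>] by auto
qed

lemma measurable_wpath_eval:
  assumes \<mu>: "sets \<mu> = sets wiener_algebra"
  shows "(\<lambda>w. w r) \<in> borel_measurable \<mu>"
proof -
  have "(\<lambda>w. w r) \<in> borel_measurable wiener_algebra"
    unfolding wiener_algebra_def by (intro measurable_restrict_space1 measurable_component_singleton) auto
  then show ?thesis using measurable_cong_sets[OF \<mu> refl] by auto
qed

lemma measurable_wpathD:
  assumes \<mu>: "sets \<mu> = sets wiener_algebra" and "X \<in> M \<rightarrow>\<^sub>M \<mu>"
  shows "(\<lambda>w. X w r) \<in> borel_measurable M"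
    and "w \<in> space M \<Longrightarrow> X w \<in> wiener_paths"
  using measurable_compose[OF assms(2) measurable_wpath_eval[OF \<mu>]] measurable_space[OF assms(2)] space_wpath[OF \<mu>] by auto

text \<open>Cylinder sets determine a finite measure on the product space, and the path space is a
  trace of it. Since paths vanish off \<open>{0..1}\<close>, a time outside contributes only the
  condition that 0 lies in the prescribed set. The explicit weights allow comparing laws under
  changed measures, and even an event with its conditional probability.\<close>

proposition distr_wpath_eqI:
  fixes \<mu> :: "('n::finite) wpath measure"
  assumes \<mu>: "sets \<mu> = sets wiener_algebra"
    and X1 [measurable]: "X1 \<in> M1 \<rightarrow>\<^sub>M \<mu>" and X2 [measurable]: "X2 \<in> M2 \<rightarrow>\<^sub>M \<mu>"
    and Z1 [measurable]: "Z1 \<in> borel_measurable M1" and Z2 [measurable]: "Z2 \<in> borel_measurable M2"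
    and fin: "(\<integral>\<^sup>+w. Z1 w \<partial>M1) \<noteq> \<infinity>"
    and eq: "\<And>T A. finite T \<Longrightarrow> T \<subseteq> {0..1} \<Longrightarrow> (\<And>r. A r \<in> sets borel) \<Longrightarrow>
       (\<integral>\<^sup>+w. Z1 w * (\<Prod>r\<in>T. indicator (A r) (X1 w r)) \<partial>M1) = (\<integral>\<^sup>+w. Z2 w * (\<Prod>r\<in>T. indicator (A r) (X2 w r)) \<partial>M2)"
  shows "distr (density M1 Z1) \<mu> X1 = distr (density M2 Z2) \<mu> X2"
proof -
  let ?P = "\<Pi>\<^sub>M t\<in>(UNIV::real set). (borel :: (real ^ 'n) measure)"
  have inc [measurable]: "(\<lambda>w. w) \<in> \<mu> \<rightarrow>\<^sub>M ?P"
    by (intro measurable_PiM_single') (auto intro: measurable_wpath_eval[OF \<mu>])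
  have X1P: "X1 \<in> M1 \<rightarrow>\<^sub>M ?P" and X2P: "X2 \<in> M2 \<rightarrow>\<^sub>M ?P"
    using measurable_compose[OF X1 inc] measurable_compose[OF X2 inc] by auto
  \<comment> \<open>\<open>A\<close> is known to be Borel only on \<open>J\<close>; replacing it by
    \<open>UNIV\<close> elsewhere gives a family to which \<open>eq\<close> applies.\<close>
  have val: "emeasure (distr (density M Z) ?P X) (prod_emb UNIV (\<lambda>_. borel) J (Pi\<^sub>E J A))
      = (if \<forall>j\<in>J - {0..1}. 0 \<in> A j then \<integral>\<^sup>+w. Z w * (\<Prod>r\<in>J \<inter> {0..1}. indicator (if r \<in> J then A r else UNIV) (X w r)) \<partial>M else 0)"
    if J: "finite J" and A: "\<And>i. i \<in> J \<Longrightarrow> A i \<in> sets borel"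
      and [measurable]: "Z \<in> borel_measurable M" "X \<in> M \<rightarrow>\<^sub>M ?P" and X: "X \<in> M \<rightarrow>\<^sub>M \<mu>"
    for M :: "'c measure" and Z X J and A :: "real \<Rightarrow> (real ^ 'n) set"
  proof -
    have [measurable]: "prod_emb UNIV (\<lambda>_. borel) J (Pi\<^sub>E J A) \<in> sets ?P"
      using J A by (intro sets_PiM_I) auto
    have "emeasure (distr (density M Z) ?P X) (prod_emb UNIV (\<lambda>_. borel) J (Pi\<^sub>E J A))
       = (\<integral>\<^sup>+w. indicator (prod_emb UNIV (\<lambda>_. borel) J (Pi\<^sub>E J A)) w \<partial>distr (density M Z) ?P X)"
      by simp
    also have "\<dots> = (\<integral>\<^sup>+w. Z w * indicator (prod_emb UNIV (\<lambda>_. borel) J (Pi\<^sub>E J A)) (X w) \<partial>M)"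
      by (subst nn_integral_distr) (auto simp: nn_integral_density)
    also have "\<dots> = (\<integral>\<^sup>+w. (if \<forall>j\<in>J - {0..1}. 0 \<in> A j then Z w * (\<Prod>r\<in>J \<inter> {0..1}. indicator (if r \<in> J then A r else UNIV) (X w r)) else 0) \<partial>M)"
    proof (intro nn_integral_cong)
      fix w assume "w \<in> space M"
      then have w: "X w \<in> wiener_paths" by (rule measurable_wpathD(2)[OF \<mu> X])
      have out: "X w j = 0" if "j \<in> J - {0..1}" for j
        using w that unfolding wiener_paths_def by blast
      then have iff: "X w \<in> prod_emb UNIV (\<lambda>_. borel) J (Pi\<^sub>E J A) \<longleftrightarrow>
          (\<forall>j\<in>J - {0..1}. 0 \<in> A j) \<and> (\<forall>j\<in>J \<inter> {0..1}. X w j \<in> A j)"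
      proof -
        have "X w \<in> prod_emb UNIV (\<lambda>_. borel) J (Pi\<^sub>E J A) \<longleftrightarrow> (\<forall>j\<in>J. X w j \<in> A j)"
          by (auto simp: prod_emb_def PiE_iff extensional_def)
        moreover have "(\<forall>j\<in>J - {0..1}. 0 \<in> A j) \<longleftrightarrow> (\<forall>j\<in>J - {0..1}. X w j \<in> A j)"
          using out by simp
        ultimately show ?thesis by blast
      qed
      have "(\<Prod>r\<in>J \<inter> {0..1}. indicator (if r \<in> J then A r else UNIV) (X w r) :: ennreal) = (if \<forall>j\<in>J \<inter> {0..1}. X w j \<in> A j then 1 else 0)"
        using J by (auto simp: indicator_def)
      then show "Z w * indicator (prod_emb UNIV (\<lambda>_. borel) J (Pi\<^sub>E J A)) (X w) =
        (if \<forall>j\<in>J - {0..1}. 0 \<in> A j then Z w * (\<Prod>r\<in>J \<inter> {0..1}. indicator (if r \<in> J then A r else UNIV) (X w r)) else 0)"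
        unfolding indicator_def[of "prod_emb _ _ _ _"] iff by auto
    qed
    also have "\<dots> = (if \<forall>j\<in>J - {0..1}. 0 \<in> A j then \<integral>\<^sup>+w. Z w * (\<Prod>r\<in>J \<inter> {0..1}. indicator (if r \<in> J then A r else UNIV) (X w r)) \<partial>M else 0)"
    proof -
      have "(\<integral>\<^sup>+w. (if b then f w else 0) \<partial>M) = (if b then \<integral>\<^sup>+w. f w \<partial>M else 0)" for b and f :: "'c \<Rightarrow> ennreal"
        by simp
      then show ?thesis .
    qed
    finally show ?thesis .
  qed
  have "distr (density M1 Z1) ?P X1 = distr (density M2 Z2) ?P X2"
  proof (rule measure_eqI_PiM_infinite)
    fix A :: "real \<Rightarrow> (real ^ 'n) set" and J assume J: "finite J" "J \<subseteq> UNIV" "\<And>i. i \<in> J \<Longrightarrow> A i \<in> sets borel"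
    show "emeasure (distr (density M1 Z1) ?P X1) (prod_emb UNIV (\<lambda>_. borel) J (Pi\<^sub>E J A))
        = emeasure (distr (density M2 Z2) ?P X2) (prod_emb UNIV (\<lambda>_. borel) J (Pi\<^sub>E J A))"
    proof -
      have e: "(\<integral>\<^sup>+w. Z1 w * (\<Prod>r\<in>J \<inter> {0..1}. indicator (if r \<in> J then A r else UNIV) (X1 w r)) \<partial>M1)
         = (\<integral>\<^sup>+w. Z2 w * (\<Prod>r\<in>J \<inter> {0..1}. indicator (if r \<in> J then A r else UNIV) (X2 w r)) \<partial>M2)"
        by (rule eq) (use J in auto)
      show ?thesis
        by (rule trans[OF val[OF J(1,3) Z1 X1P X1] trans[OF _ val[OF J(1,3) Z2 X2P X2, symmetric]]])
           (simp_all only: e)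
    qed
  next
    show "finite_measure (distr (density M1 Z1) ?P X1)"
      using fin X1P by (intro finite_measure.finite_measure_distr finite_measureI)
        (auto simp: emeasure_density cong: nn_integral_cong)
  qed auto
  note eqP = this
  show ?thesis
  proof (rule measure_eqI)
    fix S assume "S \<in> sets (distr (density M1 Z1) \<mu> X1)"
    then have S [measurable]: "S \<in> sets \<mu>" by simp
    then have "S \<in> sets wiener_algebra" using \<mu> by simp
    then obtain B where B [measurable]: "B \<in> sets ?P" and SB: "S = wiener_paths \<inter> B"
      unfolding wiener_algebra_def by (auto simp: sets_restrict_space)
    have "emeasure (distr (density M Z) \<mu> X) S = emeasure (distr (density M Z) ?P X) B"
      if [measurable]: "Z \<in> borel_measurable M" "X \<in> M \<rightarrow>\<^sub>M \<mu>" "X \<in> M \<rightarrow>\<^sub>M ?P" for M :: "'c measure" and Z X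
    proof -
      have "X -` S \<inter> space M = X -` B \<inter> space M"
        using measurable_wpathD(2)[OF \<mu> that(2)] by (auto simp: SB)
      then show ?thesis by (simp add: emeasure_distr)
    qed
    from this[OF Z1 X1 X1P] this[OF Z2 X2 X2P] eqP
    show "emeasure (distr (density M1 Z1) \<mu> X1) S = emeasure (distr (density M2 Z2) \<mu> X2) S"
      by simp
  qed simp
qed

section \<open>Increments of the Wiener measure\<close>

lemma wiener_measureD:
  assumes "wiener_measure \<mu>"
  shows "prob_space \<mu>" "sets \<mu> = sets wiener_algebra"
    "\<And>k t. 0 \<le> t 0 \<Longrightarrow> (\<And>j. j < k \<Longrightarrow> t j < t (Suc j)) \<Longrightarrow> t k \<le> 1 \<Longrightarrow>
       prob_space.indep_vars \<mu> (\<lambda>_. borel)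
            (\<lambda>(j, i) w. (w (t (Suc j)) - w (t j)) $ i) ({..<k} \<times> UNIV)"
    "\<And>a b i. 0 \<le> a \<Longrightarrow> a < b \<Longrightarrow> b \<le> 1 \<Longrightarrow> distributed \<mu> lborel (\<lambda>w. (w b - w a) $ i)
             (\<lambda>x. ennreal (normal_density 0 (sqrt (b - a)) x))"
proof -
  show "distributed \<mu> lborel (\<lambda>w. (w b - w a) $ i) (\<lambda>x. ennreal (normal_density 0 (sqrt (b - a)) x))"
    if "0 \<le> a" "a < b" "b \<le> 1" for a b i
  proof -
    let ?t = "\<lambda>j::nat. if j = 0 then a else b"
    have "\<And>k t. 0 \<le> t 0 \<and> (\<forall>j<k. t j < t (Suc j)) \<and> t k \<le> 1 \<Longrightarrow>
       \<forall>j<k. \<forall>i. distributed \<mu> lborel (\<lambda>w. (w (t (Suc j)) - w (t j)) $ i)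
             (\<lambda>x. ennreal (normal_density 0 (sqrt (t (Suc j) - t j)) x))"
      using assms unfolding wiener_measure_def by blast
    from this[of ?t 1] show ?thesis using that by auto
  qed
qed (use assms in \<open>auto simp: wiener_measure_def\<close>)

lemma borel_measurable_vec_nth [measurable (raw)]:
  fixes f :: "'a \<Rightarrow> real ^ 'n::finite"
  assumes [measurable]: "f \<in> borel_measurable M"
  shows "(\<lambda>w. f w $ i) \<in> borel_measurable M"
proof -
  have "(\<lambda>w. f w $ i) = (\<lambda>w. f w \<bullet> axis i 1)" by (simp add: inner_axis)
  then show ?thesis by simp
qed

lemma (in prob_space) indep_sets_reindex:
  assumes f: "inj_on f I" and F: "indep_sets F (f ` I)"
  shows "indep_sets (\<lambda>i. F (f i)) I"
proof (rule indep_setsI)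
  show "F (f i) \<subseteq> events" if "i \<in> I" for i
    using F that by (auto simp: indep_sets_def)
  fix A J assume J: "J \<noteq> {}" "J \<subseteq> I" "finite J" "\<forall>j\<in>J. A j \<in> F (f j)"
  have inv: "inv_into I f (f j) = j" if "j \<in> J" for j
    using J f that by (intro inv_into_f_f) auto
  have "prob (\<Inter>i\<in>f ` J. A (inv_into I f i)) = (\<Prod>i\<in>f ` J. prob (A (inv_into I f i)))"
    using J inv by (intro indep_setsD[OF F]) auto
  then show "prob (\<Inter>j\<in>J. A j) = (\<Prod>j\<in>J. prob (A j))"
    using inv inj_on_subset[OF f \<open>J \<subseteq> I\<close>] by (simp add: prod.reindex)
qed

lemma (in prob_space) indep_vars_reindex:
  assumes "inj_on f I" and "indep_vars M' X (f ` I)"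
  shows "indep_vars (\<lambda>i. M' (f i)) (\<lambda>i. X (f i)) I"
  using assms indep_sets_reindex[OF assms(1), of "\<lambda>i. {X i -` A \<inter> space M |A. A \<in> sets (M' i)}"]
  unfolding indep_vars_def2 by auto

text \<open>A partition with the single cell from \<open>a\<close> to \<open>b\<close> makes the
  coordinates of the increment independent, so their joint law is the product that defines
  \<open>gauss_vec\<close>.\<close>

lemma wiener_increment_law:
  fixes \<mu> :: "('n::finite) wpath measure"
  assumes \<mu>: "wiener_measure \<mu>" and ab: "0 \<le> a" "a < b" "b \<le> 1"
  shows "distr \<mu> borel (\<lambda>w. w b - w a) = gauss_vec (b - a)"
proof -
  interpret prob_space \<mu> by (rule wiener_measureD(1)[OF \<mu>])
  have [measurable]: "(\<lambda>w. w r) \<in> borel_measurable \<mu>" for r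
    by (rule measurable_wpath_eval[OF wiener_measureD(2)[OF \<mu>]])
  let ?t = "\<lambda>j::nat. if j = 0 then a else b"
  let ?X = "\<lambda>i w. (w b - w a) $ i"
  have Xm [measurable]: "?X i \<in> borel_measurable \<mu>" for i by measurable
  have "indep_vars (\<lambda>_. borel) (\<lambda>(j, i) w. (w (?t (Suc j)) - w (?t j)) $ i) ({..<1} \<times> UNIV)"
    by (rule wiener_measureD(3)[OF \<mu>]) (use ab in auto)
  then have "indep_vars (\<lambda>_. borel) (\<lambda>(j, i) w. (w (?t (Suc j)) - w (?t j)) $ i) (Pair 0 ` (UNIV :: 'n set))"
    by (rule indep_vars_subset) auto
  from indep_vars_reindex[OF _ this] have "indep_vars (\<lambda>_. borel) ?X UNIV"
    by (auto simp: inj_on_def comp_def)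
  then have "distr \<mu> (\<Pi>\<^sub>M i\<in>UNIV. borel) (\<lambda>w. \<lambda>i\<in>UNIV. ?X i w) = (\<Pi>\<^sub>M i\<in>UNIV. distr \<mu> borel (?X i))"
    by (rule indep_vars_iff_distr_eq_PiM[THEN iffD1, rotated 2]) (simp_all add: Xm)
  also have "\<dots> = (\<Pi>\<^sub>M i\<in>UNIV. density lborel (\<lambda>x. ennreal (normal_density 0 (sqrt (b - a)) x)))"
  proof (intro PiM_cong refl)
    fix i
    show "distr \<mu> borel (?X i) = density lborel (\<lambda>x. ennreal (normal_density 0 (sqrt (b - a)) x))"
      using distributed_distr_eq_density[OF wiener_measureD(4)[OF \<mu> ab, of i]]
        distr_cong[OF refl sets_lborel, of \<mu> "?X i" "?X i"] by simp
  qed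
  finally have eq: "distr \<mu> (\<Pi>\<^sub>M i\<in>UNIV. borel) (\<lambda>w. \<lambda>i\<in>UNIV. ?X i w)
    = (\<Pi>\<^sub>M i\<in>UNIV. density lborel (\<lambda>x. ennreal (normal_density 0 (sqrt (b - a)) x)))" .
  have "gauss_vec (b - a) = distr (distr \<mu> (\<Pi>\<^sub>M i\<in>UNIV. borel) (\<lambda>w. \<lambda>i\<in>UNIV. ?X i w)) borel (\<lambda>x. \<chi> i. x i)"
    unfolding gauss_vec_def eq ..
  also have "\<dots> = distr \<mu> borel (\<lambda>w. w b - w a)"
    by (subst distr_distr[OF measurable_vec_lambda_PiM])
       (auto intro!: measurable_restrict distr_cong simp: comp_def vec_eq_iff simp del: vector_minus_component)
  finally show ?thesis ..
qed

text \<open>The definition of the Wiener measure speaks only of increments along a partition. The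
  conditions on values up to \<open>a\<close> are therefore rewritten through increments of one
  partition that has the interval from \<open>a\<close> to \<open>b\<close> as its last
  cell.\<close>

lemma wiener_increment_indep:
  fixes \<mu> :: "('n::finite) wpath measure"
  assumes \<mu>: "wiener_measure \<mu>" and ab: "0 \<le> a" "a < b" "b \<le> 1"
    and T: "finite T" "T \<subseteq> {0..a}" and D: "\<And>r. D r \<in> sets borel" and C: "C \<in> sets borel"
  shows "emeasure \<mu> {w\<in>space \<mu>. (\<forall>r\<in>T. w r \<in> D r) \<and> w b - w a \<in> C}
     = emeasure \<mu> {w\<in>space \<mu>. \<forall>r\<in>T. w r \<in> D r} * emeasure (gauss_vec (b - a)) C"
proof -
  interpret prob_space \<mu> by (rule wiener_measureD(1)[OF \<mu>])
  note sets_\<mu> = wiener_measureD(2)[OF \<mu>]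
  have [measurable]: "(\<lambda>w. w r) \<in> borel_measurable \<mu>" for r
    by (rule measurable_wpath_eval[OF sets_\<mu>])
  have w0: "w 0 = 0" if "w \<in> space \<mu>" for w
    using that space_wpath[OF sets_\<mu>] by (auto simp: wiener_paths_def)
  \<comment> \<open>The time 0 lets each value \<open>w r\<close> be recovered as the sum of the
    increments before \<open>r\<close>, as \<open>w 0 = 0\<close>; the time \<open>a\<close>
    separates the past from the last cell.\<close>
  define xs where "xs = sorted_list_of_set (T \<union> {0, a})"
  have fin: "finite (T \<union> {0, a})" using T by auto
  have set_xs: "set xs = T \<union> {0, a}" unfolding xs_def by (rule set_sorted_list_of_set[OF fin])
  have sorted: "sorted_wrt (<) xs" unfolding xs_def by simp
  have "xs \<noteq> []" using set_xs by auto
  define m where "m = length xs - 1"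
  have len: "length xs = Suc m" using \<open>xs \<noteq> []\<close> by (simp add: m_def)
  \<comment> \<open>Index \<open>m\<close> is the time \<open>a\<close> and index
    \<open>Suc m\<close> the time \<open>b\<close>, so the cells below \<open>m\<close> are the past
    and cell \<open>m\<close> is the new increment.\<close>
  define t where "t j = (if j \<le> m then xs ! j else b)" for j
  have t_lt: "t i < t j" if "i < j" "j \<le> m" for i j
    using sorted_wrt_nth_less[OF sorted, of i j] that len by (simp add: t_def)
  have t_range: "0 \<le> t j \<and> t j \<le> a" if "j \<le> m" for j
    using nth_mem[of j xs] that len set_xs T ab by (auto simp: t_def)
  have idx: "\<exists>j\<le>m. t j = r" if "r \<in> T \<union> {0, a}" for r
    using that len unfolding set_xs[symmetric] in_set_conv_nth t_def by force
  have t0: "t 0 = 0"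
  proof -
    obtain j where j: "j \<le> m" "t j = 0" using idx[of 0] by auto
    then show ?thesis using t_lt[of 0 j] t_range[of 0] by (cases "j = 0") auto
  qed
  have tm: "t m = a"
  proof -
    obtain j where j: "j \<le> m" "t j = a" using idx[of a] by auto
    then show ?thesis using t_lt[of j m] t_range[of m] by (cases "j = m") auto
  qed
  have tSm: "t (Suc m) = b" by (simp add: t_def)
  obtain ix where ix: "\<And>r. r \<in> T \<Longrightarrow> ix r \<le> m \<and> t (ix r) = r"
    using idx by (metis UnI1)
  let ?X = "\<lambda>(j, i) w. (w (t (Suc j)) - w (t j)) $ i"
  let ?A = "{..<m} \<times> (UNIV :: 'n set)" and ?B = "{m} \<times> (UNIV :: 'n set)"
  have "indep_vars (\<lambda>_. borel) ?X ({..<Suc m} \<times> UNIV)"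
  proof (rule wiener_measureD(3)[OF \<mu>])
    show "t j < t (Suc j)" if "j < Suc m" for j
      using t_lt[of j "Suc j"] that tm tSm ab by (cases "j = m") auto
  qed (use t0 tSm ab in auto)
  then have ind: "indep_var (\<Pi>\<^sub>M p\<in>?A. borel) (\<lambda>w. \<lambda>p\<in>?A. ?X p w) (\<Pi>\<^sub>M p\<in>?B. borel) (\<lambda>w. \<lambda>p\<in>?B. ?X p w)"
    by (rule indep_var_restrict) auto
  define SA where "SA = {x \<in> space (\<Pi>\<^sub>M p\<in>?A. (borel :: real measure)). \<forall>r\<in>T. (\<chi> i. \<Sum>j<ix r. x (j, i)) \<in> D r}"
  define SB where "SB = {x \<in> space (\<Pi>\<^sub>M p\<in>?B. (borel :: real measure)). (\<chi> i. x (m, i)) \<in> C}"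
  have vec: "(\<lambda>x. \<chi> i. f i x) \<in> borel_measurable M" if "\<And>i. f i \<in> borel_measurable M"
    for M :: "'z measure" and f :: "'n \<Rightarrow> 'z \<Rightarrow> real"
  proof -
    have "(\<lambda>x. \<lambda>i\<in>UNIV. f i x) \<in> M \<rightarrow>\<^sub>M (\<Pi>\<^sub>M i\<in>(UNIV::'n set). borel)"
      by (intro measurable_restrict that)
    from measurable_compose[OF this measurable_vec_lambda_PiM] show ?thesis by simp
  qed
  have SA: "SA \<in> sets (\<Pi>\<^sub>M p\<in>?A. borel)"
  proof -
    have "{x \<in> space (\<Pi>\<^sub>M p\<in>?A. (borel :: real measure)). (\<chi> i. \<Sum>j<ix r. x (j, i)) \<in> D r} \<in> sets (\<Pi>\<^sub>M p\<in>?A. borel)"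
      if "r \<in> T" for r
    proof -
      have "(\<lambda>x. x (j, i)) \<in> borel_measurable (\<Pi>\<^sub>M p\<in>?A. (borel :: real measure))" if "j < ix r" for j i
        using that ix[OF \<open>r \<in> T\<close>] by (intro measurable_component_singleton) auto
      then have [measurable]: "(\<lambda>x. \<chi> i. \<Sum>j<ix r. x (j, i)) \<in> borel_measurable (\<Pi>\<^sub>M p\<in>?A. (borel :: real measure))"
        by (intro vec borel_measurable_sum) auto
      show ?thesis using D[of r] by measurable
    qed
    then show ?thesis unfolding SA_def using T(1) by (intro sets.sets_Collect_finite_All) auto
  qed
  have SB: "SB \<in> sets (\<Pi>\<^sub>M p\<in>?B. borel)"
  proof -
    have [measurable]: "(\<lambda>x. \<chi> i. x (m, i)) \<in> borel_measurable (\<Pi>\<^sub>M p\<in>?B. (borel :: real measure))"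
      by (intro vec measurable_component_singleton) auto
    show ?thesis unfolding SB_def using C by measurable
  qed
  have A_iff: "(\<lambda>p\<in>?A. ?X p w) \<in> SA \<longleftrightarrow> (\<forall>r\<in>T. w r \<in> D r)" if "w \<in> space \<mu>" for w
  proof -
    have "(\<chi> i. \<Sum>j<ix r. (\<lambda>p\<in>?A. ?X p w) (j, i)) = w r" if r: "r \<in> T" for r
    proof -
      have "(\<Sum>j<ix r. (\<lambda>p\<in>?A. ?X p w) (j, i)) = (\<Sum>j<ix r. w (t (Suc j)) $ i - w (t j) $ i)" for i
        using ix[OF r] by (intro sum.cong) auto
      also have "\<dots> i = w r $ i" for i
        using ix[OF r] sum_lessThan_telescope[of "\<lambda>j. w (t j) $ i" "ix r"] by (simp add: t0 w0[OF \<open>w \<in> space \<mu>\<close>])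
      finally show ?thesis by (simp add: vec_eq_iff)
    qed
    then show ?thesis by (auto simp: SA_def space_PiM)
  qed
  have B_iff: "(\<lambda>p\<in>?B. ?X p w) \<in> SB \<longleftrightarrow> w b - w a \<in> C" for w
  proof -
    have "(\<chi> i. (\<lambda>p\<in>?B. ?X p w) (m, i)) = w b - w a"
      by (simp add: vec_eq_iff tm tSm)
    then show ?thesis by (auto simp: SB_def space_PiM)
  qed
  have "prob ((\<lambda>w. (\<lambda>p\<in>?A. ?X p w, \<lambda>p\<in>?B. ?X p w)) -` (SA \<times> SB) \<inter> space \<mu>)
     = prob ((\<lambda>w. \<lambda>p\<in>?A. ?X p w) -` SA \<inter> space \<mu>) * prob ((\<lambda>w. \<lambda>p\<in>?B. ?X p w) -` SB \<inter> space \<mu>)"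
    by (rule indep_varD[OF ind SA SB])
  also have "(\<lambda>w. (\<lambda>p\<in>?A. ?X p w, \<lambda>p\<in>?B. ?X p w)) -` (SA \<times> SB) \<inter> space \<mu>
     = {w\<in>space \<mu>. (\<forall>r\<in>T. w r \<in> D r) \<and> w b - w a \<in> C}"
    using A_iff B_iff by auto
  also have "(\<lambda>w. \<lambda>p\<in>?A. ?X p w) -` SA \<inter> space \<mu> = {w\<in>space \<mu>. \<forall>r\<in>T. w r \<in> D r}"
    using A_iff by auto
  also have "(\<lambda>w. \<lambda>p\<in>?B. ?X p w) -` SB \<inter> space \<mu> = (\<lambda>w. w b - w a) -` C \<inter> space \<mu>"
    using B_iff by auto
  also have "prob \<dots> = measure (gauss_vec (b - a)) C"
    unfolding wiener_increment_law[OF \<mu> ab, symmetric] using C by (subst measure_distr) auto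
  finally have fin: "prob {w\<in>space \<mu>. (\<forall>r\<in>T. w r \<in> D r) \<and> w b - w a \<in> C}
    = prob {w\<in>space \<mu>. \<forall>r\<in>T. w r \<in> D r} * measure (gauss_vec (b - a)) C" .
  interpret g: prob_space "gauss_vec (b - a) :: (real ^ 'n) measure" using ab by (intro prob_space_gauss_vec) auto
  show ?thesis
    using fin by (simp add: emeasure_eq_measure g.emeasure_eq_measure ennreal_mult')
qed

section \<open>Augmented filtrations\<close>

lemma aug_generator_subset:
  "{(\<lambda>w. X w s) -` A \<inter> space \<mu> | s A. s \<in> {0..t} \<and> A \<in> sets borel} \<union> null_sets (completion \<mu>) \<subseteq> Pow (space \<mu>)"
  using sets.sets_into_space[of _ "completion \<mu>"] by (auto simp: null_sets_def)

lemma space_aug [simp]: "space (aug_filtration \<mu> X t) = space \<mu>"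
  unfolding aug_filtration_def by (rule space_measure_of[OF aug_generator_subset])

lemma sets_aug: "sets (aug_filtration \<mu> X t) = sigma_sets (space \<mu>)
   ({(\<lambda>w. X w s) -` A \<inter> space \<mu> | s A. s \<in> {0..t} \<and> A \<in> sets borel} \<union> null_sets (completion \<mu>))"
  unfolding aug_filtration_def by (rule sets_measure_of[OF aug_generator_subset])

lemma null_sets_in_aug: "N \<in> null_sets (completion \<mu>) \<Longrightarrow> N \<in> sets (aug_filtration \<mu> X t)"
  unfolding sets_aug by blast

lemma aug_eval: "0 \<le> s \<Longrightarrow> s \<le> t \<Longrightarrow> (\<lambda>w. X w s) \<in> borel_measurable (aug_filtration \<mu> X t)"
  by (rule measurableI) (auto simp: sets_aug)

lemma aug_mono: "s \<le> t \<Longrightarrow> sets (aug_filtration \<mu> X s) \<subseteq> sets (aug_filtration \<mu> X t)"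
  unfolding sets_aug by (rule sigma_sets_mono') (auto 0 4)

lemma aug_subalgebra:
  assumes "\<And>s. 0 \<le> s \<Longrightarrow> s \<le> t \<Longrightarrow> (\<lambda>w. X w s) \<in> borel_measurable (completion \<mu>)"
  shows "subalgebra (completion \<mu>) (aug_filtration \<mu> X t)"
proof -
  have "sigma_sets (space (completion \<mu>)) ({(\<lambda>w. X w s) -` A \<inter> space \<mu> | s A. s \<in> {0..t} \<and> A \<in> sets borel} \<union> null_sets (completion \<mu>))
     \<subseteq> sets (completion \<mu>)"
    using measurable_sets[OF assms] by (intro sets.sigma_sets_subset) auto
  then show ?thesis by (simp add: subalgebra_def sets_aug)
qed

text \<open>The exceptional null set and all its subsets belong to the augmented \<sigma>-algebra,
  so a preimage may be altered there freely.\<close>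

lemma measurable_aug_AE:
  fixes f g :: "('n::finite) wpath \<Rightarrow> 'b::topological_space"
  assumes f: "f \<in> N \<rightarrow>\<^sub>M borel" and N: "N = aug_filtration \<mu> X t"
    and eq: "AE w in \<mu>. f w = g w"
  shows "g \<in> N \<rightarrow>\<^sub>M borel"
proof (rule measurableI)
  fix A :: "'b set" assume A: "A \<in> sets borel"
  obtain Z where Z: "Z \<in> null_sets \<mu>" "\<And>w. w \<in> space \<mu> - Z \<Longrightarrow> f w = g w"
    using eq by (auto elim!: AE_E3)
  let ?d = "(g -` A \<inter> space \<mu>) \<inter> Z"
  have dn: "B \<in> sets N" if "B \<subseteq> Z" for B
    unfolding N using Z(1) that by (intro null_sets_in_aug) (auto simp: null_sets_completion_iff2)
  have "g -` A \<inter> space N = ((f -` A \<inter> space N) - Z) \<union> ?d"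
    using Z(2) by (auto simp: N)
  moreover have "f -` A \<inter> space N \<in> sets N" using f A by (rule measurable_sets)
  ultimately show "g -` A \<inter> space N \<in> sets N"
    using dn[of Z] dn[of ?d] by auto
qed auto

lemma measurable_aug_LIMSEQ:
  fixes f :: "nat \<Rightarrow> _ \<Rightarrow> 'b::euclidean_space"
  assumes f: "\<And>n. f n \<in> borel_measurable (aug_filtration \<mu> X t)"
    and lim: "AE w in \<mu>. (\<lambda>n. f n w) \<longlonglongrightarrow> g w"
  shows "g \<in> borel_measurable (aug_filtration \<mu> X t)"
proof (rule measurable_aug_AE[OF _ refl])
  show "(\<lambda>w. lim (\<lambda>n. f n w)) \<in> borel_measurable (aug_filtration \<mu> X t)"
    using f by (rule borel_measurable_lim_metric)
  show "AE w in \<mu>. lim (\<lambda>n. f n w) = g w"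
    using lim by eventually_elim (rule limI)
qed

text \<open>A generator of the target is an evaluation event or a null set of the completion. The
  latter only lies inside a measurable null set, which is why the preimage is asked to be covered by
  a set all of whose subsets are measurable.\<close>

lemma measurable_into_aug:
  assumes R: "R \<in> space N \<rightarrow> space \<mu>"
    and ev: "\<And>s. 0 \<le> s \<Longrightarrow> s \<le> t \<Longrightarrow> (\<lambda>w. Y (R w) s) \<in> borel_measurable N"
    and null: "\<And>A. A \<in> null_sets \<mu> \<Longrightarrow> \<exists>B\<in>sets N. R -` A \<inter> space N \<subseteq> B \<and> (\<forall>C\<subseteq>B. C \<in> sets N)"
  shows "R \<in> N \<rightarrow>\<^sub>M aug_filtration \<mu> Y t"
  unfolding aug_filtration_def
proof (rule measurable_measure_of[OF aug_generator_subset R])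
  fix A assume "A \<in> {(\<lambda>w. Y w s) -` A \<inter> space \<mu> | s A. s \<in> {0..t} \<and> A \<in> sets borel} \<union> null_sets (completion \<mu>)"
  then show "R -` A \<inter> space N \<in> sets N"
  proof
    assume "A \<in> {(\<lambda>w. Y w s) -` A \<inter> space \<mu> | s A. s \<in> {0..t} \<and> A \<in> sets borel}"
    then obtain s D where sD: "s \<in> {0..t}" "D \<in> sets borel" "A = (\<lambda>w. Y w s) -` D \<inter> space \<mu>" by auto
    then have "R -` A \<inter> space N = (\<lambda>w. Y (R w) s) -` D \<inter> space N" using R by auto
    then show ?thesis using measurable_sets[OF ev[of s] sD(2)] sD by auto
  next
    assume "A \<in> null_sets (completion \<mu>)"
    then obtain A' where A': "A' \<in> null_sets \<mu>" "A \<subseteq> A'" by (auto simp: null_sets_completion_iff2)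
    from null[OF A'(1)] obtain B where "R -` A' \<inter> space N \<subseteq> B" "\<forall>C\<subseteq>B. C \<in> sets N" by auto
    moreover have "R -` A \<inter> space N \<subseteq> R -` A' \<inter> space N" using A'(2) by auto
    ultimately show ?thesis by (meson order.trans)
  qed
qed

section \<open>Brownian motions and their law\<close>

lemma distr_completion_id: "distr (completion \<mu>) \<mu> (\<lambda>w. w) = \<mu>"
proof (rule measure_eqI)
  fix A assume "A \<in> sets (distr (completion \<mu>) \<mu> (\<lambda>w. w))"
  then have A: "A \<in> sets \<mu>" by simp
  have "(\<lambda>w. w) \<in> completion \<mu> \<rightarrow>\<^sub>M \<mu>" by (rule measurable_completion) simp
  then have "emeasure (distr (completion \<mu>) \<mu> (\<lambda>w. w)) A = emeasure (completion \<mu>) ((\<lambda>w. w) -` A \<inter> space (completion \<mu>))"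
    using A by (rule emeasure_distr)
  also have "(\<lambda>w. w) -` A \<inter> space (completion \<mu>) = A" using sets.sets_into_space[OF A] by auto
  finally show "emeasure (distr (completion \<mu>) \<mu> (\<lambda>w. w)) A = emeasure \<mu> A" using A by simp
qed simp

lemma prob_space_completion: "prob_space \<mu> \<Longrightarrow> prob_space (completion \<mu>)"
  by (intro prob_spaceI) (simp add: prob_space.emeasure_space_1)

text \<open>For events given by finitely many past values of \<open>X\<close>, independence of the
  increment depends on the law of \<open>X\<close> alone and is that of the Wiener measure. Dynkin's
  theorem extends it to the filtration.\<close>

proposition bm_from_wiener_law:
  fixes \<mu> :: "('n::finite) wpath measure"
  assumes \<mu>: "wiener_measure \<mu>" and X: "X \<in> completion \<mu> \<rightarrow>\<^sub>M \<mu>" and law: "distr (completion \<mu>) \<mu> X = \<mu>"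
  shows "bm_from (completion \<mu>) (aug_filtration \<mu> X) (\<lambda>r w. X w r) 0 {}"
proof -
  note sets_\<mu> = wiener_measureD(2)[OF \<mu>]
  let ?M = "completion \<mu>"
  interpret M: prob_space ?M by (rule prob_space_completion[OF wiener_measureD(1)[OF \<mu>]])
  note [measurable] = measurable_wpathD(1)[OF sets_\<mu> X] measurable_wpath_eval[OF sets_\<mu>]
  have law': "emeasure ?M (X -` A \<inter> space \<mu>) = emeasure \<mu> A" if "A \<in> sets \<mu>" for A
    using emeasure_distr[OF X that] law by simp
  have "emeasure ?M (A \<inter> {w\<in>space ?M. X w b - X w a \<in> C}) = emeasure ?M A * emeasure (gauss_vec (b - a)) C"
    if ab: "0 \<le> a" "a < b" "b \<le> 1" and A: "A \<in> sets (aug_filtration \<mu> X a)" and C [measurable]: "C \<in> sets borel" for a b A C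
  proof -
    interpret \<gamma>: prob_space "gauss_vec (b - a) :: (real ^ 'n) measure" using ab by (intro prob_space_gauss_vec) auto
    define F where "F = {w\<in>space \<mu>. X w b - X w a \<in> C}"
    have F [measurable]: "F \<in> sets ?M"
    proof -
      have "{w\<in>space ?M. X w b - X w a \<in> C} \<in> sets ?M" by measurable
      then show ?thesis by (simp add: F_def)
    qed
    \<comment> \<open>Agreement with a cylinder event only almost everywhere admits the null sets of
      the augmentation among the generators without losing stability under intersections.\<close>
    define cyl where "cyl T D A \<longleftrightarrow> finite T \<and> T \<subseteq> {0..a} \<and> (\<forall>r. D r \<in> sets borel) \<and> (AE w in ?M. w \<in> A \<longleftrightarrow> (\<forall>r\<in>T. X w r \<in> D r))"
      for T and D :: "real \<Rightarrow> (real ^ 'n) set" and A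
    define \<G> where "\<G> = {A\<in>sets ?M. \<exists>T D. cyl T D A}"
    have "\<G> \<subseteq> Pow (space \<mu>)" using sets.sets_into_space[of _ ?M] by (auto simp: \<G>_def)
    have "Int_stable \<G>"
    proof (rule Int_stableI)
      fix A B assume "A \<in> \<G>" "B \<in> \<G>"
      then obtain T D T' D' where c: "cyl T D A" "cyl T' D' B" and AB: "A \<in> sets ?M" "B \<in> sets ?M"
        unfolding \<G>_def by blast
      let ?D = "\<lambda>r. (if r \<in> T then D r else UNIV) \<inter> (if r \<in> T' then D' r else UNIV)"
      have "AE w in ?M. w \<in> A \<inter> B \<longleftrightarrow> (\<forall>r\<in>T \<union> T'. X w r \<in> ?D r)"
        using c[unfolded cyl_def, THEN conjunct2, THEN conjunct2, THEN conjunct2] by eventually_elim auto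
      moreover have "\<forall>r. ?D r \<in> sets borel" using c by (auto simp: cyl_def)
      moreover have "finite (T \<union> T')" "T \<union> T' \<subseteq> {0..a}" using c by (auto simp: cyl_def)
      ultimately have "cyl (T \<union> T') ?D (A \<inter> B)" unfolding cyl_def by (intro conjI)
      then show "A \<inter> B \<in> \<G>" using AB unfolding \<G>_def by blast
    qed
    have "sigma_sets (space \<mu>) ({(\<lambda>w. X w s) -` A \<inter> space \<mu> | s A. s \<in> {0..a} \<and> A \<in> sets borel} \<union> null_sets ?M) \<subseteq> sigma_sets (space \<mu>) \<G>"
    proof (rule sigma_sets_mono', safe)
      fix s and D :: "(real ^ 'n) set" assume s: "s \<in> {0..a}" and D: "D \<in> sets borel"
      have "(\<lambda>w. X w s) -` D \<inter> space ?M \<in> sets ?M" using D by measurable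
      then show "(\<lambda>w. X w s) -` D \<inter> space \<mu> \<in> \<G>"
        unfolding \<G>_def cyl_def using s D by (auto intro!: exI[of _ "{s}"] exI[of _ "\<lambda>_. D"])
    next
      fix N assume N: "N \<in> null_sets ?M"
      then have "AE w in ?M. w \<notin> N" by (rule AE_not_in)
      \<comment> \<open>A null set agrees almost everywhere with the impossible condition at time
        0.\<close>
      then show "N \<in> \<G>"
        unfolding \<G>_def cyl_def using N ab by (auto intro!: exI[of _ "{0}"] exI[of _ "\<lambda>_. {}"])
    qed
    then have A': "A \<in> sigma_sets (space \<mu>) \<G>" using A by (auto simp: sets_aug)
    have \<G>M: "sigma_sets (space \<mu>) \<G> \<subseteq> sets ?M"
      using sets.sigma_sets_subset[of \<G> ?M] by (auto simp: \<G>_def)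
    have basic_eq: "emeasure ?M (A \<inter> F) = emeasure ?M A * emeasure (gauss_vec (b - a)) C" if "A \<in> \<G>" for A
    proof -
      obtain T D where c: "cyl T D A" and A: "A \<in> sets ?M"
        using \<open>A \<in> \<G>\<close> unfolding \<G>_def by blast
      then have T: "A \<in> sets ?M" "finite T" "T \<subseteq> {0..a}" "\<And>r. D r \<in> sets borel" "AE w in ?M. w \<in> A \<longleftrightarrow> (\<forall>r\<in>T. X w r \<in> D r)"
        by (simp_all add: cyl_def)
      let ?A = "{w\<in>space \<mu>. \<forall>r\<in>T. w r \<in> D r}" and ?AF = "{w\<in>space \<mu>. (\<forall>r\<in>T. w r \<in> D r) \<and> w b - w a \<in> C}"
      have ev: "Measurable.pred \<mu> (\<lambda>w. \<forall>r\<in>T. w r \<in> D r)"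
        using T(2,4) by measurable
      have m: "?A \<in> sets \<mu>" "?AF \<in> sets \<mu>" using ev by measurable
      have Xsp: "X w \<in> space \<mu>" if "w \<in> space \<mu>" for w using measurable_space[OF X] that by simp
      have "emeasure ?M A = emeasure ?M (X -` ?A \<inter> space \<mu>)"
        using T(5) measurable_sets[OF X m(1)] T(1) Xsp
        by (intro emeasure_eq_AE) (auto elim!: AE_mp)
      moreover have "emeasure ?M (A \<inter> F) = emeasure ?M (X -` ?AF \<inter> space \<mu>)"
        using T(5) measurable_sets[OF X m(2)] sets.Int[OF T(1) F, unfolded F_def] Xsp
        by (intro emeasure_eq_AE) (auto elim!: AE_mp simp: F_def)
      ultimately show ?thesis
        using wiener_increment_indep[OF \<mu> ab T(2,3) T(4) C] law'[OF m(1)] law'[OF m(2)] by simp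
    qed
    have "space \<mu> \<in> \<G>"
      unfolding \<G>_def cyl_def using sets.top[of ?M] AE_space[of ?M]
      by (auto intro!: exI[of _ "{}"] exI[of _ "\<lambda>_. {}"])
    from basic_eq[OF this] have F1: "emeasure ?M F = emeasure (gauss_vec (b - a)) C"
      using M.emeasure_space_1 sets.sets_into_space[OF F] by (simp add: Int_absorb1)
    from \<open>Int_stable \<G>\<close> \<open>\<G> \<subseteq> Pow (space \<mu>)\<close> A'
    have "emeasure ?M (A \<inter> F) = emeasure ?M A * emeasure (gauss_vec (b - a)) C"
    proof (induction rule: sigma_sets_induct_disjoint)
      case (basic A) then show ?case by (rule basic_eq)
    next
      case empty then show ?case by simp
    next
      case (compl A)
      have A [measurable]: "A \<in> sets ?M" using compl(1) \<G>M by auto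
      have "(space \<mu> - A) \<inter> F = F - (A \<inter> F)" by (auto simp: F_def)
      then have "emeasure ?M ((space \<mu> - A) \<inter> F) = emeasure ?M F - emeasure ?M (A \<inter> F)"
        by (simp only:) (rule emeasure_Diff, auto simp del: emeasure_completion)
      also have "\<dots> = emeasure (gauss_vec (b - a)) C - emeasure ?M A * emeasure (gauss_vec (b - a)) C"
        by (simp only: F1 compl(2))
      also have "\<dots> = (1 - emeasure ?M A) * emeasure (gauss_vec (b - a)) C"
        by (simp only: M.emeasure_eq_measure \<gamma>.emeasure_eq_measure)
           (simp add: ennreal_minus ennreal_mult'[symmetric] left_diff_distrib flip: ennreal_1)
      also have "1 - emeasure ?M A = emeasure ?M (space \<mu> - A)"
        using emeasure_compl[OF A] M.emeasure_space_1 by (simp del: emeasure_completion)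
      finally show ?case .
    next
      case (union A)
      have A [measurable]: "A i \<in> sets ?M" for i using union(2) \<G>M by auto
      have "emeasure ?M ((\<Union>i. A i) \<inter> F) = (\<Sum>i. emeasure ?M (A i \<inter> F))"
        using union(1) by (subst suminf_emeasure) (auto simp: disjoint_family_on_def simp del: emeasure_completion intro!: arg_cong[where f="emeasure ?M"])
      also have "\<dots> = (\<Sum>i. emeasure ?M (A i)) * emeasure (gauss_vec (b - a)) C"
        by (simp only: union(3) ennreal_suminf_multc)
      also have "(\<Sum>i. emeasure ?M (A i)) = emeasure ?M (\<Union>i. A i)"
        using union(1) by (intro suminf_emeasure) auto
      finally show ?case .
    qed
    then show ?thesis by (simp add: F_def)
  qed
  then show ?thesis
    unfolding bm_from_def
    by (intro conjI ballI allI impI M.prob_space_axioms aug_subalgebra aug_eval aug_mono)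
       (simp_all del: emeasure_completion)
qed

text \<open>The process is compared with the coordinate process from time 0 on. There the only time
  left is 0, where all paths vanish, so the two sides are the same constant. The finite set
  \<open>E\<close> accommodates the grid that a simple Girsanov transformation leaves
  behind.\<close>

proposition bm_from_law:
  fixes \<mu> :: "('n::finite) wpath measure"
  assumes \<mu>: "wiener_measure \<mu>" and bm: "bm_from M G (\<lambda>r w. Y w r) 0 E" and E: "finite E" and Y: "Y \<in> M \<rightarrow>\<^sub>M \<mu>"
  shows "distr M \<mu> Y = \<mu>"
proof -
  note sets_\<mu> = wiener_measureD(2)[OF \<mu>]
  have id: "(\<lambda>w. w) \<in> completion \<mu> \<rightarrow>\<^sub>M \<mu>" by (rule measurable_completion) simp
  have bm2: "bm_from (completion \<mu>) (aug_filtration \<mu> (\<lambda>w. w)) (\<lambda>r w. w r) 0 E"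
    by (rule bm_from_mono[OF bm_from_wiener_law[OF \<mu> id distr_completion_id]]) auto
  interpret M: prob_space M by (rule bm_fromD(1)[OF bm])
  interpret M2: prob_space "completion \<mu>" by (rule bm_fromD(1)[OF bm2])
  have z: "X w 0 = 0" if "X \<in> M \<rightarrow>\<^sub>M \<mu>" "w \<in> space M" for X w and M :: "'z measure"
    using measurable_wpathD(2)[OF sets_\<mu> that] by (auto simp: wiener_paths_def)
  have "distr (density M (\<lambda>_. 1)) \<mu> Y = distr (density (completion \<mu>) (\<lambda>_. 1)) \<mu> (\<lambda>w. w)"
  proof (rule distr_wpath_eqI[OF sets_\<mu> Y id])
    fix T :: "real set" and A :: "real \<Rightarrow> (real ^ 'n) set" assume T: "finite T" "T \<subseteq> {0..1}" and A: "\<And>r. A r \<in> sets borel"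
    show "(\<integral>\<^sup>+w. 1 * (\<Prod>r\<in>T. indicator (A r) (Y w r)) \<partial>M) = (\<integral>\<^sup>+w. 1 * (\<Prod>r\<in>T. indicator (A r) (w r)) \<partial>completion \<mu>)"
    proof (rule bm_from_cylinder_eq[OF bm bm2 _ E])
      fix T :: "real set" and g :: "real \<Rightarrow> real ^ 'n \<Rightarrow> ennreal" assume "T \<subseteq> {0..(0::real)}"
      then have T: "r = 0" if "r \<in> T" for r using that by force
      have "(\<integral>\<^sup>+w. 1 * (\<Prod>r\<in>T. g r (X w r)) \<partial>M) = (\<Prod>r\<in>T. g r 0)"
        if "prob_space M" "X \<in> M \<rightarrow>\<^sub>M \<mu>" for X and M :: "'z measure"
      proof -
        have "(\<integral>\<^sup>+w. 1 * (\<Prod>r\<in>T. g r (X w r)) \<partial>M) = (\<integral>\<^sup>+w. (\<Prod>r\<in>T. g r 0) \<partial>M)"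
        proof (intro nn_integral_cong)
          fix w assume w: "w \<in> space M"
          have "(\<Prod>r\<in>T. g r (X w r)) = (\<Prod>r\<in>T. g r 0)"
            using z[OF that(2) w] T by (intro prod.cong refl) metis
          then show "1 * (\<Prod>r\<in>T. g r (X w r)) = (\<Prod>r\<in>T. g r 0)" by simp
        qed
        then show ?thesis using prob_space.emeasure_space_1[OF that(1)] by simp
      qed
      from this[OF M.prob_space_axioms Y] this[OF M2.prob_space_axioms id]
      show "(\<integral>\<^sup>+w. 1 * (\<Prod>r\<in>T. g r (Y w r)) \<partial>M) = (\<integral>\<^sup>+w. 1 * (\<Prod>r\<in>T. g r (w r)) \<partial>completion \<mu>)"
        by simp
    qed (use T A in auto)
  qed (auto simp: M.emeasure_space_1)
  then show ?thesis by (simp add: density_1 distr_completion_id)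
qed

section \<open>Square integrable drifts\<close>

definition L2 :: "'a measure \<Rightarrow> ('a \<Rightarrow> 'b::euclidean_space) \<Rightarrow> bool" where
  "L2 N f \<longleftrightarrow> f \<in> borel_measurable N \<and> integrable N (\<lambda>s. (norm (f s))\<^sup>2)"

lemma L2_inner:
  assumes f: "L2 N f" and g: "L2 N g"
  shows "integrable N (\<lambda>s. f s \<bullet> g s)"
    and "\<bar>\<integral>s. f s \<bullet> g s \<partial>N\<bar> \<le> sqrt (\<integral>s. (norm (f s))\<^sup>2 \<partial>N) * sqrt (\<integral>s. (norm (g s))\<^sup>2 \<partial>N)"
proof -
  have [measurable]: "f \<in> borel_measurable N" "g \<in> borel_measurable N"
    and fi: "integrable N (\<lambda>s. (norm (f s))\<^sup>2)" and gi: "integrable N (\<lambda>s. (norm (g s))\<^sup>2)"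
    using f g by (auto simp: L2_def)
  have le: "norm (f s) * norm (g s) \<le> (norm (f s))\<^sup>2 + (norm (g s))\<^sup>2" for s
    using sum_squares_bound[of "norm (f s)" "norm (g s)"] mult_nonneg_nonneg[OF norm_ge_zero[of "f s"] norm_ge_zero[of "g s"]]
    by linarith
  have i: "integrable N (\<lambda>s. norm (f s) * norm (g s))"
    by (rule Bochner_Integration.integrable_bound[OF Bochner_Integration.integrable_add[OF fi gi]])
       (auto intro!: AE_I2 le)
  show ii: "integrable N (\<lambda>s. f s \<bullet> g s)"
    by (rule Bochner_Integration.integrable_bound[OF i]) (auto intro!: AE_I2 Cauchy_Schwarz_ineq2)
  have "\<bar>\<integral>s. f s \<bullet> g s \<partial>N\<bar> \<le> (\<integral>s. norm (f s) * norm (g s) \<partial>N)"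
    by (rule order.trans[OF integral_abs_bound])
       (intro integral_mono integrable_abs i ii, rule Cauchy_Schwarz_ineq2)
  also have "\<dots> \<le> sqrt (\<integral>s. (norm (f s))\<^sup>2 \<partial>N) * sqrt (\<integral>s. (norm (g s))\<^sup>2 \<partial>N)"
  proof -
    have "(\<integral>\<^sup>+s. ennreal (norm (f s)) * ennreal (norm (g s)) \<partial>N)\<^sup>2
       \<le> (\<integral>\<^sup>+s. (ennreal (norm (f s)))\<^sup>2 \<partial>N) * (\<integral>\<^sup>+s. (ennreal (norm (g s)))\<^sup>2 \<partial>N)"
      by (rule Cauchy_Schwarz_nn_integral) auto
    then have "(\<integral>\<^sup>+s. ennreal (norm (f s) * norm (g s)) \<partial>N)\<^sup>2
       \<le> (\<integral>\<^sup>+s. ennreal ((norm (f s))\<^sup>2) \<partial>N) * (\<integral>\<^sup>+s. ennreal ((norm (g s))\<^sup>2) \<partial>N)"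
      by (simp only: ennreal_mult[OF norm_ge_zero norm_ge_zero] ennreal_power[OF norm_ge_zero])
    then have "ennreal ((\<integral>s. norm (f s) * norm (g s) \<partial>N)\<^sup>2)
       \<le> ennreal ((\<integral>s. (norm (f s))\<^sup>2 \<partial>N) * (\<integral>s. (norm (g s))\<^sup>2 \<partial>N))"
      by (subst (asm) (1 2 3) nn_integral_eq_integral)
         (use i fi gi in \<open>simp_all add: ennreal_power ennreal_mult\<close>)
    then have "(\<integral>s. norm (f s) * norm (g s) \<partial>N)\<^sup>2
       \<le> (\<integral>s. (norm (f s))\<^sup>2 \<partial>N) * (\<integral>s. (norm (g s))\<^sup>2 \<partial>N)"
      by (subst (asm) ennreal_le_iff) auto
    from real_le_rsqrt[OF this] show ?thesis by (simp only: real_sqrt_mult)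
  qed
  finally show "\<bar>\<integral>s. f s \<bullet> g s \<partial>N\<bar> \<le> sqrt (\<integral>s. (norm (f s))\<^sup>2 \<partial>N) * sqrt (\<integral>s. (norm (g s))\<^sup>2 \<partial>N)" .
qed

lemma L2_diff:
  assumes f: "L2 N f" and g: "L2 N g"
  shows "L2 N (\<lambda>s. f s - g s)"
proof -
  have "(norm (f s - g s))\<^sup>2 = (norm (f s))\<^sup>2 - 2 * (f s \<bullet> g s) + (norm (g s))\<^sup>2" for s
    by (simp add: power2_norm_eq_inner inner_diff inner_commute)
  then show ?thesis using f g L2_inner(1)[OF f g] by (auto simp: L2_def)
qed

lemma L2_tendsto:
  assumes fn: "\<And>n. L2 N (fn n)" and f: "L2 N f" and g: "L2 N g"
    and lim: "(\<lambda>n. \<integral>s. (norm (fn n s - f s))\<^sup>2 \<partial>N) \<longlonglongrightarrow> 0"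
  shows "(\<lambda>n. \<integral>s. fn n s \<bullet> g s \<partial>N) \<longlonglongrightarrow> (\<integral>s. f s \<bullet> g s \<partial>N)"
    and "(\<lambda>n. \<integral>s. (norm (fn n s))\<^sup>2 \<partial>N) \<longlonglongrightarrow> (\<integral>s. (norm (f s))\<^sup>2 \<partial>N)"
proof -
  note d = L2_diff[OF fn f]
  have inner0: "(\<lambda>n. \<integral>s. (fn n s - f s) \<bullet> h s \<partial>N) \<longlonglongrightarrow> 0" if h: "L2 N h" for h
  proof (rule Lim_null_comparison)
    show "\<forall>\<^sub>F n in sequentially. norm (\<integral>s. (fn n s - f s) \<bullet> h s \<partial>N)
        \<le> sqrt (\<integral>s. (norm (fn n s - f s))\<^sup>2 \<partial>N) * sqrt (\<integral>s. (norm (h s))\<^sup>2 \<partial>N)"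
      using L2_inner(2)[OF d h] by (intro always_eventually) auto
    show "(\<lambda>n. sqrt (\<integral>s. (norm (fn n s - f s))\<^sup>2 \<partial>N) * sqrt (\<integral>s. (norm (h s))\<^sup>2 \<partial>N)) \<longlonglongrightarrow> 0"
      by (rule tendsto_eq_intros tendsto_real_sqrt lim refl | simp)+
  qed
  have "(\<integral>s. fn n s \<bullet> g s \<partial>N) = (\<integral>s. (fn n s - f s) \<bullet> g s \<partial>N) + (\<integral>s. f s \<bullet> g s \<partial>N)" for n
    using L2_inner(1)[OF fn g] L2_inner(1)[OF f g] by (simp add: inner_diff_left)
  then show "(\<lambda>n. \<integral>s. fn n s \<bullet> g s \<partial>N) \<longlonglongrightarrow> (\<integral>s. f s \<bullet> g s \<partial>N)"
    using tendsto_add[OF inner0[OF g] tendsto_const, of "\<integral>s. f s \<bullet> g s \<partial>N"] by simp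
  have "(\<integral>s. (norm (fn n s))\<^sup>2 \<partial>N) = (\<integral>s. (norm (fn n s - f s))\<^sup>2 \<partial>N) + 2 * (\<integral>s. (fn n s - f s) \<bullet> f s \<partial>N) + (\<integral>s. (norm (f s))\<^sup>2 \<partial>N)" for n
  proof -
    have "(norm (fn n s))\<^sup>2 = (norm (fn n s - f s))\<^sup>2 + 2 * ((fn n s - f s) \<bullet> f s) + (norm (f s))\<^sup>2" for s
      by (simp add: power2_norm_eq_inner inner_diff inner_commute)
    then show ?thesis using d[of n] L2_inner(1)[OF d[of n] f] f by (simp add: L2_def)
  qed
  then show "(\<lambda>n. \<integral>s. (norm (fn n s))\<^sup>2 \<partial>N) \<longlonglongrightarrow> (\<integral>s. (norm (f s))\<^sup>2 \<partial>N)"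
    using tendsto_add[OF tendsto_add[OF lim tendsto_mult_left[OF inner0[OF f], of 2]] tendsto_const, of "\<integral>s. (norm (f s))\<^sup>2 \<partial>N"] by simp
qed

section \<open>Drifts as square integrable functions on the unit interval\<close>

abbreviation lb01 :: "real measure" where "lb01 \<equiv> restrict_space lborel {0..1}"

lemma lb01_finite: "finite_measure lb01"
  by (rule finite_measureI) (simp add: emeasure_restrict_space space_restrict_space)

lemma L2_iff_square_integrable01: "L2 lb01 f \<longleftrightarrow> square_integrable01 f"
proof -
  have "f \<in> borel_measurable lb01 \<longleftrightarrow> set_borel_measurable borel {0..1} f"
    unfolding set_borel_measurable_def by (subst borel_measurable_restrict_space_iff) auto
  then show ?thesis unfolding L2_def square_integrable01_def
    by (simp add: integrable_restrict_space set_integrable_def)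
qed

lemma set_integral_lb01:
  fixes f :: "real \<Rightarrow> 'b::euclidean_space"
  shows "(LBINT s:{0..1}. f s) = (\<integral>s. f s \<partial>lb01)"
  by (simp add: integral_restrict_space set_lebesgue_integral_def)

lemma set_integral_lb01_sub:
  fixes f :: "real \<Rightarrow> 'b::euclidean_space"
  assumes "S \<subseteq> {0..1}"
  shows "(LBINT s:S. f s) = (\<integral>s. indicat_real S s *\<^sub>R f s \<partial>lb01)"
proof -
  have "indicat_real {0..1} s *\<^sub>R indicat_real S s *\<^sub>R f s = indicat_real S s *\<^sub>R f s" for s
    using assms by (auto simp: indicator_def)
  then show ?thesis
    by (subst integral_restrict_space) (simp_all only: set_lebesgue_integral_def, simp)
qed

lemma L2_const: "L2 lb01 (\<lambda>_. c)"
  using lb01_finite by (simp add: L2_def finite_measure.integrable_const)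

lemma L2_indicator:
  assumes [measurable]: "S \<in> sets borel" and f: "L2 lb01 f"
  shows "L2 lb01 (\<lambda>s. indicat_real S s *\<^sub>R f s)"
proof -
  have [measurable]: "f \<in> borel_measurable lb01" using f by (simp add: L2_def)
  have [measurable]: "(\<lambda>s. indicat_real S s) \<in> borel_measurable lb01"
    by (intro measurable_restrict_space1) auto
  have m: "(\<lambda>s. indicat_real S s *\<^sub>R f s) \<in> borel_measurable lb01" by measurable
  moreover have "integrable lb01 (\<lambda>s. (norm (indicat_real S s *\<^sub>R f s))\<^sup>2)"
  proof (rule Bochner_Integration.integrable_bound)
    show "integrable lb01 (\<lambda>s. (norm (f s))\<^sup>2)" using f by (simp add: L2_def)
    show "(\<lambda>s. (norm (indicat_real S s *\<^sub>R f s))\<^sup>2) \<in> borel_measurable lb01" using m by measurable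
    show "AE s in lb01. norm ((norm (indicat_real S s *\<^sub>R f s))\<^sup>2) \<le> norm ((norm (f s))\<^sup>2)"
      by (rule AE_I2) (simp split: split_indicator)
  qed
  ultimately show ?thesis by (simp add: L2_def)
qed

lemma L2_set_integrable:
  fixes f :: "real \<Rightarrow> 'b::euclidean_space"
  assumes f: "L2 lb01 f"
  shows "integrable lb01 f" and "set_integrable lborel {0..1} f"
proof -
  have m: "f \<in> borel_measurable lb01" using f by (simp add: L2_def)
  have "norm x \<le> 1 + (norm x)\<^sup>2" for x :: 'b
  proof -
    have "2 * norm x * 1 \<le> (norm x)\<^sup>2 + 1\<^sup>2" by (rule sum_squares_bound)
    then show ?thesis using norm_ge_zero[of x] by (simp only: power_one)
  qed
  then show "integrable lb01 f"
    using f m finite_measure.integrable_const[OF lb01_finite, of 1]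
    by (intro Bochner_Integration.integrable_bound[of lb01 "\<lambda>s. 1 + (norm (f s))\<^sup>2" f])
       (auto simp: L2_def)
  then show "set_integrable lborel {0..1} f"
    by (simp add: integrable_restrict_space set_integrable_def)
qed

text \<open>Each coordinate of the integral is the inner product with a fixed square integrable
  function, an indicator times a basis vector, so convergence in the mean square suffices.\<close>

lemma L2_tendsto_set_integral:
  fixes f :: "real \<Rightarrow> 'b::euclidean_space"
  assumes fn: "\<And>n. L2 lb01 (fn n)" and f: "L2 lb01 f" and S: "S \<subseteq> {0..1}" "S \<in> sets borel"
    and lim: "(\<lambda>n. \<integral>s. (norm (fn n s - f s))\<^sup>2 \<partial>lb01) \<longlonglongrightarrow> 0"
  shows "(\<lambda>n. LBINT s:S. fn n s) \<longlonglongrightarrow> (LBINT s:S. f s)"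
proof -
  have inner: "(LBINT s:S. h s) \<bullet> b = (\<integral>s. h s \<bullet> (indicat_real S s *\<^sub>R b) \<partial>lb01)" if "L2 lb01 h" for h and b :: 'b
    using L2_set_integrable(1)[OF L2_indicator[OF S(2) that]]
    by (simp add: set_integral_lb01_sub[OF S(1)] flip: integral_inner_left)
  show ?thesis
    unfolding tendsto_componentwise_iff[of _ "LBINT s:S. f s"]
    using L2_tendsto(1)[OF fn f L2_indicator[OF S(2) L2_const] lim]
    by (simp add: inner[OF fn] inner[OF f])
qed

lemma primitive01_wpath:
  fixes g :: "real \<Rightarrow> real ^ 'a::finite"
  assumes "square_integrable01 g"
  shows "continuous_on {0..1} (primitive01 g)" "primitive01 g 0 = 0" "t \<notin> {0..1} \<Longrightarrow> primitive01 g t = 0"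
proof -
  let ?f = "\<lambda>s. indicat_real {0..1} s *\<^sub>R g s"
  have i: "integrable lborel ?f"
    using L2_set_integrable(2)[of g] assms by (simp add: L2_iff_square_integrable01 set_integrable_def)
  have "continuous_on UNIV (\<lambda>b. LBINT s:{0..b}. ?f s)"
  proof (rule continuous_on_componentwise[THEN iffD2], rule ballI)
    fix c :: "real ^ 'a" assume "c \<in> Basis"
    have "(LBINT s:{0..b}. ?f s) \<bullet> c = (LBINT s:{0..b}. ?f s \<bullet> c)" for b
      using integrable_mult_indicator[OF _ i, of "{0..b}"]
      by (simp add: set_lebesgue_integral_def mult.assoc flip: integral_inner_left)
    moreover have "continuous_on UNIV (\<lambda>b. LBINT s:{0..b}. ?f s \<bullet> c)"
    proof (rule continuous_on_LBINT)
      have "integrable lborel (\<lambda>s. ?f s \<bullet> c)" using i by (rule integrable_inner_left)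
      then show "set_integrable lborel {0..b} (\<lambda>s. ?f s \<bullet> c)" for b
        unfolding set_integrable_def by (intro integrable_mult_indicator) auto
    qed
    ultimately show "continuous_on UNIV (\<lambda>b. (LBINT s:{0..b}. ?f s) \<bullet> c)" by simp
  qed
  then have "continuous_on {0..1} (\<lambda>b. LBINT s:{0..b}. ?f s)" by (rule continuous_on_subset) auto
  also have "continuous_on {0..1} (\<lambda>b. LBINT s:{0..b}. ?f s) \<longleftrightarrow> continuous_on {0..1} (primitive01 g)"
    by (intro continuous_on_cong refl) (auto simp: primitive01_def set_lebesgue_integral_def indicator_def intro!: Bochner_Integration.integral_cong)
  finally show "continuous_on {0..1} (primitive01 g)" .
qed (auto simp: primitive01_def)

lemma drift_shift_wpath:
  assumes "w \<in> wiener_paths" "square_integrable01 (\<lambda>s. u s w)"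
  shows "drift_shift u w \<in> wiener_paths"
  using assms primitive01_wpath[OF assms(2)]
  by (auto simp: wiener_paths_def drift_shift_def intro!: continuous_on_add)

text \<open>The drifts and their stochastic sums must converge along the same indices. Hence a
  single bad event serves both sequences, with probability below \<open>(1/2)^n\<close> at the
  tolerance \<open>(1/2)^n\<close>, and Borel-Cantelli is applied once.\<close>

lemma converges_in_prob_AE_subseq2:
  assumes M: "finite_measure M"
    and X: "converges_in_prob M X X0" and Y: "converges_in_prob M Y Y0"
    and [measurable]: "\<And>n. X n \<in> borel_measurable M" "X0 \<in> borel_measurable M"
      "\<And>n. Y n \<in> borel_measurable M" "Y0 \<in> borel_measurable M"
  shows "\<exists>r. strict_mono r \<and> (AE w in M. (\<lambda>n. X (r n) w) \<longlonglongrightarrow> X0 w) \<and> (AE w in M. (\<lambda>n. Y (r n) w) \<longlonglongrightarrow> Y0 w)"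
proof -
  interpret finite_measure M by fact
  define bad where "bad m e = {w\<in>space M. \<bar>X m w - X0 w\<bar> > e} \<union> {w\<in>space M. \<bar>Y m w - Y0 w\<bar> > e}" for m e
  have [measurable]: "bad m e \<in> sets M" for m e unfolding bad_def by measurable
  have ev: "eventually (\<lambda>m. measure M (bad m ((1/2)^n)) < (1/2)^n) sequentially" for n
  proof -
    have "(\<lambda>m. measure M {w\<in>space M. \<bar>X m w - X0 w\<bar> > (1/2)^n} + measure M {w\<in>space M. \<bar>Y m w - Y0 w\<bar> > (1/2)^n}) \<longlonglongrightarrow> 0 + 0"
      using X Y unfolding converges_in_prob_def by (intro tendsto_add) auto
    from order_tendstoD(2)[OF this, of "(1/2)^n"]
    have "eventually (\<lambda>m. measure M {w\<in>space M. \<bar>X m w - X0 w\<bar> > (1/2)^n} + measure M {w\<in>space M. \<bar>Y m w - Y0 w\<bar> > (1/2)^n} < (1/2)^n) sequentially"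
      by simp
    then show ?thesis
      by eventually_elim (auto simp: bad_def intro!: le_less_trans[OF measure_Un_le])
  qed
  have "\<exists>r. \<forall>n. (measure M (bad (r n) ((1/2)^n)) < (1/2)^n) \<and> r n < r (Suc n)"
  proof (rule dependent_nat_choice)
    show "\<exists>m. measure M (bad m ((1/2)^0)) < (1/2)^0"
      using ev[of 0] by (auto simp: eventually_sequentially)
    show "\<exists>m'. measure M (bad m' ((1/2)^Suc n)) < (1/2)^Suc n \<and> m < m'" for m n
    proof -
      have "eventually (\<lambda>m'. measure M (bad m' ((1/2)^Suc n)) < (1/2)^Suc n \<and> m < m') sequentially"
        using ev[of "Suc n"] eventually_gt_at_top[of m] by eventually_elim auto
      then show ?thesis by (auto simp only: eventually_sequentially)
    qed
  qed
  then obtain r where r: "\<And>n. measure M (bad (r n) ((1/2)^n)) < (1/2)^n" "\<And>n. r n < r (Suc n)" by blast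
  have "summable (\<lambda>n. measure M (bad (r n) ((1/2)^n)))"
    by (rule summable_comparison_test'[of "\<lambda>n. (1/2::real)^n" 0])
       (use r(1) in \<open>auto intro!: less_imp_le summable_geometric\<close>)
  then have AE: "AE w in M. eventually (\<lambda>n. w \<in> space M - bad (r n) ((1/2)^n)) sequentially"
    by (intro borel_cantelli_AE1) (auto simp: emeasure_eq_measure)
  have half: "(\<lambda>n. (1/2::real)^n) \<longlonglongrightarrow> 0" by (rule LIMSEQ_realpow_zero) auto
  have "AE w in M. (\<lambda>n. X (r n) w) \<longlonglongrightarrow> X0 w"
    using AE
  proof eventually_elim
    case (elim w)
    have "(\<lambda>n. X (r n) w - X0 w) \<longlonglongrightarrow> 0"
      by (rule Lim_null_comparison[OF _ half]) (use elim in \<open>eventually_elim, auto simp: bad_def not_less\<close>)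
    then show ?case by (simp add: LIM_zero_iff)
  qed
  moreover have "AE w in M. (\<lambda>n. Y (r n) w) \<longlonglongrightarrow> Y0 w"
    using AE
  proof eventually_elim
    case (elim w)
    have "(\<lambda>n. Y (r n) w - Y0 w) \<longlonglongrightarrow> 0"
      by (rule Lim_null_comparison[OF _ half]) (use elim in \<open>eventually_elim, auto simp: bad_def not_less\<close>)
    then show ?case by (simp add: LIM_zero_iff)
  qed
  ultimately show ?thesis using r(2) by (auto simp: strict_mono_Suc_iff)
qed

section \<open>Passage to the limit\<close>

text \<open>The restarted process vanishes up to \<open>a\<close>, which makes the initial
  comparison in \<open>bm_from_cylinder_eq\<close> trivial when started at time
  \<open>a\<close>.\<close>

lemma bm_from_shift:
  assumes bm: "bm_from M G X t E" and a: "t \<le> a" "a \<le> 1"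
  shows "bm_from M G (\<lambda>r w. X r w - X (min r a) w) a E"
proof -
  have t: "0 \<le> t" by (rule bm_fromD(2)[OF bm])
  have "(\<lambda>w. X r w - X (min r a) w) \<in> borel_measurable (G r)" if "0 \<le> r" "r \<le> 1" for r
    using that a t by (intro borel_measurable_diff bm_from_measurable[OF bm]) auto
  moreover have "X c w - X (min c a) w - (X b w - X (min b a) w) = X c w - X b w" if "a \<le> b" "b < c" for b c w
    using that by (simp add: min_absorb2)
  moreover have "bm_from M G X a E" by (rule bm_from_mono[OF bm a(1) order.refl])
  ultimately show ?thesis unfolding bm_from_def by auto
qed

text \<open>In contrast to \<open>cell_integral\<close>, the interval may contain grid points. The
  restarted \<open>Y\<close> under the new measure with weight \<open>Z\<close>, and the restarted
  \<open>X\<close> under \<open>M\<close> with the constant weight \<open>c\<close>, agree up to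
  time \<open>a\<close>; the cylinder comparison carries this across the grid to time
  \<open>b\<close>, where the increment of \<open>X\<close> is Gaussian.\<close>

lemma (in simple_girsanov) increment:
  assumes ab: "0 \<le> a" "a < b" "b \<le> 1" and Z: "Z \<in> borel_measurable (G a)" and g [measurable]: "g \<in> borel_measurable borel"
    and fin: "(\<integral>\<^sup>+w. Z w * ennreal (N 1 w) \<partial>M) < \<infinity>"
  shows "(\<integral>\<^sup>+w. Z w * g (Y b w - Y a w) * ennreal (N 1 w) \<partial>M) = (\<integral>\<^sup>+w. Z w * ennreal (N 1 w) \<partial>M) * (\<integral>\<^sup>+y. g y \<partial>gauss_vec (b - a))"
proof -
  let ?Q = "density M (\<lambda>w. ennreal (N 1 w))"
  define c where "c = (\<integral>\<^sup>+w. Z w * ennreal (N 1 w) \<partial>M)"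
  have bm1: "bm_from ?Q G (\<lambda>r w. Y r w - Y (min r a) w) a (t ` {..k})"
    by (rule bm_from_shift[OF bm_from_simple_girsanov]) (use ab in auto)
  have bm2: "bm_from M G (\<lambda>r w. X r w - X (min r a) w) a (t ` {..k})"
    by (rule bm_from_shift[OF bm_from_mono[OF bm]]) (use ab in auto)
  interpret M: prob_space M by (rule bm_fromD(1)[OF bm])
  note subM = measurable_from_subalg[OF bm_fromD(3)[OF bm]]
  have [measurable]: "N 1 \<in> borel_measurable M" by (rule subM[OF _ _ N_measurable]) auto
  have [measurable]: "Z \<in> borel_measurable M" by (rule subM[OF _ _ Z]) (use ab in auto)
  have Ym [measurable]: "X r \<in> borel_measurable M" "D r \<in> borel_measurable M" if "0 \<le> r" "r \<le> 1" for r
    using that subM[of r "X r" borel] subM[of r "D r" borel] X_measurable[of r r] D_measurable[of r] by auto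
  have "(\<integral>\<^sup>+w. Z w * (\<Prod>r\<in>{b}. g (Y r w - Y (min r a) w)) \<partial>?Q) = (\<integral>\<^sup>+w. c * (\<Prod>r\<in>{b}. g (X r w - X (min r a) w)) \<partial>M)"
  proof (rule bm_from_cylinder_eq[OF bm1 bm2])
    fix T :: "real set" and g :: "real \<Rightarrow> real ^ 'n \<Rightarrow> ennreal"
    assume T: "T \<subseteq> {0..a}" and [measurable]: "\<And>r. g r \<in> borel_measurable borel"
    have z: "(\<Prod>r\<in>T. g r (x r - x (min r a))) = (\<Prod>r\<in>T. g r 0)" for x :: "real \<Rightarrow> real ^ 'n"
      using T by (intro prod.cong refl) (auto simp: min_absorb1 subset_eq)
    have "(\<integral>\<^sup>+w. Z w * (\<Prod>r\<in>T. g r 0) \<partial>?Q) = c * (\<Prod>r\<in>T. g r 0)"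
    proof -
      have "(\<integral>\<^sup>+w. Z w * (\<Prod>r\<in>T. g r 0) \<partial>?Q) = (\<integral>\<^sup>+w. (Z w * ennreal (N 1 w)) * (\<Prod>r\<in>T. g r 0) \<partial>M)"
        by (subst nn_integral_density) (auto simp: ac_simps)
      also have "\<dots> = c * (\<Prod>r\<in>T. g r 0)" unfolding c_def by (rule nn_integral_multc) simp
      finally show ?thesis .
    qed
    moreover have "(\<integral>\<^sup>+w. c * (\<Prod>r\<in>T. g r 0) \<partial>M) = c * (\<Prod>r\<in>T. g r 0)"
      by (simp add: M.emeasure_space_1)
    ultimately show "(\<integral>\<^sup>+w. Z w * (\<Prod>r\<in>T. g r (Y r w - Y (min r a) w)) \<partial>?Q) = (\<integral>\<^sup>+w. c * (\<Prod>r\<in>T. g r (X r w - X (min r a) w)) \<partial>M)"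
      using z[of "\<lambda>r. Y r _"] z[of "\<lambda>r. X r _"] by simp
  qed (use ab Z in auto)
  then have "(\<integral>\<^sup>+w. Z w * g (Y b w - Y a w) \<partial>?Q) = (\<integral>\<^sup>+w. c * g (X b w - X a w) \<partial>M)"
    using ab by (simp add: min_absorb2)
  also have "\<dots> = (\<integral>\<^sup>+w. \<integral>\<^sup>+y. c * g y \<partial>gauss_vec (b - a) \<partial>M)"
    by (rule bm_from_nn_integral[OF bm, where \<Phi>="\<lambda>w y. c * g y"]) (use ab in auto)
  also have "\<dots> = c * (\<integral>\<^sup>+y. g y \<partial>gauss_vec (b - a))"
    by (simp add: nn_integral_cmult M.emeasure_space_1)
  also have "(\<integral>\<^sup>+w. Z w * g (Y b w - Y a w) \<partial>?Q) = (\<integral>\<^sup>+w. Z w * g (Y b w - Y a w) * ennreal (N 1 w) \<partial>M)"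
    using ab by (subst nn_integral_density) (auto simp: ac_simps)
  finally show ?thesis by (simp add: c_def)
qed

lemma open_indicator_approx:
  fixes U :: "'a::metric_space set"
  assumes "open U"
  shows "\<exists>f :: nat \<Rightarrow> 'a \<Rightarrow> real. (\<forall>n. continuous_on UNIV (f n)) \<and> (\<forall>n x. 0 \<le> f n x \<and> f n x \<le> 1) \<and>
     (\<forall>x. incseq (\<lambda>n. f n x)) \<and> (\<forall>x. (\<lambda>n. f n x) \<longlonglongrightarrow> indicat_real U x)"
proof (cases "U = UNIV")
  case True
  then show ?thesis by (intro exI[of _ "\<lambda>_ _. 1"]) (auto simp: incseq_def)
next
  case False
  define f where "f n x = min 1 (real n * infdist x (- U))" for n :: nat and x
  have "(\<lambda>n. f n x) \<longlonglongrightarrow> indicat_real U x" for x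
  proof (cases "x \<in> U")
    case True
    then have "infdist x (- U) > 0"
    proof -
      have "closed (- U)" "- U \<noteq> {}" using False assms by auto
      from in_closed_iff_infdist_zero[OF this, of x] True show ?thesis
        using infdist_nonneg[of x "- U"] by simp
    qed
    then obtain m :: nat where m: "1 < real m * infdist x (- U)" using reals_Archimedean3 by blast
    have "eventually (\<lambda>n. f n x = 1) sequentially"
      using eventually_ge_at_top[of m]
    proof eventually_elim
      case (elim n)
      then have "real m * infdist x (- U) \<le> real n * infdist x (- U)"
        by (intro mult_right_mono) (auto simp: infdist_nonneg)
      then show ?case using m by (simp add: f_def)
    qed
    then show ?thesis using True by (auto intro: tendsto_eventually)
  next
    case False
    then have "f n x = 0" for n by (simp add: f_def)
    then show ?thesis using False by simp
  qed
  moreover have "continuous_on UNIV (f n)" for n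
    unfolding f_def by (intro continuous_intros)
  moreover have "0 \<le> f n x" "f n x \<le> 1" for n x by (auto simp: f_def infdist_nonneg)
  moreover have "incseq (\<lambda>n. f n x)" for x
    unfolding incseq_def f_def by (intro allI impI min.mono order.refl mult_right_mono) (auto simp: infdist_nonneg)
  ultimately show ?thesis by blast
qed

lemma borel_measure_eqI_continuous:
  fixes P Q :: "'a::metric_space measure"
  assumes P: "sets P = sets borel" and Q: "sets Q = sets borel" and fin: "finite_measure P"
    and eq: "\<And>g :: 'a \<Rightarrow> real. continuous_on UNIV g \<Longrightarrow> (\<And>x. 0 \<le> g x) \<Longrightarrow> (\<And>x. g x \<le> 1) \<Longrightarrow>
      (\<integral>\<^sup>+x. ennreal (g x) \<partial>P) = (\<integral>\<^sup>+x. ennreal (g x) \<partial>Q)"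
  shows "P = Q"
proof (rule measure_eqI_generator_eq[of "{U. open U}" UNIV P Q "\<lambda>_. UNIV"])
  show "Int_stable {U :: 'a set. open U}" by (auto simp: Int_stable_def)
  show "sets P = sigma_sets UNIV {U. open U}" "sets Q = sigma_sets UNIV {U. open U}"
    using P Q by (simp_all add: borel_def)
  show "emeasure P UNIV \<noteq> \<infinity>" using finite_measure.emeasure_finite[OF fin] by simp
  fix U :: "'a set" assume "U \<in> {U. open U}"
  then have U: "open U" by simp
  obtain f :: "nat \<Rightarrow> 'a \<Rightarrow> real" where f: "\<And>n. continuous_on UNIV (f n)" "\<And>n x. 0 \<le> f n x" "\<And>n x. f n x \<le> 1"
     "\<And>x. incseq (\<lambda>n. f n x)" "\<And>x. (\<lambda>n. f n x) \<longlonglongrightarrow> indicat_real U x"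
    using open_indicator_approx[OF U] by blast
  have [measurable]: "f n \<in> borel_measurable borel" for n
    by (rule borel_measurable_continuous_onI[OF f(1)])
  have lim: "(\<lambda>n. \<integral>\<^sup>+x. ennreal (f n x) \<partial>R) \<longlonglongrightarrow> emeasure R U" if R: "sets R = sets borel" for R
  proof -
    have [measurable_cong]: "sets R = sets borel" by fact
    have "(\<lambda>n. \<integral>\<^sup>+x. ennreal (f n x) \<partial>R) \<longlonglongrightarrow> (\<integral>\<^sup>+x. ennreal (indicat_real U x) \<partial>R)"
      using f by (intro nn_integral_LIMSEQ) (auto simp: incseq_def le_fun_def intro!: ennreal_leI tendsto_ennrealI)
    then show ?thesis using U R by (simp add: ennreal_indicator)
  qed
  from lim[OF P] lim[OF Q] show "emeasure P U = emeasure Q U"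
    unfolding eq[OF f(1) f(2) f(3)] by (rule LIMSEQ_unique)
qed auto

text \<open>Equal means improve almost sure convergence of nonnegative functions to convergence in
  the mean, by Scheffe's lemma. The difference splits into \<open>h n * (N n - L)\<close>, small in
  the mean because \<open>h n\<close> is bounded, and \<open>(h n - h0) * L\<close>, which is
  dominated by \<open>L\<close>.\<close>

lemma tendsto_integral_mult_L1:
  fixes N :: "nat \<Rightarrow> 'a \<Rightarrow> real"
  assumes N: "\<And>n. integrable M (N n)" "integrable M L" and nonneg: "\<And>n x. 0 \<le> N n x" "AE x in M. 0 \<le> L x"
    and lim: "AE x in M. (\<lambda>n. N n x) \<longlonglongrightarrow> L x" and int: "\<And>n. (\<integral>x. N n x \<partial>M) = (\<integral>x. L x \<partial>M)"
    and h [measurable]: "\<And>n. h n \<in> borel_measurable M" "h0 \<in> borel_measurable M"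
    and bd: "\<And>n x. 0 \<le> h n x \<and> h n x \<le> (1::real)" "\<And>x. 0 \<le> h0 x \<and> h0 x \<le> 1"
    and hlim: "AE x in M. (\<lambda>n. h n x) \<longlonglongrightarrow> h0 x"
  shows "(\<lambda>n. \<integral>x. h n x * N n x \<partial>M) \<longlonglongrightarrow> (\<integral>x. h0 x * L x \<partial>M)"
proof -
  have [measurable]: "N n \<in> borel_measurable M" "L \<in> borel_measurable M" for n using N by auto
  have i1: "integrable M (\<lambda>x. f x * L x)" if [measurable]: "f \<in> borel_measurable M" and "\<And>x. \<bar>f x\<bar> \<le> 1" for f :: "'a \<Rightarrow> real"
    by (rule Bochner_Integration.integrable_bound[OF N(2)])
       (auto simp: abs_mult intro!: AE_I2 mult_left_le_one_le that(2))
  have i2: "integrable M (\<lambda>x. h n x * N n x)" for n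
    by (rule Bochner_Integration.integrable_bound[OF N(1)[of n]])
       (use bd in \<open>auto simp: abs_mult intro!: AE_I2 mult_left_le_one_le\<close>)
  have scheffe: "(\<lambda>n. \<integral>\<^sup>+x. norm (N n x - L x) \<partial>M) \<longlonglongrightarrow> 0"
  proof (rule Scheffe_lemma2)
    fix n
    have "(\<integral>\<^sup>+x. norm (N n x) \<partial>M) = ennreal (\<integral>x. N n x \<partial>M)"
      using N(1)[of n] nonneg by (simp add: nn_integral_eq_integral)
    also have "\<dots> = (\<integral>\<^sup>+x. ennreal (L x) \<partial>M)"
      unfolding int using N(2) nonneg(2) by (simp add: nn_integral_eq_integral)
    also have "\<dots> = (\<integral>\<^sup>+x. norm (L x) \<partial>M)"
      using nonneg(2) by (intro nn_integral_cong_AE) auto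
    finally show "(\<integral>\<^sup>+x. norm (N n x) \<partial>M) \<le> (\<integral>\<^sup>+x. norm (L x) \<partial>M)" by simp
  qed (use N lim in auto)
  have 1: "(\<lambda>n. \<integral>x. h n x * N n x - h n x * L x \<partial>M) \<longlonglongrightarrow> (\<integral>x. 0 \<partial>M)"
  proof (rule tendsto_L1_int)
    show "(\<lambda>n. \<integral>\<^sup>+x. norm (h n x * N n x - h n x * L x - 0) \<partial>M) \<longlonglongrightarrow> 0"
    proof (rule tendsto_sandwich[OF _ _ tendsto_const scheffe])
      show "\<forall>\<^sub>F n in sequentially. (\<integral>\<^sup>+x. norm (h n x * N n x - h n x * L x - 0) \<partial>M) \<le> (\<integral>\<^sup>+x. norm (N n x - L x) \<partial>M)"
        using bd by (intro always_eventually allI nn_integral_mono ennreal_leI)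
          (auto simp: abs_mult right_diff_distrib[symmetric] intro!: mult_left_le_one_le)
    qed simp
  qed (use i1[of "h _"] i2 bd in auto)
  have 2: "(\<lambda>n. \<integral>x. h n x * L x \<partial>M) \<longlonglongrightarrow> (\<integral>x. h0 x * L x \<partial>M)"
  proof (rule integral_dominated_convergence[where w="\<lambda>x. \<bar>L x\<bar>"])
    show "AE x in M. (\<lambda>n. h n x * L x) \<longlonglongrightarrow> h0 x * L x"
      using hlim by eventually_elim (intro tendsto_intros)
    show "AE x in M. norm (h n x * L x) \<le> \<bar>L x\<bar>" for n
      using bd by (intro AE_I2) (auto simp: abs_mult intro!: mult_left_le_one_le)
  qed (use N in auto)
  have "(\<integral>x. h n x * N n x \<partial>M) = (\<integral>x. h n x * N n x - h n x * L x \<partial>M) + (\<integral>x. h n x * L x \<partial>M)" for n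
    using i2[of n] i1[of "h n"] bd by auto
  then show ?thesis using tendsto_add[OF 1 2] by simp
qed

text \<open>The content of \<open>is_rho\<close> with convergence in probability replaced by almost
  sure convergence along a subsequence; \<open>J\<close> is the stochastic integral. The
  approximating sequence is fixed once, because the same simple coefficients are used along the
  coordinate process and along a solution.\<close>

locale ito_drift =
  fixes \<mu> :: "('n::finite) wpath measure" and vdot :: "real \<Rightarrow> 'n wpath \<Rightarrow> real ^ 'n"
    and L J :: "'n wpath \<Rightarrow> real"
    and t :: "nat \<Rightarrow> nat \<Rightarrow> real" and k :: "nat \<Rightarrow> nat" and \<xi> :: "nat \<Rightarrow> nat \<Rightarrow> 'n wpath \<Rightarrow> real ^ 'n"
  assumes wiener: "wiener_measure \<mu>"
    and L_measurable: "L \<in> borel_measurable \<mu>" and L_integral: "(\<integral>w. L w \<partial>\<mu>) = 1"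
    and vdot_square: "\<And>w. w \<in> space \<mu> \<Longrightarrow> square_integrable01 (\<lambda>s. vdot s w)"
    and t_0: "\<And>n. 0 \<le> t n 0" and t_mono: "\<And>n j. j < k n \<Longrightarrow> t n j \<le> t n (Suc j)" and t_k: "\<And>n. t n (k n) \<le> 1"
    and \<xi>_adapted: "\<And>n j. j < k n \<Longrightarrow> \<xi> n j \<in> borel_measurable (aug_filtration \<mu> (\<lambda>w. w) (t n j))"
    and drift_lim: "AE w in \<mu>. (\<lambda>n. \<integral>s. (norm (simple_proc (t n) (k n) (\<xi> n) s w - vdot s w))\<^sup>2 \<partial>lb01) \<longlonglongrightarrow> 0"
    and ito_lim: "AE w in \<mu>. (\<lambda>n. \<Sum>j<k n. \<xi> n j w \<bullet> (w (t n (Suc j)) - w (t n j))) \<longlonglongrightarrow> J w"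
    and L_eq: "AE w in \<mu>. L w = exp (- J w - 1/2 * (\<integral>s. (norm (vdot s w))\<^sup>2 \<partial>lb01))"

lemma simple_itoE:
  assumes "simple_ito \<mu> u J"
  obtains k t \<xi> where "0 \<le> t 0" "\<And>j. j < k \<Longrightarrow> t j \<le> t (Suc j)" "t k \<le> 1"
    "\<And>j. j < k \<Longrightarrow> \<xi> j \<in> borel_measurable (aug_filtration \<mu> (\<lambda>w. w) (t j))"
    "u = simple_proc t k \<xi>" "J = (\<lambda>w. \<Sum>j<k. \<xi> j w \<bullet> (w (t (Suc j)) - w (t j)))"
  using assms unfolding simple_ito_def simple_proc_def[abs_def] by blast

lemma ito_drift_exists:
  fixes \<mu> :: "('n::finite) wpath measure"
  assumes \<mu>: "wiener_measure \<mu>" and L: "L \<in> borel_measurable \<mu>" "(\<integral>w. L w \<partial>\<mu>) = 1"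
    and rho: "is_rho \<mu> vdot L"
  shows "\<exists>J t k \<xi>. ito_drift \<mu> vdot L J t k \<xi>"
proof -
  note sets_\<mu> = wiener_measureD(2)[OF \<mu>]
  let ?M = "completion \<mu>"
  interpret M: prob_space ?M by (rule prob_space_completion[OF wiener_measureD(1)[OF \<mu>]])
  obtain J where J: "has_ito_integral \<mu> vdot J"
    and LJ: "AE w in \<mu>. L w = exp (- J w - 1/2 * (LBINT s:{0..1}. (norm (vdot s w))\<^sup>2))"
    using rho by (auto simp: is_rho_def)
  have vd: "adapted_drift \<mu> vdot" and Jm [measurable]: "J \<in> borel_measurable ?M"
    using J by (auto simp: has_ito_integral_def)
  obtain un Jn where un: "\<And>n. simple_ito \<mu> (un n) (Jn n)"
     and c1: "converges_in_prob ?M (\<lambda>n w. LBINT s:{0..1}. (norm (un n s w - vdot s w))\<^sup>2) (\<lambda>_. 0)"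
     and c2: "converges_in_prob ?M Jn J"
    using J unfolding has_ito_integral_def by blast
  define P where "P n k t \<xi> \<longleftrightarrow> 0 \<le> t 0 \<and> (\<forall>j<k. t j \<le> t (Suc j)) \<and> t k \<le> 1 \<and>
    (\<forall>j<k. \<xi> j \<in> borel_measurable (aug_filtration \<mu> (\<lambda>w. w) (t j))) \<and>
    un n = simple_proc t k \<xi> \<and> Jn n = (\<lambda>w. \<Sum>j<k. \<xi> j w \<bullet> (w (t (Suc j)) - w (t j)))"
    for n k t \<xi>
  have "\<exists>k t \<xi>. P n k t \<xi>" for n
    by (rule simple_itoE[OF un[of n]]) (unfold P_def, blast)
  then obtain k t \<xi> where "\<And>n. P n (k n) (t n) (\<xi> n)"
    by metis
  note * = this[unfolded P_def]
  have [measurable]: "(\<lambda>w. w r) \<in> borel_measurable ?M" for r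
    by (rule measurable_completion[OF measurable_wpath_eval[OF sets_\<mu>]])
  have \<xi>m [measurable]: "\<xi> n j \<in> borel_measurable ?M" if "j < k n" for n j
    by (rule measurable_from_subalg[OF aug_subalgebra]) (use * that in auto)
  have \<xi>m' [measurable]: "\<xi> n j \<in> borel_measurable ?M" if "j \<in> {..<k n}" for n j
    using \<xi>m that by auto
  have [measurable]: "Jn n \<in> borel_measurable ?M" for n
  proof -
    have "(\<lambda>w. \<Sum>j<k n. \<xi> n j w \<bullet> (w (t n (Suc j)) - w (t n j))) \<in> borel_measurable ?M" by measurable
    then show ?thesis using * by simp
  qed
  have vm: "(\<lambda>(w, s). vdot s w) \<in> borel_measurable (?M \<Otimes>\<^sub>M lb01)"
  proof -
    have "(\<lambda>(s, w). vdot s w) \<in> borel_measurable (lb01 \<Otimes>\<^sub>M ?M)"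
    proof -
      have "sets (restrict_space borel {0..1::real} \<Otimes>\<^sub>M ?M) = sets (lb01 \<Otimes>\<^sub>M ?M)"
        by (intro sets_pair_measure_cong sets_restrict_space_cong) auto
      then show ?thesis using vd measurable_cong_sets[OF _ refl] unfolding adapted_drift_def by blast
    qed
    from measurable_pair_swap[OF this] show ?thesis by (simp add: case_prod_beta')
  qed
  have um: "(\<lambda>(w, s). un n s w) \<in> borel_measurable (?M \<Otimes>\<^sub>M lb01)" for n
  proof -
    have [measurable]: "(\<lambda>s. indicat_real {a<..b} s) \<in> borel_measurable lb01" for a b :: real
      by (intro measurable_restrict_space1) auto
    have "(\<lambda>(w, s). \<Sum>j<k n. indicat_real {t n j<..t n (Suc j)} s *\<^sub>R \<xi> n j w) \<in> borel_measurable (?M \<Otimes>\<^sub>M lb01)"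
      by measurable
    then show ?thesis using * by (simp add: simple_proc_def)
  qed
  interpret lb: finite_measure lb01 by (rule lb01_finite)
  have Xm: "(\<lambda>w. LBINT s:{0..1}. (norm (un n s w - vdot s w))\<^sup>2) \<in> borel_measurable ?M" for n
    unfolding set_integral_lb01 using um[of n] vm
    by (intro lb.borel_measurable_lebesgue_integral) (simp add: case_prod_beta')
  obtain r where r: "strict_mono r"
    "AE w in ?M. (\<lambda>n. LBINT s:{0..1}. (norm (un (r n) s w - vdot s w))\<^sup>2) \<longlonglongrightarrow> 0"
    "AE w in ?M. (\<lambda>n. Jn (r n) w) \<longlonglongrightarrow> J w"
    using converges_in_prob_AE_subseq2[OF M.finite_measure_axioms c1 c2 Xm] by auto
  have "ito_drift \<mu> vdot L J (\<lambda>n. t (r n)) (\<lambda>n. k (r n)) (\<lambda>n. \<xi> (r n))"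
  proof
    show "AE w in \<mu>. (\<lambda>n. \<integral>s. (norm (simple_proc (t (r n)) (k (r n)) (\<xi> (r n)) s w - vdot s w))\<^sup>2 \<partial>lb01) \<longlonglongrightarrow> 0"
      using r(2) * by (simp add: AE_completion_iff set_integral_lb01)
    show "AE w in \<mu>. (\<lambda>n. \<Sum>j<k (r n). \<xi> (r n) j w \<bullet> (w (t (r n) (Suc j)) - w (t (r n) j))) \<longlonglongrightarrow> J w"
      using r(3) * by (simp add: AE_completion_iff)
    show "AE w in \<mu>. L w = exp (- J w - 1/2 * (\<integral>s. (norm (vdot s w))\<^sup>2 \<partial>lb01))"
      using LJ by (simp add: set_integral_lb01)
  qed (use \<mu> L * vd in \<open>auto simp: adapted_drift_def\<close>)
  then show ?thesis by blast
qed

section \<open>The map \<open>V\<close> under the measure \<nu>\<close>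

context ito_drift
begin

abbreviation "M \<equiv> completion \<mu>"
abbreviation "G \<equiv> aug_filtration \<mu> (\<lambda>w. w)"
abbreviation "V \<equiv> drift_shift vdot"
abbreviation "\<nu> \<equiv> density M (\<lambda>w. ennreal (L w))"

lemmas sets_\<mu> = wiener_measureD(2)[OF wiener]

lemma prob_M: "prob_space M"
  by (rule prob_space_completion[OF wiener_measureD(1)[OF wiener]])

lemma id_measurable: "(\<lambda>w. w) \<in> M \<rightarrow>\<^sub>M \<mu>"
  by (rule measurable_completion) simp

lemma bm_W: "bm_from M G (\<lambda>r w. w r) 0 {}"
  by (rule bm_from_wiener_law[OF wiener id_measurable distr_completion_id])

lemma eval_measurable: "(\<lambda>w. w r) \<in> borel_measurable M"
  by (rule measurable_completion[OF measurable_wpath_eval[OF sets_\<mu>]])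

lemma L_measurable_M [measurable]: "L \<in> borel_measurable M"
  by (rule measurable_completion[OF L_measurable])

lemma L_pos: "AE w in M. L w > 0"
  using AE_completion[OF L_eq] by eventually_elim simp

lemma L_integrable: "integrable M L" and L_integral_M: "(\<integral>w. L w \<partial>M) = 1"
proof -
  have "integrable \<mu> L" using L_integral not_integrable_integral_eq by fastforce
  then show "integrable M L" using L_measurable by (simp add: integrable_completion)
  show "(\<integral>w. L w \<partial>M) = 1" using L_integral L_measurable by (simp add: integral_completion)
qed

lemma V_eval: "0 \<le> r \<Longrightarrow> r \<le> 1 \<Longrightarrow> V w r = w r + (LBINT s:{0..r}. vdot s w)"
  by (simp add: drift_shift_def primitive01_def)

lemma V_path: "w \<in> space \<mu> \<Longrightarrow> V w \<in> wiener_paths"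
  using vdot_square space_wpath[OF sets_\<mu>] by (intro drift_shift_wpath) auto

lemma L2_vdot: "w \<in> space \<mu> \<Longrightarrow> L2 lb01 (\<lambda>s. vdot s w)"
  using vdot_square by (simp add: L2_iff_square_integrable01)

lemma L2_simple: "L2 lb01 (\<lambda>s. simple_proc (t n) (k n) (\<xi> n) s w)"
  unfolding L2_def
proof
  show "(\<lambda>s. simple_proc (t n) (k n) (\<xi> n) s w) \<in> borel_measurable lb01"
    by (intro measurable_restrict_space1) auto
  show "integrable lb01 (\<lambda>s. (norm (simple_proc (t n) (k n) (\<xi> n) s w))\<^sup>2)"
    using set_integrable_simple_proc(2)[of "{0..1}" "t n" "k n" "\<xi> n" w]
    by (simp add: integrable_restrict_space set_integrable_def)
qed

sublocale W: simple_girsanov M G "\<lambda>r w. w r" "t n" "k n" "\<xi> n" for n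
  by standard (use bm_W t_0 t_mono t_k \<xi>_adapted in auto)

lemma t_range01: "j \<le> k n \<Longrightarrow> 0 \<le> t n j \<and> t n j \<le> 1"
  by (rule W.t_range)

lemma Y_lim: "AE w in \<mu>. \<forall>r\<in>{0..1}. (\<lambda>n. W.Y n r w) \<longlonglongrightarrow> V w r"
  using drift_lim AE_space
proof eventually_elim
  case (elim w)
  show ?case
  proof
    fix r :: real assume r: "r \<in> {0..1}"
    have "(\<lambda>n. LBINT s:{0..r}. simple_proc (t n) (k n) (\<xi> n) s w) \<longlonglongrightarrow> (LBINT s:{0..r}. vdot s w)"
      by (rule L2_tendsto_set_integral[OF L2_simple L2_vdot]) (use r elim in auto)
    then show "(\<lambda>n. W.Y n r w) \<longlonglongrightarrow> V w r"
      using r by (auto simp: V_eval simple_drift_def intro!: tendsto_intros)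
  qed
qed

lemma simple_exp_1:
  "simple_exp (t n) (k n) \<zeta> X 1 w =
     exp (- (\<Sum>j<k n. \<zeta> j w \<bullet> (X (t n (Suc j)) w - X (t n j) w)) - 1/2 * (\<integral>s. (norm (simple_proc (t n) (k n) \<zeta> s w))\<^sup>2 \<partial>lb01))"
proof -
  have "max (t n j) (min (t n (Suc j)) 1) = t n (Suc j)" if "j < k n" for j
    using t_mono[OF that] t_range01[of "Suc j" n] that by simp
  then show ?thesis by (simp add: simple_exp_def set_integral_lb01)
qed

lemma N_lim: "AE w in \<mu>. (\<lambda>n. W.N n 1 w) \<longlonglongrightarrow> L w"
  using drift_lim ito_lim L_eq AE_space
proof eventually_elim
  case (elim w)
  show ?case
    unfolding simple_exp_1 elim(3)
    by (intro tendsto_intros elim L2_tendsto(2)[OF L2_simple L2_vdot[OF elim(4)] L2_vdot[OF elim(4)] elim(1)])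
qed

lemma V_adapted:
  assumes "0 \<le> r" "r \<le> 1"
  shows "(\<lambda>w. V w r) \<in> borel_measurable (G r)"
proof (rule measurable_aug_LIMSEQ)
  show "W.Y n r \<in> borel_measurable (G r)" for n
    using assms W.D_measurable[of r n] aug_eval[of r r "\<lambda>w. w" \<mu>] by auto
  show "AE w in \<mu>. (\<lambda>n. W.Y n r w) \<longlonglongrightarrow> V w r"
    using Y_lim by eventually_elim (use assms in auto)
qed

lemma sub_G: "0 \<le> r \<Longrightarrow> r \<le> 1 \<Longrightarrow> subalgebra M (G r)"
  by (rule bm_fromD(3)[OF bm_W])

lemma V_measurable: "V \<in> M \<rightarrow>\<^sub>M \<mu>"
proof (rule measurable_wpathI[OF sets_\<mu>])
  show "(\<lambda>w. V w r) \<in> borel_measurable M" if "0 \<le> r" "r \<le> 1" for r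
    by (rule measurable_from_subalg[OF sub_G V_adapted]) (use that in auto)
qed (use V_path in auto)

text \<open>This is the limit of the identity for the simple drifts. Continuity of \<open>g\<close>
  lets the increments converge inside it, and the common mean one lets the densities converge in the
  mean.\<close>

lemma V_increment_continuous:
  assumes ab: "0 \<le> a" "a < b" "b \<le> 1" and A: "A \<in> sets (G a)"
    and g: "continuous_on UNIV g" "\<And>x. 0 \<le> g x" "\<And>x. g x \<le> (1::real)"
  shows "(\<integral>\<^sup>+w. indicator A w * ennreal (g (V w b - V w a)) * ennreal (L w) \<partial>M)
     = (\<integral>\<^sup>+w. indicator A w * ennreal (L w) \<partial>M) * (\<integral>\<^sup>+y. ennreal (g y) \<partial>gauss_vec (b - a))"
proof -
  interpret M: prob_space M by (rule prob_M)
  interpret \<gamma>: prob_space "gauss_vec (b - a) :: (real ^ 'n) measure" using ab by (intro prob_space_gauss_vec) auto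
  have gm [measurable]: "g \<in> borel_measurable borel" by (rule borel_measurable_continuous_onI[OF g(1)])
  have [measurable]: "A \<in> sets M" using A sub_G[of a] ab by (auto simp: subalgebra_def)
  have [measurable]: "(\<lambda>w. V w r) \<in> borel_measurable M" for r
    by (rule measurable_wpathD(1)[OF sets_\<mu> V_measurable])
  have [measurable]: "W.Y n a \<in> borel_measurable M" "W.Y n b \<in> borel_measurable M" for n
    using ab measurable_from_subalg[OF sub_G W.D_measurable[of a n]] measurable_from_subalg[OF sub_G W.D_measurable[of b n]]
    by (auto intro!: borel_measurable_add eval_measurable)
  have Nm [measurable]: "W.N n 1 \<in> borel_measurable M" for n
    by (rule measurable_from_subalg[OF sub_G W.N_measurable]) auto
  have N0: "0 \<le> W.N n 1 w" for n w by (simp add: simple_exp_def)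
  have Ni: "integrable M (W.N n 1)" "(\<integral>w. W.N n 1 w \<partial>M) = 1" for n
  proof -
    show i: "integrable M (W.N n 1)"
      using W.integral_N[of n] N0 by (intro integrableI_nonneg) auto
    show "(\<integral>w. W.N n 1 w \<partial>M) = 1"
      using W.integral_N[of n] nn_integral_eq_integral[OF i] N0 by (simp add: integral_nonneg)
  qed
  define c where "c = (\<integral>y. g y \<partial>gauss_vec (b - a))"
  have gi: "integrable (gauss_vec (b - a)) g"
  proof (rule \<gamma>.integrable_const_bound[of _ 1])
    show "g \<in> borel_measurable (gauss_vec (b - a))" by measurable
  qed (use g in auto)
  have c: "(\<integral>\<^sup>+y. ennreal (g y) \<partial>gauss_vec (b - a)) = ennreal c" "0 \<le> c"
    using nn_integral_eq_integral[OF gi] g by (auto simp: c_def)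
  \<comment> \<open>The identities come as nonnegative integrals, whereas the limit theorem is about
    real ones; this translates between the two.\<close>
  have conv: "(\<integral>\<^sup>+w. indicator A w * ennreal (h w) * ennreal (f w) \<partial>M) = ennreal (\<integral>w. (indicator A w * h w) * f w \<partial>M)"
    if f: "integrable M f" "AE w in M. 0 \<le> f w" and h [measurable]: "h \<in> borel_measurable M" "\<And>w. 0 \<le> h w \<and> h w \<le> 1" for f h :: "'n wpath \<Rightarrow> real"
  proof -
    have "integrable M (\<lambda>w. (indicator A w * h w) * f w)"
      by (rule Bochner_Integration.integrable_bound[OF f(1)])
         (use f h in \<open>auto simp: abs_mult indicator_def intro!: AE_I2 mult_left_le_one_le\<close>)
    moreover have "(\<integral>\<^sup>+w. indicator A w * ennreal (h w) * ennreal (f w) \<partial>M) = (\<integral>\<^sup>+w. ennreal ((indicator A w * h w) * f w) \<partial>M)"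
      using f(2) h(2) by (intro nn_integral_cong_AE) (auto elim!: AE_mp simp: indicator_def ennreal_mult)
    ultimately show ?thesis
      using f(2) h(2) by (subst (asm) nn_integral_eq_integral) (auto elim!: AE_mp)
  qed
  have L0: "AE w in M. 0 \<le> L w" using L_pos by eventually_elim simp
  have nonneg: "0 \<le> (\<integral>w. (indicator A w * h w) * f w \<partial>M)" if "AE w in M. 0 \<le> f w" "\<And>w. 0 \<le> h w \<and> h w \<le> 1" for f h :: "'n wpath \<Rightarrow> real"
    using that by (intro integral_nonneg_AE) (auto elim!: AE_mp)
  have eqn: "(\<integral>w. (indicator A w * g (W.Y n b w - W.Y n a w)) * W.N n 1 w \<partial>M) = (\<integral>w. (indicator A w * 1) * W.N n 1 w \<partial>M) * c" for n
  proof -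
    have fin: "(\<integral>\<^sup>+w. indicator A w * ennreal (W.N n 1 w) \<partial>M) < \<infinity>"
    proof -
      have "(\<integral>\<^sup>+w. indicator A w * ennreal (W.N n 1 w) \<partial>M) \<le> (\<integral>\<^sup>+w. ennreal (W.N n 1 w) \<partial>M)"
        by (intro nn_integral_mono) (auto simp: indicator_def)
      then show ?thesis using W.integral_N[of n] by (simp add: le_less_trans)
    qed
    have "(\<integral>\<^sup>+w. indicator A w * ennreal (g (W.Y n b w - W.Y n a w)) * ennreal (W.N n 1 w) \<partial>M)
       = (\<integral>\<^sup>+w. indicator A w * ennreal (W.N n 1 w) \<partial>M) * ennreal c"
      unfolding c(1)[symmetric] by (rule W.increment[OF ab _ _ fin]) (use A in auto)
    then have "ennreal (\<integral>w. (indicator A w * g (W.Y n b w - W.Y n a w)) * W.N n 1 w \<partial>M)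
       = ennreal (\<integral>w. (indicator A w * 1) * W.N n 1 w \<partial>M) * ennreal c"
      using conv[OF Ni(1)[of n], of "\<lambda>w. g (W.Y n b w - W.Y n a w)"] conv[OF Ni(1)[of n], of "\<lambda>_. 1"] N0 g by simp
    then have "ennreal (\<integral>w. (indicator A w * g (W.Y n b w - W.Y n a w)) * W.N n 1 w \<partial>M)
       = ennreal ((\<integral>w. (indicator A w * 1) * W.N n 1 w \<partial>M) * c)"
      using c(2) by (simp only: ennreal_mult'')
    then show ?thesis
      using nonneg[of "W.N n 1" "\<lambda>w. g (W.Y n b w - W.Y n a w)"] nonneg[of "W.N n 1" "\<lambda>_. 1"] N0 g c(2)
      by (subst (asm) ennreal_inj) auto
  qed
  have NL: "AE w in M. (\<lambda>n. W.N n 1 w) \<longlonglongrightarrow> L w" using N_lim by (rule AE_completion)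
  have YL: "AE w in M. (\<lambda>n. indicator A w * g (W.Y n b w - W.Y n a w)) \<longlonglongrightarrow> indicator A w * g (V w b - V w a)"
    using AE_completion[OF Y_lim]
  proof eventually_elim
    case (elim w)
    have "(\<lambda>n. W.Y n b w - W.Y n a w) \<longlonglongrightarrow> V w b - V w a"
      using elim ab by (intro tendsto_diff) auto
    then have "(\<lambda>n. g (W.Y n b w - W.Y n a w)) \<longlonglongrightarrow> g (V w b - V w a)"
      by (rule continuous_on_tendsto_compose[OF g(1)]) auto
    then show ?case by (intro tendsto_intros)
  qed
  have "(\<lambda>n. \<integral>w. (indicator A w * g (W.Y n b w - W.Y n a w)) * W.N n 1 w \<partial>M) \<longlonglongrightarrow> (\<integral>w. (indicator A w * g (V w b - V w a)) * L w \<partial>M)"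
    by (rule tendsto_integral_mult_L1[OF Ni(1) L_integrable N0 L0 NL _ _ _ _ _ YL])
       (use g in \<open>auto simp: Ni(2) L_integral_M indicator_def\<close>)
  moreover have "(\<lambda>n. (\<integral>w. (indicator A w * 1) * W.N n 1 w \<partial>M) * c) \<longlonglongrightarrow> (\<integral>w. (indicator A w * 1) * L w \<partial>M) * c"
    by (intro tendsto_mult tendsto_const tendsto_integral_mult_L1[OF Ni(1) L_integrable N0 L0 NL])
       (auto simp: Ni(2) L_integral_M indicator_def)
  ultimately have "(\<integral>w. (indicator A w * g (V w b - V w a)) * L w \<partial>M) = (\<integral>w. (indicator A w * 1) * L w \<partial>M) * c"
    unfolding eqn by (rule LIMSEQ_unique)
  then show ?thesis
    using conv[OF L_integrable L0, of "\<lambda>w. g (V w b - V w a)"] conv[OF L_integrable L0, of "\<lambda>_. 1"] g c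
    by (simp add: ennreal_mult'')
qed

text \<open>For fixed \<open>A\<close> both sides are finite measures in \<open>C\<close>, so
  continuous test functions decide. The filtration is the canonical one, which
  \<open>inverse_adapted\<close> exploits: there \<open>A\<close> is an event of the original path,
  not one expressed through \<open>V\<close>.\<close>

proposition bm_V: "bm_from \<nu> G (\<lambda>r w. V w r) 0 {}"
proof -
  interpret M: prob_space M by (rule prob_M)
  have [measurable]: "(\<lambda>w. V w r) \<in> borel_measurable M" for r
    by (rule measurable_wpathD(1)[OF sets_\<mu> V_measurable])
  have L0: "AE w in M. 0 \<le> L w" using L_pos by eventually_elim simp
  have L1: "(\<integral>\<^sup>+w. ennreal (L w) \<partial>M) = 1"
    using nn_integral_eq_integral[OF L_integrable L0] L_integral_M by simp
  have "prob_space \<nu>"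
  proof (rule prob_spaceI)
    have "emeasure \<nu> (space M) = (\<integral>\<^sup>+w. ennreal (L w) \<partial>M)"
      by (subst emeasure_density) (auto intro!: nn_integral_cong)
    then show "emeasure \<nu> (space \<nu>) = 1" by (simp add: L1)
  qed
  moreover have "emeasure \<nu> (A \<inter> {w\<in>space M. V w b - V w a \<in> C}) = emeasure \<nu> A * emeasure (gauss_vec (b - a)) C"
    if ab: "0 \<le> a" "a < b" "b \<le> 1" and A: "A \<in> sets (G a)" and C [measurable]: "C \<in> sets borel" for a b A C
  proof -
    interpret \<gamma>: prob_space "gauss_vec (b - a) :: (real ^ 'n) measure" using ab by (intro prob_space_gauss_vec) auto
    have [measurable]: "A \<in> sets M" using A sub_G[of a] ab by (auto simp: subalgebra_def)
    define c where "c = (\<integral>\<^sup>+w. indicator A w * ennreal (L w) \<partial>M)"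
    have c1: "c \<le> 1" unfolding c_def L1[symmetric] by (intro nn_integral_mono) (auto simp: indicator_def)
    let ?f = "\<lambda>w. indicator A w * ennreal (L w)"
    \<comment> \<open>The event \<open>A\<close> is moved into the density, which turns independence
      into an equality of two measures on the state space.\<close>
    have "distr (density M ?f) borel (\<lambda>w. V w b - V w a) = density (gauss_vec (b - a)) (\<lambda>_. c)"
    proof (rule borel_measure_eqI_continuous)
      show "finite_measure (distr (density M ?f) borel (\<lambda>w. V w b - V w a))"
      proof (rule finite_measure.finite_measure_distr)
        have "emeasure (density M ?f) (space M) = c"
          unfolding c_def by (subst emeasure_density) (auto intro!: nn_integral_cong)
        then show "finite_measure (density M ?f)"
          using c1 by (intro finite_measureI) (auto simp: top_unique)
      qed simp
      fix g :: "real ^ 'n \<Rightarrow> real" assume g: "continuous_on UNIV g" "\<And>x. 0 \<le> g x" "\<And>x. g x \<le> 1"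
      have [measurable]: "g \<in> borel_measurable borel" by (rule borel_measurable_continuous_onI[OF g(1)])
      have "(\<integral>\<^sup>+x. ennreal (g x) \<partial>distr (density M ?f) borel (\<lambda>w. V w b - V w a))
         = (\<integral>\<^sup>+w. indicator A w * ennreal (g (V w b - V w a)) * ennreal (L w) \<partial>M)"
        by (subst nn_integral_distr) (auto simp: nn_integral_density ac_simps)
      also have "\<dots> = c * (\<integral>\<^sup>+y. ennreal (g y) \<partial>gauss_vec (b - a))"
        unfolding c_def by (rule V_increment_continuous[OF ab A g])
      also have "\<dots> = (\<integral>\<^sup>+y. ennreal (g y) \<partial>density (gauss_vec (b - a)) (\<lambda>_. c))"
      proof -
        have [measurable]: "(\<lambda>y. ennreal (g y)) \<in> borel_measurable (gauss_vec (b - a))" by measurable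
        show ?thesis by (subst nn_integral_density) (auto simp: nn_integral_cmult)
      qed
      finally show "(\<integral>\<^sup>+x. ennreal (g x) \<partial>distr (density M ?f) borel (\<lambda>w. V w b - V w a))
        = (\<integral>\<^sup>+y. ennreal (g y) \<partial>density (gauss_vec (b - a)) (\<lambda>_. c))" .
    qed auto
    then have "emeasure (distr (density M ?f) borel (\<lambda>w. V w b - V w a)) C = c * emeasure (gauss_vec (b - a)) C"
      by (simp add: emeasure_density nn_integral_cmult)
    moreover have "emeasure (distr (density M ?f) borel (\<lambda>w. V w b - V w a)) C = emeasure \<nu> (A \<inter> {w\<in>space M. V w b - V w a \<in> C})"
    proof -
      have d [measurable]: "(\<lambda>w. V w b - V w a) \<in> borel_measurable M" by measurable
      have m1: "(\<lambda>w. V w b - V w a) -` C \<inter> space M \<in> sets M" by (rule measurable_sets[OF d C])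
      have m2: "A \<inter> {w\<in>space M. V w b - V w a \<in> C} \<in> sets M" by measurable
      have "emeasure (distr (density M ?f) borel (\<lambda>w. V w b - V w a)) C
         = (\<integral>\<^sup>+w. ?f w * indicator ((\<lambda>w. V w b - V w a) -` C \<inter> space M) w \<partial>M)"
        using m1 by (subst emeasure_distr) (auto simp: emeasure_density)
      also have "\<dots> = emeasure \<nu> (A \<inter> {w\<in>space M. V w b - V w a \<in> C})"
        using m2 by (subst emeasure_density) (auto intro!: nn_integral_cong simp: indicator_def)
      finally show ?thesis .
    qed
    moreover have "c = emeasure \<nu> A"
      unfolding c_def by (subst emeasure_density) (auto simp: mult.commute)
    ultimately show ?thesis by simp
  qed
  ultimately show ?thesis
    using bm_W V_adapted unfolding bm_from_def by (auto simp: subalgebra_def)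
qed

corollary distr_V: "distr \<nu> \<mu> V = \<mu>"
  by (rule bm_from_law[OF wiener bm_V]) (use V_measurable in auto)

end

section \<open>Approximation by continuous functionals\<close>

lemma tendsto_fun_coordinatewise:
  fixes f :: "nat \<Rightarrow> 'i \<Rightarrow> 'b::topological_space"
  assumes "\<And>i. (\<lambda>n. f n i) \<longlonglongrightarrow> l i"
  shows "f \<longlonglongrightarrow> l"
proof -
  have "limitin (product_topology (\<lambda>i::'i. euclidean :: 'b topology) UNIV) f l sequentially"
    using assms by (simp add: limitin_componentwise)
  then show ?thesis unfolding euclidean_product_topology by simp
qed

text \<open>
  Continuity refers to pointwise convergence of paths.  The sets approximable in \<open>L\<^sup>1\<close> by such
  functionals form a \<open>\<sigma>\<close>-algebra, so the uniform topology of the path space is not needed.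
\<close>

definition cont_approx :: "('n::finite) wpath measure \<Rightarrow> 'n wpath set \<Rightarrow> bool" where
  "cont_approx \<mu> A \<longleftrightarrow> A \<in> sets \<mu> \<and> (\<forall>e>0. \<exists>F :: 'n wpath \<Rightarrow> real. continuous_on UNIV F \<and> (\<forall>w. 0 \<le> F w \<and> F w \<le> 1) \<and>
     F \<in> borel_measurable \<mu> \<and> (\<integral>w. \<bar>F w - indicator A w\<bar> \<partial>\<mu>) < e)"

context
  fixes \<mu> :: "('n::finite) wpath measure"
  assumes \<mu>: "finite_measure \<mu>" and sets_\<mu>: "sets \<mu> = sets wiener_algebra"
begin

lemma integrable_unit_diff:
  assumes [measurable]: "F \<in> borel_measurable \<mu>" "A \<in> sets \<mu>" and "\<And>w. 0 \<le> F w \<and> F w \<le> (1::real)"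
  shows "integrable \<mu> (\<lambda>w. \<bar>F w - indicator A w\<bar>)"
proof (rule finite_measure.integrable_const_bound[OF \<mu>, of _ 1])
  show "AE w in \<mu>. norm \<bar>F w - indicator A w\<bar> \<le> 1"
  proof (rule AE_I2)
    fix w
    show "norm \<bar>F w - indicator A w\<bar> \<le> 1" using assms(3)[of w] by (simp split: split_indicator)
  qed
qed measurable

lemma cont_approx_compl:
  assumes "cont_approx \<mu> A"
  shows "cont_approx \<mu> (space \<mu> - A)"
  unfolding cont_approx_def
proof (intro conjI allI impI)
  show "space \<mu> - A \<in> sets \<mu>" using assms by (auto simp: cont_approx_def)
  fix e :: real assume "e > 0"
  then obtain F where F: "continuous_on UNIV F" "\<forall>w. 0 \<le> F w \<and> F w \<le> 1" "F \<in> borel_measurable \<mu>" "(\<integral>w. \<bar>F w - indicator A w\<bar> \<partial>\<mu>) < e"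
    using assms unfolding cont_approx_def by blast
  have "(\<integral>w. \<bar>1 - F w - indicator (space \<mu> - A) w\<bar> \<partial>\<mu>) = (\<integral>w. \<bar>F w - indicator A w\<bar> \<partial>\<mu>)"
    by (intro Bochner_Integration.integral_cong) (auto simp: indicator_def)
  then show "\<exists>F. continuous_on UNIV F \<and> (\<forall>w. 0 \<le> F w \<and> F w \<le> 1) \<and> F \<in> borel_measurable \<mu> \<and> (\<integral>w. \<bar>F w - indicator (space \<mu> - A) w\<bar> \<partial>\<mu>) < e"
    using F by (intro exI[of _ "\<lambda>w. 1 - F w"]) (auto intro!: continuous_intros)
qed

lemma cont_approx_empty: "cont_approx \<mu> {}"
  unfolding cont_approx_def by (auto intro!: exI[of _ "\<lambda>_. 0"])

text \<open>The maximum of two approximations differs from the indicator of the union by at most the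
  sum of the two errors.\<close>

lemma cont_approx_Un:
  assumes "cont_approx \<mu> A" "cont_approx \<mu> B"
  shows "cont_approx \<mu> (A \<union> B)"
  unfolding cont_approx_def
proof (intro conjI allI impI)
  have [measurable]: "A \<in> sets \<mu>" "B \<in> sets \<mu>" using assms by (auto simp: cont_approx_def)
  then show "A \<union> B \<in> sets \<mu>" by auto
  fix e :: real assume "e > 0"
  then have "e / 2 > 0" by simp
  then obtain F H where F: "continuous_on UNIV F" "\<And>w. 0 \<le> F w \<and> F w \<le> 1" "F \<in> borel_measurable \<mu>" "(\<integral>w. \<bar>F w - indicator A w\<bar> \<partial>\<mu>) < e / 2"
    and H: "continuous_on UNIV H" "\<And>w. 0 \<le> H w \<and> H w \<le> 1" "H \<in> borel_measurable \<mu>" "(\<integral>w. \<bar>H w - indicator B w\<bar> \<partial>\<mu>) < e / 2"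
    using assms unfolding cont_approx_def by meson
  have [measurable]: "F \<in> borel_measurable \<mu>" "H \<in> borel_measurable \<mu>" by fact+
  have FH: "0 \<le> max (F w) (H w) \<and> max (F w) (H w) \<le> 1" for w using F(2)[of w] H(2)[of w] by auto
  have i: "integrable \<mu> (\<lambda>w. \<bar>F w - indicator A w\<bar>)" "integrable \<mu> (\<lambda>w. \<bar>H w - indicator B w\<bar>)"
    using F H by (auto intro!: integrable_unit_diff)
  have "(\<integral>w. \<bar>max (F w) (H w) - indicator (A \<union> B) w\<bar> \<partial>\<mu>) \<le> (\<integral>w. \<bar>F w - indicator A w\<bar> + \<bar>H w - indicator B w\<bar> \<partial>\<mu>)"
  proof (intro integral_mono)
    show "integrable \<mu> (\<lambda>w. \<bar>max (F w) (H w) - indicator (A \<union> B) w\<bar>)"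
      using FH by (intro integrable_unit_diff) auto
    fix w
    show "\<bar>max (F w) (H w) - indicator (A \<union> B) w\<bar> \<le> \<bar>F w - indicator A w\<bar> + \<bar>H w - indicator B w\<bar>"
      using F(2)[of w] H(2)[of w] by (auto simp: indicator_def max_def abs_if)
  qed (use i in auto)
  also have "\<dots> < e" using i F(4) H(4) by simp
  finally show "\<exists>F. continuous_on UNIV F \<and> (\<forall>w. 0 \<le> F w \<and> F w \<le> 1) \<and> F \<in> borel_measurable \<mu> \<and> (\<integral>w. \<bar>F w - indicator (A \<union> B) w\<bar> \<partial>\<mu>) < e"
    using F(1) H(1) FH by (intro exI[of _ "\<lambda>w. max (F w) (H w)"]) (auto intro!: continuous_on_max)
qed

text \<open>Finite unions exhaust the measure of the whole union: half of \<open>e\<close> pays for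
  truncating it, the other half for approximating the finite part.\<close>

lemma cont_approx_UN:
  assumes A: "\<And>i::nat. cont_approx \<mu> (A i)"
  shows "cont_approx \<mu> (\<Union>i. A i)"
  unfolding cont_approx_def
proof (intro conjI allI impI)
  interpret finite_measure \<mu> by (rule \<mu>)
  have m [measurable]: "A i \<in> sets \<mu>" for i using A by (auto simp: cont_approx_def)
  then show U [measurable]: "(\<Union>i. A i) \<in> sets \<mu>" by auto
  fix e :: real assume e: "e > 0"
  have fin: "cont_approx \<mu> (\<Union>i<n. A i)" for n :: nat
    by (induction n) (auto simp: lessThan_Suc cont_approx_empty intro!: cont_approx_Un A)
  have "(\<lambda>n. measure \<mu> (\<Union>i<n. A i)) \<longlonglongrightarrow> measure \<mu> (\<Union>n. \<Union>i<n. A i)"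
  proof (rule finite_Lim_measure_incseq)
    show "incseq (\<lambda>n. \<Union>i<n. A i)" unfolding incseq_def by (intro allI impI UN_mono) auto
  qed auto
  also have "(\<Union>n. \<Union>i<n. A i) = (\<Union>i. A i)" by auto
  finally have "eventually (\<lambda>n. measure \<mu> (\<Union>i<n. A i) > measure \<mu> (\<Union>i. A i) - e / 2) sequentially"
    using e by (intro order_tendstoD) auto
  then obtain n where n: "measure \<mu> (\<Union>i<n. A i) > measure \<mu> (\<Union>i. A i) - e / 2"
    by (auto simp: eventually_sequentially)
  let ?A = "\<Union>i<n. A i"
  have [measurable]: "?A \<in> sets \<mu>" by auto
  have "e / 2 > 0" using e by simp
  then obtain F where F: "continuous_on UNIV F" "\<And>w. 0 \<le> F w \<and> F w \<le> 1" "F \<in> borel_measurable \<mu>" "(\<integral>w. \<bar>F w - indicator ?A w\<bar> \<partial>\<mu>) < e / 2"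
    using fin[of n] unfolding cont_approx_def by meson
  have i: "integrable \<mu> (\<lambda>w. \<bar>F w - indicator ?A w\<bar>)"
    using F by (intro integrable_unit_diff) auto
  have "(\<integral>w. \<bar>F w - indicator (\<Union>i. A i) w\<bar> \<partial>\<mu>) \<le> (\<integral>w. \<bar>F w - indicator ?A w\<bar> + indicator ((\<Union>i. A i) - ?A) w \<partial>\<mu>)"
  proof (intro integral_mono)
    show "integrable \<mu> (\<lambda>w. \<bar>F w - indicator (\<Union>i. A i) w\<bar>)"
      using F by (intro integrable_unit_diff) auto
    show "integrable \<mu> (\<lambda>w. \<bar>F w - indicator ?A w\<bar> + indicator ((\<Union>i. A i) - ?A) w)"
      using i by (intro Bochner_Integration.integrable_add) (auto simp: emeasure_eq_measure)
    fix w
    have "?A \<subseteq> (\<Union>i. A i)" by auto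
    then show "\<bar>F w - indicator (\<Union>i. A i) w\<bar> \<le> \<bar>F w - indicator ?A w\<bar> + indicator ((\<Union>i. A i) - ?A) w"
      using F(2)[of w] by (cases "w \<in> ?A"; cases "w \<in> (\<Union>i. A i)") (auto simp: indicator_def)
  qed
  also have "\<dots> = (\<integral>w. \<bar>F w - indicator ?A w\<bar> \<partial>\<mu>) + measure \<mu> ((\<Union>i. A i) - ?A)"
    using i sets.sets_into_space[OF U] by (subst Bochner_Integration.integral_add) (auto simp: emeasure_eq_measure intro!: arg_cong[where f="measure \<mu>"])
  also have "measure \<mu> ((\<Union>i. A i) - ?A) = measure \<mu> (\<Union>i. A i) - measure \<mu> ?A"
    by (rule finite_measure_Diff) auto
  finally have "(\<integral>w. \<bar>F w - indicator (\<Union>i. A i) w\<bar> \<partial>\<mu>) < e" using F(4) n by simp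
  then show "\<exists>F. continuous_on UNIV F \<and> (\<forall>w. 0 \<le> F w \<and> F w \<le> 1) \<and> F \<in> borel_measurable \<mu> \<and> (\<integral>w. \<bar>F w - indicator (\<Union>i. A i) w\<bar> \<partial>\<mu>) < e"
    using F by auto
qed

lemma cont_approx_open:
  assumes "open U"
  shows "cont_approx \<mu> {w\<in>space \<mu>. w r \<in> U}"
  unfolding cont_approx_def
proof (intro conjI allI impI)
  interpret finite_measure \<mu> by (rule \<mu>)
  note ev = measurable_wpath_eval[OF sets_\<mu>, of r]
  have "{w\<in>space \<mu>. w r \<in> U} = (\<lambda>w. w r) -` U \<inter> space \<mu>" by auto
  then show S [measurable]: "{w\<in>space \<mu>. w r \<in> U} \<in> sets \<mu>" using measurable_sets[OF ev borel_open[OF assms]] by simp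
  fix e :: real assume e: "e > 0"
  obtain f :: "nat \<Rightarrow> real ^ 'n \<Rightarrow> real" where f: "\<And>n. continuous_on UNIV (f n)" "\<And>n x. 0 \<le> f n x \<and> f n x \<le> 1"
     "\<And>x. (\<lambda>n. f n x) \<longlonglongrightarrow> indicat_real U x"
    using open_indicator_approx[OF assms] by blast
  have fm: "(\<lambda>w. f n (w r)) \<in> borel_measurable \<mu>" for n
    by (rule measurable_compose[OF ev borel_measurable_continuous_onI[OF f(1)]])
  have "(\<lambda>n. \<integral>w. \<bar>f n (w r) - indicator {w\<in>space \<mu>. w r \<in> U} w\<bar> \<partial>\<mu>) \<longlonglongrightarrow> (\<integral>w. 0 \<partial>\<mu>)"
  proof (rule integral_dominated_convergence[where w="\<lambda>_. 1"])
    show "(\<lambda>w. \<bar>f n (w r) - indicator {w\<in>space \<mu>. w r \<in> U} w\<bar>) \<in> borel_measurable \<mu>" for n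
      using fm[of n] S by auto
    show "AE w in \<mu>. (\<lambda>n. \<bar>f n (w r) - indicator {w\<in>space \<mu>. w r \<in> U} w\<bar>) \<longlonglongrightarrow> 0"
    proof (rule AE_I2)
      fix w assume "w \<in> space \<mu>"
      then have "indicator {w\<in>space \<mu>. w r \<in> U} w = indicat_real U (w r)" by (simp add: indicator_def)
      then show "(\<lambda>n. \<bar>f n (w r) - indicator {w\<in>space \<mu>. w r \<in> U} w\<bar>) \<longlonglongrightarrow> 0"
        using f(3)[of "w r"] by (simp add: LIM_zero tendsto_rabs_zero)
    qed
    show "AE w in \<mu>. norm \<bar>f n (w r) - indicator {w\<in>space \<mu>. w r \<in> U} w\<bar> \<le> 1" for n
    proof (rule AE_I2)
      fix w
      show "norm \<bar>f n (w r) - indicator {w\<in>space \<mu>. w r \<in> U} w\<bar> \<le> 1"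
        using f(2)[of n "w r"] by (simp split: split_indicator)
    qed
  qed auto
  then have "eventually (\<lambda>n. (\<integral>w. \<bar>f n (w r) - indicator {w\<in>space \<mu>. w r \<in> U} w\<bar> \<partial>\<mu>) < e) sequentially"
    using e by (intro order_tendstoD(2)) auto
  then obtain n where n: "(\<integral>w. \<bar>f n (w r) - indicator {w\<in>space \<mu>. w r \<in> U} w\<bar> \<partial>\<mu>) < e"
    by (auto simp: eventually_sequentially)
  have "continuous_on UNIV (\<lambda>w :: 'n wpath. f n (w r))"
    by (rule continuous_on_compose2[OF f(1) continuous_on_product_coordinates]) auto
  then show "\<exists>F. continuous_on UNIV F \<and> (\<forall>w. 0 \<le> F w \<and> F w \<le> 1) \<and> F \<in> borel_measurable \<mu> \<and> (\<integral>w. \<bar>F w - indicator {w\<in>space \<mu>. w r \<in> U} w\<bar> \<partial>\<mu>) < e"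
    using n fm f(2) by (intro exI[of _ "\<lambda>w. f n (w r)"]) auto
qed

lemma cont_approx_borel:
  assumes "C \<in> sets borel"
  shows "cont_approx \<mu> {w\<in>space \<mu>. w r \<in> C}"
proof -
  have "C \<in> sigma_sets UNIV {S. open S}" using assms by (simp add: borel_def)
  then show ?thesis
  proof (induction rule: sigma_sets.induct)
    case (Basic U) then show ?case by (intro cont_approx_open) auto
  next
    case Empty then show ?case using cont_approx_empty by simp
  next
    case (Compl C)
    have "{w\<in>space \<mu>. w r \<in> UNIV - C} = space \<mu> - {w\<in>space \<mu>. w r \<in> C}" by auto
    then show ?case using cont_approx_compl[OF Compl.IH] by simp
  next
    case (Union C)
    have "{w\<in>space \<mu>. w r \<in> (\<Union>i. C i)} = (\<Union>i. {w\<in>space \<mu>. w r \<in> C i})" by auto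
    then show ?case using cont_approx_UN[OF Union.IH] by simp
  qed
qed

proposition cont_approx_sets:
  assumes "A \<in> sets \<mu>"
  shows "cont_approx \<mu> A"
proof -
  note sp = space_wpath[OF sets_\<mu>]
  have "A \<in> sets wiener_algebra" using assms sets_\<mu> by simp
  then obtain B where B: "B \<in> sets (\<Pi>\<^sub>M t\<in>(UNIV::real set). (borel :: (real ^ 'n) measure))" and AB: "A = space \<mu> \<inter> B"
    unfolding wiener_algebra_def sp by (auto simp: sets_restrict_space)
  from B have "cont_approx \<mu> (space \<mu> \<inter> B)"
    unfolding sets_PiM_single
  proof (induction rule: sigma_sets.induct)
    case (Basic S)
    then obtain i C where C: "C \<in> sets borel" "S = {f \<in> \<Pi>\<^sub>E i\<in>UNIV. space borel. f i \<in> C}" by blast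
    then have "space \<mu> \<inter> S = {w\<in>space \<mu>. w i \<in> C}" by auto
    then show ?case using cont_approx_borel[OF C(1)] by simp
  next
    case Empty then show ?case using cont_approx_empty by simp
  next
    case (Compl S)
    have "space \<mu> \<inter> ((\<Pi>\<^sub>E i\<in>UNIV. space borel) - S) = space \<mu> - (space \<mu> \<inter> S)" by auto
    then show ?case using cont_approx_compl[OF Compl.IH] by simp
  next
    case (Union S)
    have "space \<mu> \<inter> (\<Union>i. S i) = (\<Union>i. space \<mu> \<inter> S i)" by auto
    then show ?case using cont_approx_UN[OF Union.IH] by simp
  qed
  then show ?thesis by (simp add: AB)
qed

corollary continuous_AE_approx:
  assumes A: "A \<in> sets \<mu>"
  obtains F :: "nat \<Rightarrow> 'n wpath \<Rightarrow> real" where "\<And>n. continuous_on UNIV (F n)" "\<And>n w. 0 \<le> F n w \<and> F n w \<le> 1"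
    "\<And>n. F n \<in> borel_measurable \<mu>" "AE w in \<mu>. (\<lambda>n. F n w) \<longlonglongrightarrow> indicator A w"
proof -
  have "\<forall>n. \<exists>F :: 'n wpath \<Rightarrow> real. continuous_on UNIV F \<and> (\<forall>w. 0 \<le> F w \<and> F w \<le> 1) \<and>
     F \<in> borel_measurable \<mu> \<and> (\<integral>w. \<bar>F w - indicator A w\<bar> \<partial>\<mu>) < inverse (real (Suc n))"
    using cont_approx_sets[OF A] unfolding cont_approx_def by simp
  from choice[OF this] obtain F where F: "\<And>n. continuous_on UNIV (F n)" "\<And>n w. 0 \<le> F n w \<and> F n w \<le> 1"
    "\<And>n. F n \<in> borel_measurable \<mu>" "\<And>n. (\<integral>w. \<bar>F n w - indicator A w\<bar> \<partial>\<mu>) < inverse (real (Suc n))"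
    by blast
  have i: "integrable \<mu> (\<lambda>w. \<bar>F n w - indicator A w\<bar>)" for n
    using F A by (intro integrable_unit_diff) auto
  have "(\<lambda>n. \<integral>w. norm \<bar>F n w - indicator A w\<bar> \<partial>\<mu>) \<longlonglongrightarrow> 0"
    by (rule tendsto_sandwich[OF _ _ tendsto_const LIMSEQ_inverse_real_of_nat])
       (use F(4) in \<open>auto intro!: always_eventually less_imp_le\<close>)
  from tendsto_L1_AE_subseq[OF i this] obtain r where r: "strict_mono r" "AE w in \<mu>. (\<lambda>n. \<bar>F (r n) w - indicator A w\<bar>) \<longlonglongrightarrow> 0"
    by blast
  from r(2) have "AE w in \<mu>. (\<lambda>n. F (r n) w) \<longlonglongrightarrow> indicator A w"
    by eventually_elim (simp add: tendsto_rabs_zero_iff LIM_zero_iff)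
  then show ?thesis using F by (intro that[of "\<lambda>n. F (r n)"]) auto
qed

end

section \<open>The law of a strong solution\<close>

lemma bm_from_cong:
  assumes bm: "bm_from M G X t E" and eq: "\<And>r w. 0 \<le> r \<Longrightarrow> r \<le> 1 \<Longrightarrow> X r w = X' r w"
  shows "bm_from M G X' t E"
proof -
  have e: "X r = X' r" if "0 \<le> r" "r \<le> 1" for r using eq that by auto
  have "emeasure M (A \<inter> {w\<in>space M. X' b w - X' a w \<in> C}) = emeasure M A * emeasure (gauss_vec (b - a)) C"
    if "t \<le> a" "a < b" "b \<le> 1" "{a<..<b} \<inter> E = {}" "A \<in> sets (G a)" "C \<in> sets borel" for a b A C
    using bm_fromD(6)[OF bm that] bm_fromD(2)[OF bm] that e[of a] e[of b] by simp
  then show ?thesis using bm e unfolding bm_from_def by simp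
qed

text \<open>This transports the almost sure limits of the coordinate process, and the formula for
  \<open>L\<close>, to an arbitrary solution.\<close>

lemma abs_cont_map_AE:
  assumes X: "abs_cont_map \<mu> X" and P: "AE w in \<mu>. P w"
  shows "AE w in completion \<mu>. P (X w)"
proof -
  have Xm: "X \<in> completion \<mu> \<rightarrow>\<^sub>M \<mu>" and ac: "absolutely_continuous \<mu> (distr (completion \<mu>) \<mu> X)"
    using X by (auto simp: abs_cont_map_def)
  obtain N where N: "N \<in> null_sets \<mu>" "\<And>w. w \<in> space \<mu> - N \<Longrightarrow> P w" using P by (auto elim!: AE_E3)
  then have "N \<in> null_sets (distr (completion \<mu>) \<mu> X)" using ac by (auto simp: absolutely_continuous_def)
  then have "X -` N \<inter> space (completion \<mu>) \<in> null_sets (completion \<mu>)"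
    using Xm by (simp add: null_sets_distr_iff)
  then show ?thesis
    by (rule AE_I') (use N(2) measurable_space[OF Xm] in auto)
qed

lemma abs_cont_map_null:
  assumes X: "abs_cont_map \<mu> X" and N: "N \<in> null_sets \<mu>"
  shows "X -` N \<inter> space \<mu> \<in> null_sets (completion \<mu>)"
proof -
  have Xm: "X \<in> completion \<mu> \<rightarrow>\<^sub>M \<mu>" and ac: "absolutely_continuous \<mu> (distr (completion \<mu>) \<mu> X)"
    using X by (auto simp: abs_cont_map_def)
  then have "N \<in> null_sets (distr (completion \<mu>) \<mu> X)" using N by (auto simp: absolutely_continuous_def)
  then show ?thesis using Xm by (simp add: null_sets_distr_iff)
qed

text \<open>Adaptedness handles the evaluations and absolute continuity the null sets, so
  functionals adapted to \<open>Y\<close> become adapted to \<open>B\<close> after composition with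
  \<open>X\<close>.\<close>

lemma measurable_comp_aug:
  assumes X: "abs_cont_map \<mu> X"
    and ad: "\<And>s. 0 \<le> s \<Longrightarrow> s \<le> r \<Longrightarrow> (\<lambda>w. Y (X w) s) \<in> borel_measurable (aug_filtration \<mu> B r)"
  shows "X \<in> aug_filtration \<mu> B r \<rightarrow>\<^sub>M aug_filtration \<mu> Y r"
proof (rule measurable_into_aug)
  have Xm: "X \<in> completion \<mu> \<rightarrow>\<^sub>M \<mu>" using X by (auto simp: abs_cont_map_def)
  show "X \<in> space (aug_filtration \<mu> B r) \<rightarrow> space \<mu>" using measurable_space[OF Xm] by auto
  fix A assume "A \<in> null_sets \<mu>"
  then have N: "X -` A \<inter> space \<mu> \<in> null_sets (completion \<mu>)" by (rule abs_cont_map_null[OF X])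
  have "C \<in> sets (aug_filtration \<mu> B r)" if "C \<subseteq> X -` A \<inter> space \<mu>" for C
    by (rule null_sets_in_aug[OF null_sets_completion_subset[OF that N]])
  then show "\<exists>N\<in>sets (aug_filtration \<mu> B r). X -` A \<inter> space (aug_filtration \<mu> B r) \<subseteq> N \<and> (\<forall>C\<subseteq>N. C \<in> sets (aug_filtration \<mu> B r))"
    by (intro bexI[of _ "X -` A \<inter> space \<mu>"]) simp_all
qed (use ad in auto)

lemma sum_simple_proc_integral:
  fixes f :: "real \<Rightarrow> real ^ 'n::finite" and \<xi> :: "nat \<Rightarrow> 'a \<Rightarrow> real ^ 'n"
  assumes f: "L2 lb01 f" and t: "\<And>j. j < k \<Longrightarrow> 0 \<le> t j \<and> t j \<le> t (Suc j) \<and> t (Suc j) \<le> 1"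
  shows "(\<Sum>j<k. \<xi> j w \<bullet> ((LBINT s:{0..t (Suc j)}. f s) - (LBINT s:{0..t j}. f s)))
     = (\<integral>s. simple_proc t k \<xi> s w \<bullet> f s \<partial>lb01)"
proof -
  have i: "integrable lb01 (\<lambda>s. indicat_real S s *\<^sub>R f s)" if "S \<in> sets borel" for S
    by (rule L2_set_integrable(1)[OF L2_indicator[OF that f]])
  have "\<xi> j w \<bullet> ((LBINT s:{0..t (Suc j)}. f s) - (LBINT s:{0..t j}. f s)) = (\<integral>s. (indicat_real {t j<..t (Suc j)} s *\<^sub>R \<xi> j w) \<bullet> f s \<partial>lb01)"
    if j: "j < k" for j
  proof -
    have "(LBINT s:{0..t (Suc j)}. f s) - (LBINT s:{0..t j}. f s)
       = (\<integral>s. indicat_real {0..t (Suc j)} s *\<^sub>R f s - indicat_real {0..t j} s *\<^sub>R f s \<partial>lb01)"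
      using t[OF j] i by (simp add: set_integral_lb01_sub)
    also have "\<dots> = (\<integral>s. indicat_real {t j<..t (Suc j)} s *\<^sub>R f s \<partial>lb01)"
      using t[OF j] by (intro Bochner_Integration.integral_cong) (auto simp: indicator_def)
    finally show ?thesis
      using i[of "{t j<..t (Suc j)}"] by (simp flip: integral_inner_right)
  qed
  then have "(\<Sum>j<k. \<xi> j w \<bullet> ((LBINT s:{0..t (Suc j)}. f s) - (LBINT s:{0..t j}. f s)))
     = (\<Sum>j<k. \<integral>s. (indicat_real {t j<..t (Suc j)} s *\<^sub>R \<xi> j w) \<bullet> f s \<partial>lb01)"
    by simp
  also have "\<dots> = (\<integral>s. (\<Sum>j<k. (indicat_real {t j<..t (Suc j)} s *\<^sub>R \<xi> j w) \<bullet> f s) \<partial>lb01)"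
  proof (rule Bochner_Integration.integral_sum[symmetric])
    fix j
    show "integrable lb01 (\<lambda>s. (indicat_real {t j<..t (Suc j)} s *\<^sub>R \<xi> j w) \<bullet> f s)"
      using integrable_inner_right[OF i[of "{t j<..t (Suc j)}"], of "\<xi> j w"] by simp
  qed
  finally show ?thesis by (simp add: simple_proc_def inner_sum_left)
qed

lemma nn_integral_le_liminf:
  fixes f :: "nat \<Rightarrow> 'a \<Rightarrow> ennreal"
  assumes f: "\<And>n. f n \<in> borel_measurable M" and lim: "AE x in M. (\<lambda>n. f n x) \<longlonglongrightarrow> g x"
  shows "(\<integral>\<^sup>+x. g x \<partial>M) \<le> liminf (\<lambda>n. \<integral>\<^sup>+x. f n x \<partial>M)"
proof -
  have "(\<integral>\<^sup>+x. g x \<partial>M) = (\<integral>\<^sup>+x. liminf (\<lambda>n. f n x) \<partial>M)"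
    using lim by (intro nn_integral_cong_AE) (auto elim!: eventually_mono intro!: lim_imp_Liminf[symmetric])
  also have "\<dots> \<le> liminf (\<lambda>n. \<integral>\<^sup>+x. f n x \<partial>M)" by (rule nn_integral_liminf[OF f])
  finally show ?thesis .
qed

context ito_drift
begin

theorem strong_solution_law:
  assumes B: "B \<in> M \<rightarrow>\<^sub>M \<mu>" and law_B: "distr M \<mu> B = \<mu>" and X: "strong_solution \<mu> vdot B X"
  shows "distr M \<mu> X = density \<mu> (\<lambda>w. ennreal (L w))"
proof -
  interpret M: prob_space M by (rule prob_M)
  interpret \<mu>: prob_space \<mu> by (rule wiener_measureD(1)[OF wiener])
  have ac: "abs_cont_map \<mu> X" and adX: "\<And>r. 0 \<le> r \<Longrightarrow> r \<le> 1 \<Longrightarrow> (\<lambda>w. X w r) \<in> borel_measurable (aug_filtration \<mu> B r)"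
    and eqX: "AE w in \<mu>. \<forall>r\<in>{0..1}. X w r = B w r - (LBINT s:{0..r}. vdot s (X w))"
    using X by (auto simp: strong_solution_def)
  have Xm: "X \<in> M \<rightarrow>\<^sub>M \<mu>" using ac by (simp add: abs_cont_map_def)
  have Xsp: "X w \<in> space \<mu>" if "w \<in> space \<mu>" for w using measurable_space[OF Xm] that by simp
  let ?G = "aug_filtration \<mu> B"
  have bmB: "bm_from M ?G (\<lambda>r w. B w r) 0 {}" by (rule bm_from_wiener_law[OF wiener B law_B])
  have XG: "X \<in> ?G r \<rightarrow>\<^sub>M G r" if "0 \<le> r" "r \<le> 1" for r
  proof (rule measurable_comp_aug[OF ac])
    fix s assume s: "0 \<le> s" "s \<le> r"
    show "(\<lambda>w. X w s) \<in> borel_measurable (?G r)"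
      using adX[of s] s that by (intro measurable_from_subalg[OF bm_fromD(5)[OF bmB, of s r]]) auto
  qed
  \<comment> \<open>The sign is chosen so that adding the primitive of this drift to
    \<open>B\<close> approximates \<open>X\<close> itself.\<close>
  define \<zeta> where "\<zeta> n j w = - \<xi> n j (X w)" for n j w
  interpret S: simple_girsanov M ?G "\<lambda>r w. B w r" "t n" "k n" "\<zeta> n" for n
  proof
    show "\<zeta> n j \<in> borel_measurable (?G (t n j))" if j: "j < k n" for j
      unfolding \<zeta>_def using j t_range01[of j n] measurable_compose[OF XG \<xi>_adapted[OF j]] by auto
  qed (use bmB t_0 t_mono t_k in auto)
  let ?U = "\<lambda>n s w. simple_proc (t n) (k n) (\<xi> n) s w"
  have U\<zeta>: "simple_proc (t n) (k n) (\<zeta> n) s w = - ?U n s (X w)" for n s w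
    by (simp add: simple_proc_def \<zeta>_def sum_negf)
  \<comment> \<open>\<open>Y n\<close> is the equation with the simple drift put in place of the
    limit one: \<open>B\<close> minus the integral of the simple drift along \<open>X\<close>. It is
    a Brownian motion for the density \<open>S.N n 1\<close>, and it converges to \<open>X\<close>.
    The form with \<open>primitive01\<close> makes it an element of the path space.\<close>
  define Y where "Y n w = (\<lambda>r. B w r - primitive01 (\<lambda>s. ?U n s (X w)) r)" for n w
  have sqU: "square_integrable01 (\<lambda>s. ?U n s w)" for n w
    using L2_simple by (simp add: L2_iff_square_integrable01)
  have YS: "S.Y n r w = Y n w r" if "0 \<le> r" "r \<le> 1" for n r w
    using that by (simp add: Y_def primitive01_def simple_drift_def U\<zeta> set_lebesgue_integral_def)
  have Ypath: "Y n w \<in> wiener_paths" if "w \<in> space M" for n w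
    using measurable_wpathD(2)[OF sets_\<mu> B that] primitive01_wpath[OF sqU[of n "X w"]]
    by (auto simp: wiener_paths_def Y_def intro!: continuous_on_diff)
  have Ym [measurable]: "Y n \<in> M \<rightarrow>\<^sub>M \<mu>" for n
  proof (rule measurable_wpathI[OF sets_\<mu> Ypath])
    fix r :: real assume r: "0 \<le> r" "r \<le> 1"
    have "S.D n r \<in> borel_measurable M"
      by (rule measurable_from_subalg[OF bm_fromD(3)[OF bmB r] S.D_measurable[OF r]])
    then have "S.Y n r \<in> borel_measurable M"
      by (intro borel_measurable_add measurable_wpathD(1)[OF sets_\<mu> B])
    then show "(\<lambda>w. Y n w r) \<in> borel_measurable M" using YS[OF r] by simp
  qed
  have Nm [measurable]: "S.N n 1 \<in> borel_measurable M" for n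
    by (rule measurable_from_subalg[OF bm_fromD(3)[OF bmB] S.N_measurable]) auto
  have law_Y: "(\<integral>\<^sup>+w. F (Y n w) * ennreal (S.N n 1 w) \<partial>M) = (\<integral>\<^sup>+w. F w \<partial>\<mu>)"
    if F [measurable]: "F \<in> borel_measurable \<mu>" for F n
  proof -
    have "bm_from (density M (\<lambda>w. ennreal (S.N n 1 w))) ?G (\<lambda>r w. Y n w r) 0 (t n ` {..k n})"
      by (rule bm_from_cong[OF S.bm_from_simple_girsanov YS])
    then have "distr (density M (\<lambda>w. ennreal (S.N n 1 w))) \<mu> (Y n) = \<mu>"
      by (rule bm_from_law[OF wiener]) auto
    then have "(\<integral>\<^sup>+w. F w \<partial>\<mu>) = (\<integral>\<^sup>+w. F w \<partial>distr (density M (\<lambda>w. ennreal (S.N n 1 w))) \<mu> (Y n))"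
      by simp
    also have "\<dots> = (\<integral>\<^sup>+w. F (Y n w) * ennreal (S.N n 1 w) \<partial>M)"
      by (subst nn_integral_distr) (auto simp: nn_integral_density ac_simps)
    finally show ?thesis ..
  qed
  have Ylim: "AE w in M. (\<lambda>n. Y n w) \<longlonglongrightarrow> X w"
    using abs_cont_map_AE[OF ac drift_lim] AE_completion[OF eqX] AE_space
  proof eventually_elim
    case (elim w)
    have w: "w \<in> space \<mu>" "X w \<in> space \<mu>" using elim(3) Xsp by auto
    have "(\<lambda>n. Y n w r) \<longlonglongrightarrow> X w r" for r
    proof (cases "r \<in> {0..1}")
      case True
      have "(\<lambda>n. LBINT s:{0..r}. ?U n s (X w)) \<longlonglongrightarrow> (LBINT s:{0..r}. vdot s (X w))"
        by (rule L2_tendsto_set_integral[OF L2_simple L2_vdot]) (use True elim w in auto)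
      then have "(\<lambda>n. B w r - (LBINT s:{0..r}. ?U n s (X w))) \<longlonglongrightarrow> X w r"
        using elim(2) True by (auto intro!: tendsto_intros)
      then show ?thesis using True by (simp add: Y_def primitive01_def)
    next
      case False
      then have "Y n w r = 0" for n using Ypath[OF elim(3)] unfolding wiener_paths_def by blast
      moreover have "X w r = 0"
        using w(2) False unfolding space_wpath[OF sets_\<mu>] wiener_paths_def by blast
      ultimately show ?thesis by simp
    qed
    then show ?case by (rule tendsto_fun_coordinatewise)
  qed
  have Nlim: "AE w in M. (\<lambda>n. S.N n 1 w) \<longlonglongrightarrow> inverse (L (X w))"
    using abs_cont_map_AE[OF ac drift_lim] abs_cont_map_AE[OF ac ito_lim] abs_cont_map_AE[OF ac L_eq] AE_completion[OF eqX] AE_space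
  proof eventually_elim
    case (elim w)
    let ?v = "\<lambda>s. vdot s (X w)"
    have w: "w \<in> space \<mu>" "X w \<in> space \<mu>" using elim(5) Xsp by auto
    note v = L2_vdot[OF w(2)]
    \<comment> \<open>On increments \<open>B\<close> equals \<open>X\<close> plus the integral of
      the drift along \<open>X\<close>. The sum therefore splits into minus the stochastic sum of
      the locale evaluated at \<open>X w\<close>, which tends to \<open>- J (X w)\<close>, and a
      Lebesgue integral.\<close>
    have "(\<Sum>j<k n. \<zeta> n j w \<bullet> (B w (t n (Suc j)) - B w (t n j)))
       = - (\<Sum>j<k n. \<xi> n j (X w) \<bullet> (X w (t n (Suc j)) - X w (t n j))) - (\<integral>s. ?U n s (X w) \<bullet> ?v s \<partial>lb01)" for n
    proof -
      have Bv: "B w r = X w r + (LBINT s:{0..r}. ?v s)" if "0 \<le> r" "r \<le> 1" for r using elim(4) that by auto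
      have "(\<Sum>j<k n. \<zeta> n j w \<bullet> (B w (t n (Suc j)) - B w (t n j)))
        = (\<Sum>j<k n. - (\<xi> n j (X w) \<bullet> (X w (t n (Suc j)) - X w (t n j)))
             - \<xi> n j (X w) \<bullet> ((LBINT s:{0..t n (Suc j)}. ?v s) - (LBINT s:{0..t n j}. ?v s)))"
      proof (intro sum.cong refl)
        fix j assume "j \<in> {..<k n}"
        then show "\<zeta> n j w \<bullet> (B w (t n (Suc j)) - B w (t n j)) = - (\<xi> n j (X w) \<bullet> (X w (t n (Suc j)) - X w (t n j)))
             - \<xi> n j (X w) \<bullet> ((LBINT s:{0..t n (Suc j)}. ?v s) - (LBINT s:{0..t n j}. ?v s))"
          using t_range01[of j n] t_range01[of "Suc j" n] by (simp add: Bv \<zeta>_def inner_diff_right inner_add_right)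
      qed
      also have "\<dots> = - (\<Sum>j<k n. \<xi> n j (X w) \<bullet> (X w (t n (Suc j)) - X w (t n j)))
           - (\<Sum>j<k n. \<xi> n j (X w) \<bullet> ((LBINT s:{0..t n (Suc j)}. ?v s) - (LBINT s:{0..t n j}. ?v s)))"
        by (simp only: sum_subtractf sum_negf)
      also have "(\<Sum>j<k n. \<xi> n j (X w) \<bullet> ((LBINT s:{0..t n (Suc j)}. ?v s) - (LBINT s:{0..t n j}. ?v s))) = (\<integral>s. ?U n s (X w) \<bullet> ?v s \<partial>lb01)"
        by (rule sum_simple_proc_integral[OF v]) (use t_range01[of _ n] t_mono[of _ n] in auto)
      finally show ?thesis .
    qed
    then have N: "S.N n 1 w = exp ((\<Sum>j<k n. \<xi> n j (X w) \<bullet> (X w (t n (Suc j)) - X w (t n j))) + (\<integral>s. ?U n s (X w) \<bullet> ?v s \<partial>lb01)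
        - 1/2 * (\<integral>s. (norm (?U n s (X w)))\<^sup>2 \<partial>lb01))" for n
      unfolding simple_exp_1 by (simp add: U\<zeta>)
    \<comment> \<open>The mixed integral tends to the full energy of the drift, of which half is
      taken away again. The exponent \<open>J + 1/2 * energy\<close> that is left is minus the
      logarithm of \<open>L\<close>, hence the reciprocal.\<close>
    have "(\<lambda>n. S.N n 1 w) \<longlonglongrightarrow> exp (J (X w) + (\<integral>s. ?v s \<bullet> ?v s \<partial>lb01) - 1/2 * (\<integral>s. (norm (?v s))\<^sup>2 \<partial>lb01))"
      unfolding N by (intro tendsto_intros elim(2) L2_tendsto(1)[OF L2_simple v v elim(1)] L2_tendsto(2)[OF L2_simple v v elim(1)])
    also have "exp (J (X w) + (\<integral>s. ?v s \<bullet> ?v s \<partial>lb01) - 1/2 * (\<integral>s. (norm (?v s))\<^sup>2 \<partial>lb01)) = inverse (L (X w))"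
      unfolding elim(3) by (simp add: exp_minus[symmetric] power2_norm_eq_inner)
    finally show ?case .
  qed
  let ?\<nu>X = "distr M \<mu> X"
  interpret \<nu>X: prob_space ?\<nu>X by (rule M.prob_space_distr[OF Xm])
  have Lm: "L \<in> borel_measurable \<mu>" by (rule L_measurable)
  note [measurable] = Xm Lm
  \<comment> \<open>Continuity for pointwise convergence of paths is needed because
    \<open>Y n w\<close> tends to \<open>X w\<close> only at each time.\<close>
  have fatou: "(\<integral>\<^sup>+w. ennreal (F w) * ennreal (inverse (L w)) \<partial>?\<nu>X) \<le> (\<integral>\<^sup>+w. ennreal (F w) \<partial>\<mu>)"
    if F: "continuous_on UNIV F" "\<And>w. 0 \<le> F w \<and> F w \<le> 1" and Fm [measurable]: "F \<in> borel_measurable \<mu>" for F :: "'n wpath \<Rightarrow> real"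
  proof -
    have "(\<integral>\<^sup>+w. ennreal (F w) * ennreal (inverse (L w)) \<partial>?\<nu>X) = (\<integral>\<^sup>+w. ennreal (F (X w)) * ennreal (inverse (L (X w))) \<partial>M)"
      by (subst nn_integral_distr) auto
    also have "\<dots> \<le> liminf (\<lambda>n. \<integral>\<^sup>+w. ennreal (F (Y n w)) * ennreal (S.N n 1 w) \<partial>M)"
    proof (rule nn_integral_le_liminf)
      show "AE w in M. (\<lambda>n. ennreal (F (Y n w)) * ennreal (S.N n 1 w)) \<longlonglongrightarrow> ennreal (F (X w)) * ennreal (inverse (L (X w)))"
        using Ylim Nlim
      proof eventually_elim
        case (elim w)
        have "(\<lambda>n. F (Y n w)) \<longlonglongrightarrow> F (X w)"
          by (rule continuous_on_tendsto_compose[OF F(1) elim(1)]) auto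
        then have "(\<lambda>n. ennreal (F (Y n w) * S.N n 1 w)) \<longlonglongrightarrow> ennreal (F (X w) * inverse (L (X w)))"
          using elim(2) by (intro tendsto_ennrealI tendsto_mult)
        then show ?case using F(2) by (simp only: ennreal_mult')
      qed
    qed measurable
    also have "\<dots> = (\<integral>\<^sup>+w. ennreal (F w) \<partial>\<mu>)"
      using law_Y[of "\<lambda>w. ennreal (F w)"] by (simp add: Liminf_const)
    finally show ?thesis .
  qed
  let ?R = "density ?\<nu>X (\<lambda>w. ennreal (inverse (L w)))"
  \<comment> \<open>A second use of Fatou passes from continuous functionals to sets. The
    approximations converge \<mu>-almost everywhere, hence also under the law of \<open>X\<close>,
    which is absolutely continuous.\<close>
  have R: "emeasure ?R A \<le> emeasure \<mu> A" for A
  proof (cases "A \<in> sets \<mu>")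
    case A [measurable]: True
    obtain F :: "nat \<Rightarrow> 'n wpath \<Rightarrow> real" where F: "\<And>n. continuous_on UNIV (F n)" "\<And>n w. 0 \<le> F n w \<and> F n w \<le> 1"
      and Fm [measurable]: "\<And>n. F n \<in> borel_measurable \<mu>" and Flim: "AE w in \<mu>. (\<lambda>n. F n w) \<longlonglongrightarrow> indicator A w"
      using continuous_AE_approx[OF \<mu>.finite_measure_axioms sets_\<mu> A] by blast
    have i: "integrable \<mu> (F n)" for n
      by (rule \<mu>.integrable_const_bound[of _ 1]) (use F in auto)
    have "emeasure ?R A = (\<integral>\<^sup>+w. ennreal (inverse (L w)) * indicator A w \<partial>?\<nu>X)"
      by (rule emeasure_density) auto
    also have "\<dots> \<le> liminf (\<lambda>n. \<integral>\<^sup>+w. ennreal (F n w) * ennreal (inverse (L w)) \<partial>?\<nu>X)"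
    proof (rule nn_integral_le_liminf)
      have "AE w in M. (\<lambda>n. F n (X w)) \<longlonglongrightarrow> indicator A (X w) \<and> 0 < L (X w)"
        using abs_cont_map_AE[OF ac Flim] abs_cont_map_AE[OF ac L_eq] by eventually_elim simp
      then have "AE w in ?\<nu>X. (\<lambda>n. F n w) \<longlonglongrightarrow> indicator A w \<and> 0 < L w"
      proof (subst AE_distr_iff[OF Xm])
        show "{w \<in> space \<mu>. (\<lambda>n. F n w) \<longlonglongrightarrow> indicat_real A w \<and> 0 < L w} \<in> sets \<mu>"
          by measurable
      qed
      then show "AE w in ?\<nu>X. (\<lambda>n. ennreal (F n w) * ennreal (inverse (L w))) \<longlonglongrightarrow> ennreal (inverse (L w)) * indicator A w"
      proof eventually_elim
        case (elim w)
        then have "(\<lambda>n. ennreal (F n w * inverse (L w))) \<longlonglongrightarrow> ennreal (indicator A w * inverse (L w))"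
          by (intro tendsto_ennrealI tendsto_mult tendsto_const) auto
        then show ?case using F(2) by (cases "w \<in> A") (simp_all add: ennreal_mult')
      qed
    qed measurable
    also have "\<dots> \<le> liminf (\<lambda>n. \<integral>\<^sup>+w. ennreal (F n w) \<partial>\<mu>)"
      by (intro Liminf_mono always_eventually allI fatou F Fm)
    also have "\<dots> = ennreal (\<integral>w. indicator A w \<partial>\<mu>)"
    proof (intro lim_imp_Liminf)
      have "(\<lambda>n. \<integral>w. F n w \<partial>\<mu>) \<longlonglongrightarrow> (\<integral>w. indicator A w \<partial>\<mu>)"
        by (rule integral_dominated_convergence[where w="\<lambda>_. 1"]) (use F Flim in auto)
      then show "(\<lambda>n. \<integral>\<^sup>+w. ennreal (F n w) \<partial>\<mu>) \<longlonglongrightarrow> ennreal (\<integral>w. indicator A w \<partial>\<mu>)"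
        using F(2) by (subst nn_integral_eq_integral[OF i]) (auto intro!: tendsto_ennrealI)
    qed simp
    also have "\<dots> = emeasure \<mu> A" by (simp add: \<mu>.emeasure_eq_measure)
    finally show ?thesis .
  next
    case False
    then show ?thesis by (simp add: emeasure_notin_sets)
  qed
  have Rle: "?R \<le> \<mu>" using R by (auto simp: le_measure_iff le_fun_def)
  let ?\<nu> = "density \<mu> (\<lambda>w. ennreal (L w))"
  have Lpos: "AE w in ?\<nu>X. 0 < L w"
    using abs_cont_map_AE[OF ac L_eq] by (subst AE_distr_iff[OF Xm]) (auto elim!: eventually_mono)
  \<comment> \<open>Integrating \<open>L\<close> against the comparison of measures removes the
    factor \<open>1 / L\<close>.\<close>
  have le: "emeasure ?\<nu>X A \<le> emeasure ?\<nu> A" if A [measurable]: "A \<in> sets \<mu>" for A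
  proof -
    have "emeasure ?\<nu>X A = (\<integral>\<^sup>+w. indicator A w \<partial>?\<nu>X)" by simp
    also have "\<dots> = (\<integral>\<^sup>+w. ennreal (inverse (L w)) * (ennreal (L w) * indicator A w) \<partial>?\<nu>X)"
      using Lpos by (intro nn_integral_cong_AE)
        (auto elim!: eventually_mono simp: mult.assoc[symmetric] ennreal_mult'[symmetric])
    also have "\<dots> = (\<integral>\<^sup>+w. ennreal (L w) * indicator A w \<partial>?R)"
      by (subst nn_integral_density) auto
    also have "\<dots> \<le> (\<integral>\<^sup>+w. ennreal (L w) * indicator A w \<partial>\<mu>)"
      by (rule nn_integral_mono_measure[OF _ Rle]) simp
    also have "\<dots> = emeasure ?\<nu> A" by (subst emeasure_density) auto
    finally show ?thesis .
  qed
  have \<nu>1: "emeasure ?\<nu> (space \<mu>) = 1"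
  proof -
    have "emeasure ?\<nu> (space \<mu>) = (\<integral>\<^sup>+w. ennreal (L w) \<partial>\<mu>)"
      by (subst emeasure_density) (auto intro!: nn_integral_cong)
    also have "\<dots> = ennreal (\<integral>w. L w \<partial>\<mu>)"
    proof (rule nn_integral_eq_integral)
      show "integrable \<mu> L" using L_integral not_integrable_integral_eq by fastforce
      show "AE w in \<mu>. 0 \<le> L w" using L_eq by eventually_elim simp
    qed
    finally show ?thesis by (simp add: L_integral)
  qed
  interpret \<nu>: prob_space ?\<nu> by (rule prob_spaceI) (simp add: \<nu>1)
  show ?thesis
  proof (rule measure_eqI)
    fix A assume "A \<in> sets ?\<nu>X"
    then have A: "A \<in> sets \<mu>" by simp
    have "measure ?\<nu>X A \<le> measure ?\<nu> A"
      using le[OF A] by (simp add: \<nu>X.emeasure_eq_measure \<nu>.emeasure_eq_measure)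
    \<comment> \<open>For probability measures the same bound on the complement is the reverse
      inequality on \<open>A\<close>.\<close>
    moreover have "measure ?\<nu>X (space \<mu> - A) \<le> measure ?\<nu> (space \<mu> - A)"
      using le[of "space \<mu> - A"] A by (simp add: \<nu>X.emeasure_eq_measure \<nu>.emeasure_eq_measure)
    then have "1 - measure ?\<nu>X A \<le> 1 - measure ?\<nu> A"
      using \<nu>X.prob_compl[of A] \<nu>.prob_compl[of A] A by simp
    ultimately show "emeasure ?\<nu>X A = emeasure ?\<nu> A"
      by (simp add: \<nu>X.emeasure_eq_measure \<nu>.emeasure_eq_measure)
  qed simp
qed

end

section \<open>Adaptedness of the inverse\<close>

lemma sets_completion_AE_eq:
  assumes "C \<in> sets (completion \<mu>)"
  obtains A where "A \<in> sets \<mu>" "AE w in \<mu>. w \<in> C \<longleftrightarrow> w \<in> A"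
proof -
  obtain S N N' where C: "C = S \<union> N" "N \<subseteq> N'" "N' \<in> null_sets \<mu>" "S \<in> sets \<mu>"
    using assms by (rule sets_completionE)
  have "AE w in \<mu>. w \<in> C \<longleftrightarrow> w \<in> S"
    by (rule AE_I'[OF C(3)]) (use C in auto)
  then show ?thesis using C(4) by (intro that)
qed

lemma abs_cont_map_measurable_completion:
  assumes X: "abs_cont_map \<mu> X"
  shows "X \<in> completion \<mu> \<rightarrow>\<^sub>M completion \<mu>"
proof (rule measurableI)
  have Xm: "X \<in> completion \<mu> \<rightarrow>\<^sub>M \<mu>" using X by (simp add: abs_cont_map_def)
  show "X w \<in> space (completion \<mu>)" if "w \<in> space (completion \<mu>)" for w
    using measurable_space[OF Xm] that by simp
  fix C assume "C \<in> sets (completion \<mu>)"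
  then obtain S N N' where C: "C = S \<union> N" "N \<subseteq> N'" "N' \<in> null_sets \<mu>" "S \<in> sets \<mu>"
    by (rule sets_completionE)
  have "X -` N \<inter> space \<mu> \<in> null_sets (completion \<mu>)"
    by (rule null_sets_completion_subset[OF _ abs_cont_map_null[OF X C(3)]]) (use C in auto)
  moreover have "X -` S \<inter> space \<mu> \<in> sets (completion \<mu>)" using measurable_sets[OF Xm C(4)] by simp
  moreover have "X -` C \<inter> space (completion \<mu>) = (X -` S \<inter> space \<mu>) \<union> (X -` N \<inter> space \<mu>)" using C by auto
  ultimately show "X -` C \<inter> space (completion \<mu>) \<in> sets (completion \<mu>)" by auto
qed

lemma abs_cont_mapI:
  assumes X: "X \<in> completion \<mu> \<rightarrow>\<^sub>M \<mu>" and null: "\<And>N. N \<in> null_sets \<mu> \<Longrightarrow> emeasure (completion \<mu>) (X -` N \<inter> space \<mu>) = 0"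
  shows "abs_cont_map \<mu> X"
proof -
  have "N \<in> null_sets (distr (completion \<mu>) \<mu> X)" if N: "N \<in> null_sets \<mu>" for N
    using null[OF N] emeasure_distr[OF X, of N] N by (auto simp: null_sets_def simp del: emeasure_completion)
  then show ?thesis using X by (auto simp: abs_cont_map_def absolutely_continuous_def)
qed

lemma abs_cont_map_comp:
  assumes X: "abs_cont_map \<mu> X" and Y: "abs_cont_map \<mu> Y"
  shows "abs_cont_map \<mu> (\<lambda>w. Y (X w))"
proof (rule abs_cont_mapI)
  have Xm: "X \<in> completion \<mu> \<rightarrow>\<^sub>M \<mu>" and Ym: "Y \<in> completion \<mu> \<rightarrow>\<^sub>M \<mu>" using X Y by (simp_all add: abs_cont_map_def)
  show "(\<lambda>w. Y (X w)) \<in> completion \<mu> \<rightarrow>\<^sub>M \<mu>"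
    by (rule measurable_compose[OF abs_cont_map_measurable_completion[OF X] Ym])
  fix N assume "N \<in> null_sets \<mu>"
  from abs_cont_map_null[OF Y this] obtain N' where N': "N' \<in> null_sets \<mu>" "Y -` N \<inter> space \<mu> \<subseteq> N'"
    by (auto simp: null_sets_completion_iff2)
  have "(\<lambda>w. Y (X w)) -` N \<inter> space \<mu> \<subseteq> X -` N' \<inter> space \<mu>"
    using N'(2) measurable_space[OF Xm] by auto
  then have "(\<lambda>w. Y (X w)) -` N \<inter> space \<mu> \<in> null_sets (completion \<mu>)"
    by (rule null_sets_completion_subset[OF _ abs_cont_map_null[OF X N'(1)]])
  then show "emeasure (completion \<mu>) ((\<lambda>w. Y (X w)) -` N \<inter> space \<mu>) = 0" by (rule null_setsD1)
qed

text \<open>A set of the completion agrees with a set of \<mu> up to a null set, and the preimage of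
  that null set is null for \<open>N\<close>. So the image law on the smaller \<sigma>-algebra
  decides. It is used with \<open>N\<close> equal to the completion and to \<nu>.\<close>

lemma distr_lift_completion:
  assumes X: "abs_cont_map \<mu> X" and N: "sets N = sets (completion \<mu>)" "absolutely_continuous (completion \<mu>) N"
    and f: "f \<in> borel_measurable \<mu>" and law: "distr N \<mu> X = density \<mu> f"
  shows "distr N (completion \<mu>) X = density (completion \<mu>) f"
proof (rule measure_eqI)
  let ?M = "completion \<mu>"
  have sp: "space N = space \<mu>" using sets_eq_imp_space_eq[OF N(1)] by simp
  have XM: "X \<in> N \<rightarrow>\<^sub>M ?M"
    using abs_cont_map_measurable_completion[OF X] measurable_cong_sets[OF N(1) refl] by blast
  have Xm: "X \<in> N \<rightarrow>\<^sub>M \<mu>"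
    using X measurable_cong_sets[OF N(1) refl] by (auto simp: abs_cont_map_def)
  fix C assume "C \<in> sets (distr N ?M X)"
  then have C: "C \<in> sets ?M" by simp
  then obtain A where A: "A \<in> sets \<mu>" "AE w in \<mu>. w \<in> C \<longleftrightarrow> w \<in> A" by (rule sets_completion_AE_eq)
  have "AE w in N. X w \<in> C \<longleftrightarrow> X w \<in> A"
    using absolutely_continuous_AE[OF N(1) N(2) abs_cont_map_AE[OF X A(2)]] .
  then have "emeasure N (X -` C \<inter> space N) = emeasure N (X -` A \<inter> space N)"
    using measurable_sets[OF XM C] measurable_sets[OF Xm A(1)]
    by (intro emeasure_eq_AE) (auto elim!: eventually_mono)
  then have "emeasure (distr N ?M X) C = emeasure (distr N \<mu> X) A"
    using emeasure_distr[OF XM C] emeasure_distr[OF Xm A(1)] by simp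
  also have "\<dots> = (\<integral>\<^sup>+w. f w * indicator A w \<partial>\<mu>)"
    unfolding law by (rule emeasure_density[OF f A(1)])
  also have "\<dots> = (\<integral>\<^sup>+w. f w * indicator A w \<partial>?M)"
    using f A(1) by (intro nn_integral_completion[symmetric])
  also have "\<dots> = (\<integral>\<^sup>+w. f w * indicator C w \<partial>?M)"
    using AE_completion[OF A(2)] by (intro nn_integral_cong_AE) (auto elim!: eventually_mono simp: indicator_def)
  also have "\<dots> = emeasure (density ?M f) C"
    by (rule emeasure_density[OF measurable_completion[OF f] C, symmetric])
  finally show "emeasure (distr N ?M X) C = emeasure (density ?M f) C" .
qed simp

lemma abs_cont_map_density:
  assumes X: "X \<in> completion \<mu> \<rightarrow>\<^sub>M \<mu>" and f: "f \<in> borel_measurable \<mu>" and law: "distr (completion \<mu>) \<mu> X = density \<mu> f"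
  shows "abs_cont_map \<mu> X"
  using X absolutely_continuousI_density[OF f] by (simp add: abs_cont_map_def law)

lemma distr_completion_density:
  fixes \<mu> :: "('n::finite) wpath measure"
  assumes X: "X \<in> completion \<mu> \<rightarrow>\<^sub>M \<mu>" and f: "f \<in> borel_measurable \<mu>" and law: "distr (completion \<mu>) \<mu> X = density \<mu> f"
  shows "distr (completion \<mu>) (completion \<mu>) X = density (completion \<mu>) f"
  by (rule distr_lift_completion[OF abs_cont_map_density[OF X f law] refl _ f law])
     (simp add: absolutely_continuous_def)

section \<open>Inverses of \<open>V\<close>\<close>

context ito_drift
begin

lemma ac_\<nu>: "absolutely_continuous M \<nu>"
  by (rule absolutely_continuousI_density) simp

lemma AE_\<nu>: "(AE w in \<nu>. P w) \<longleftrightarrow> (AE w in M. P w)"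
proof -
  have "(AE w in \<nu>. P w) \<longleftrightarrow> (AE w in M. 0 < ennreal (L w) \<longrightarrow> P w)"
    by (rule AE_density) simp
  also have "\<dots> \<longleftrightarrow> (AE w in M. P w)"
  proof
    show "AE w in M. P w" if "AE w in M. 0 < ennreal (L w) \<longrightarrow> P w"
      using that L_pos by eventually_elim simp
    show "AE w in M. 0 < ennreal (L w) \<longrightarrow> P w" if "AE w in M. P w"
      using that by eventually_elim simp
  qed
  finally show ?thesis .
qed

text \<open>\<open>V\<close> maps \<nu> to \<mu>, and \<nu> has the same null sets as the completed
  \<mu> because \<open>L\<close> is positive almost everywhere.\<close>

lemma abs_cont_V: "abs_cont_map \<mu> V"
proof (rule abs_cont_mapI[OF V_measurable])
  fix N assume N: "N \<in> null_sets \<mu>"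
  have V\<nu>: "V \<in> \<nu> \<rightarrow>\<^sub>M \<mu>" using V_measurable by simp
  have m: "V -` N \<inter> space \<mu> \<in> sets M" using measurable_sets[OF V_measurable, of N] N by auto
  have "emeasure \<nu> (V -` N \<inter> space \<mu>) = emeasure (distr \<nu> \<mu> V) N"
    using emeasure_distr[OF V\<nu>, of N] N by auto
  also have "\<dots> = 0" unfolding distr_V using N by auto
  finally have "AE w in \<nu>. w \<notin> V -` N \<inter> space \<mu>"
    using m by (intro AE_not_in) (simp add: null_sets_def)
  then have "AE w in M. w \<notin> V -` N \<inter> space \<mu>" by (simp only: AE_\<nu>)
  then show "emeasure M (V -` N \<inter> space \<mu>) = 0"
    using m AE_iff_null_sets[OF m] by (simp only: null_setsD1)
qed

lemma distr_V_M: "distr \<nu> M V = M"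
proof -
  have "distr \<nu> M V = density M (\<lambda>_. 1)"
    by (rule distr_lift_completion[OF abs_cont_V]) (simp_all add: ac_\<nu> distr_V density_1)
  then show ?thesis by (simp add: density_1)
qed

text \<open>If \<open>S\<close> is inverse to \<open>V\<close>, the increments of \<open>W = V \<circ> S\<close> after time \<open>r\<close> are independent of \<open>S\<close>
  up to time \<open>r\<close>, which is a functional of the whole path of \<open>W\<close>; hence it is already one of \<open>W\<close> up to \<open>r\<close>.\<close>

proposition inverse_adapted:
  assumes S: "abs_cont_map \<mu> S" and SV: "AE w in \<mu>. S (V w) = w"
    and r: "0 \<le> r" "r \<le> 1"
  shows "(\<lambda>w. S w r) \<in> borel_measurable (G r)"
proof (rule measurableI)
  fix D :: "(real ^ 'n) set" assume D: "D \<in> sets borel"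
  interpret M: prob_space M by (rule prob_M)
  define A where "A = {w\<in>space \<mu>. w r \<in> D}"
  have Sm: "S \<in> M \<rightarrow>\<^sub>M \<mu>" using S by (simp add: abs_cont_map_def)
  have AG: "A \<in> sets (G r)"
    using measurable_sets[OF aug_eval[of r r "\<lambda>w. w" \<mu>] D] r by (simp add: A_def vimage_def Int_def conj_commute)
  have A\<mu>: "A \<in> sets \<mu>"
    using measurable_sets[OF measurable_wpath_eval[OF sets_\<mu>, of r] D] by (simp add: A_def vimage_def Int_def conj_commute)
  define SA where "SA = S -` A \<inter> space \<mu>"
  have SA [measurable]: "SA \<in> sets M" using measurable_sets[OF Sm A\<mu>] by (simp add: SA_def)
  have A_M [measurable]: "A \<in> sets M" using A\<mu> by simp
  interpret F: finite_measure_subalgebra M "G r"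
    using sub_G[OF r] by unfold_locales
  \<comment> \<open>\<open>SA\<close> is an event of the inverse at time \<open>r\<close>, expressed
    on the driving path. The aim is that \<open>SA\<close> coincides almost everywhere with its
    conditional probability \<open>Z\<close> given the driving path up to \<open>r\<close>.\<close>
  define Z where "Z = nn_cond_exp M (G r) (indicator SA)"
  have ZG: "Z \<in> borel_measurable (G r)" unfolding Z_def by (rule borel_measurable_nn_cond_exp)
  have ZM [measurable]: "Z \<in> borel_measurable M" by (rule measurable_from_subalg[OF sub_G[OF r] ZG])
  \<comment> \<open>The image of \<nu> under \<open>V\<close> is the completed \<mu>, and
    \<open>V w\<close> lies in \<open>SA\<close> exactly when \<open>w\<close> lies in
    \<open>A\<close>, since \<open>S\<close> undoes \<open>V\<close>.\<close>
  have transfer: "(\<integral>\<^sup>+w. indicator A w * (\<Prod>s\<in>T. g s (V w s)) \<partial>\<nu>) = (\<integral>\<^sup>+w. indicator SA w * (\<Prod>s\<in>T. g s (w s)) \<partial>M)"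
    if g: "\<And>s. g s \<in> borel_measurable borel" for T and g :: "real \<Rightarrow> real ^ 'n \<Rightarrow> ennreal"
  proof -
    have V\<nu>: "V \<in> \<nu> \<rightarrow>\<^sub>M M" using abs_cont_map_measurable_completion[OF abs_cont_V] by simp
    have [measurable]: "(\<lambda>w. g s (w s)) \<in> borel_measurable M" for s
      by (rule measurable_compose[OF eval_measurable g])
    have "(\<lambda>w. \<Prod>s\<in>T. g s (w s)) \<in> borel_measurable M"
      by measurable
    then have "(\<integral>\<^sup>+w. indicator SA w * (\<Prod>s\<in>T. g s (w s)) \<partial>distr \<nu> M V)
      = (\<integral>\<^sup>+w. indicator SA (V w) * (\<Prod>s\<in>T. g s (V w s)) \<partial>\<nu>)"
      by (intro nn_integral_distr[OF V\<nu>]) simp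
    also have "\<dots> = (\<integral>\<^sup>+w. indicator A w * (\<Prod>s\<in>T. g s (V w s)) \<partial>\<nu>)"
    proof (rule nn_integral_cong_AE)
      have "AE w in \<nu>. S (V w) = w" using AE_completion[OF SV] by (simp only: AE_\<nu>)
      then show "AE w in \<nu>. indicator SA (V w) * (\<Prod>s\<in>T. g s (V w s)) = indicator A w * (\<Prod>s\<in>T. g s (V w s))"
        using AE_space
      proof eventually_elim
        case (elim w)
        then have "V w \<in> SA \<longleftrightarrow> w \<in> A" using measurable_space[OF V_measurable, of w] by (auto simp: SA_def)
        then show ?case by (simp add: indicator_def)
      qed
    qed
    finally show ?thesis by (simp only: distr_V_M)
  qed
  \<comment> \<open>Up to time \<open>r\<close> this is the defining property of the conditional
    probability. Beyond \<open>r\<close> both \<open>V\<close> under \<nu> and the coordinate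
    process continue with independent Gaussian increments, where \<open>A\<close> is known at time
    \<open>r\<close> on the left and \<open>Z\<close> on the right.\<close>
  have cyl: "(\<integral>\<^sup>+w. indicator A w * (\<Prod>s\<in>T. g s (V w s)) \<partial>\<nu>) = (\<integral>\<^sup>+w. Z w * (\<Prod>s\<in>T. g s (w s)) \<partial>M)"
    if T: "finite T" "T \<subseteq> {0..1}" and g: "\<And>s. g s \<in> borel_measurable borel" for T and g :: "real \<Rightarrow> real ^ 'n \<Rightarrow> ennreal"
  proof (rule bm_from_cylinder_eq[OF bm_from_mono[OF bm_V r(1) order.refl] bm_from_mono[OF bm_W r(1) order.refl] r(2) _ _ ZG _ T g])
    show "indicator A \<in> borel_measurable (G r)" using AG by simp
    fix T :: "real set" and g :: "real \<Rightarrow> real ^ 'n \<Rightarrow> ennreal"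
    assume T: "finite T" "T \<subseteq> {0..r}" and g: "\<And>s. g s \<in> borel_measurable borel"
    have pG: "(\<lambda>w. \<Prod>s\<in>T. g s (w s)) \<in> borel_measurable (G r)"
    proof -
      have [measurable]: "(\<lambda>w. g s (w s)) \<in> borel_measurable (G r)" if "s \<in> T" for s
        by (rule measurable_compose[OF aug_eval g]) (use that T(2) in auto)
      show ?thesis by measurable
    qed
    have "(\<integral>\<^sup>+w. indicator A w * (\<Prod>s\<in>T. g s (V w s)) \<partial>\<nu>) = (\<integral>\<^sup>+w. (\<Prod>s\<in>T. g s (w s)) * indicator SA w \<partial>M)"
      unfolding transfer[OF g] by (simp only: mult.commute)
    also have "\<dots> = (\<integral>\<^sup>+w. (\<Prod>s\<in>T. g s (w s)) * Z w \<partial>M)"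
      unfolding Z_def by (rule F.nn_cond_exp_intg[symmetric, OF pG]) simp
    finally show "(\<integral>\<^sup>+w. indicator A w * (\<Prod>s\<in>T. g s (V w s)) \<partial>\<nu>) = (\<integral>\<^sup>+w. Z w * (\<Prod>s\<in>T. g s (w s)) \<partial>M)"
      by (simp only: mult.commute)
  qed simp
  have "distr (density M (indicator SA)) \<mu> (\<lambda>w. w) = distr (density M Z) \<mu> (\<lambda>w. w)"
  proof (rule distr_wpath_eqI[OF sets_\<mu> id_measurable id_measurable])
    fix T :: "real set" and C :: "real \<Rightarrow> (real ^ 'n) set"
    assume T: "finite T" "T \<subseteq> {0..1}" and C: "\<And>r. C r \<in> sets borel"
    have i: "indicator (C s) \<in> borel_measurable borel" for s using C by simp
    show "(\<integral>\<^sup>+w. indicator SA w * (\<Prod>s\<in>T. indicator (C s) (w s)) \<partial>M) = (\<integral>\<^sup>+w. Z w * (\<Prod>s\<in>T. indicator (C s) (w s)) \<partial>M)"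
      by (rule trans[OF transfer[symmetric] cyl[OF T]]) (rule i)+
  qed (auto simp del: emeasure_completion)
  note eq = this
  \<comment> \<open>The comparison on \<mu>-measurable sets is lifted to the completion, where
    \<open>SA\<close> and \<open>Z\<close> are measurable and densities are unique.\<close>
  have "density M (indicator SA) = density M Z"
  proof (rule measure_eqI)
    fix C assume "C \<in> sets (density M (indicator SA))"
    then have C: "C \<in> sets M" by simp
    then obtain C' where C': "C' \<in> sets \<mu>" "AE w in \<mu>. w \<in> C \<longleftrightarrow> w \<in> C'" by (rule sets_completion_AE_eq)
    have "emeasure (density M f) C = emeasure (distr (density M f) \<mu> (\<lambda>w. w)) C'" if [measurable]: "f \<in> borel_measurable M" for f
    proof -
      have "emeasure (density M f) C = (\<integral>\<^sup>+w. f w * indicator C w \<partial>M)" by (rule emeasure_density[OF that C])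
      also have "\<dots> = (\<integral>\<^sup>+w. f w * indicator C' w \<partial>M)"
        using AE_completion[OF C'(2)] by (intro nn_integral_cong_AE) (auto elim!: eventually_mono simp: indicator_def)
      also have "\<dots> = emeasure (density M f) C'" by (rule emeasure_density[OF that, symmetric]) (use C' in simp)
      also have "\<dots> = emeasure (distr (density M f) \<mu> (\<lambda>w. w)) C'"
        using C'(1) id_measurable sets.sets_into_space[OF C'(1)]
        by (subst emeasure_distr) (auto intro!: arg_cong[where f="emeasure (density M f)"])
      finally show ?thesis .
    qed
    from this[of "indicator SA"] this[of Z] eq show "emeasure (density M (indicator SA)) C = emeasure (density M Z) C"
      by simp
  qed simp
  then have "AE w in M. indicator SA w = Z w"
    by (intro M.density_unique) auto
  then have "AE w in \<mu>. Z w = (indicator SA w :: ennreal)" by (simp only: AE_completion_iff eq_commute)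
  from measurable_aug_AE[OF ZG refl this] have "(indicator SA :: 'n wpath \<Rightarrow> ennreal) \<in> borel_measurable (G r)" .
  then have "SA \<inter> space (G r) \<in> sets (G r)" by (simp only: borel_measurable_indicator_iff)
  moreover have "SA \<inter> space (G r) = (\<lambda>w. S w r) -` D \<inter> space (G r)"
    using measurable_space[OF Sm] by (auto simp: SA_def A_def)
  ultimately show "(\<lambda>w. S w r) -` D \<inter> space (G r) \<in> sets (G r)" by simp
qed simp

theorem ae_invertible_imp_strong_solution:
  assumes "ae_invertible \<mu> V"
  shows "\<exists>U. strong_solution \<mu> vdot (\<lambda>w. w) U"
proof -
  obtain S where S: "abs_cont_map \<mu> S" "AE w in \<mu>. S (V w) = w" "AE w in \<mu>. V (S w) = w"
    using assms by (auto simp: ae_invertible_def)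
  have "AE w in \<mu>. \<forall>r\<in>{0..1}. S w r = w r - (LBINT s:{0..r}. vdot s (S w))"
    using S(3)
  proof eventually_elim
    case (elim w)
    show ?case
    proof
      fix r :: real assume "r \<in> {0..1}"
      then show "S w r = w r - (LBINT s:{0..r}. vdot s (S w))"
        using V_eval[of r "S w"] elim by simp
    qed
  qed
  then have "strong_solution \<mu> vdot (\<lambda>w. w) S"
    using S(1) inverse_adapted[OF S(1,2)] by (auto simp: strong_solution_def)
  then show ?thesis by blast
qed

theorem strong_solution_comp:
  assumes B: "B \<in> M \<rightarrow>\<^sub>M \<mu>" and law_B: "distr M \<mu> B = \<mu>" and U: "strong_solution \<mu> vdot (\<lambda>w. w) U"
  shows "strong_solution \<mu> vdot B (\<lambda>w. U (B w))"
proof -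
  have acB: "abs_cont_map \<mu> B" by (rule abs_cont_map_density[OF B, of "\<lambda>_. 1"]) (simp_all add: law_B density_1)
  have acU: "abs_cont_map \<mu> U" and adU: "\<And>r. 0 \<le> r \<Longrightarrow> r \<le> 1 \<Longrightarrow> (\<lambda>w. U w r) \<in> borel_measurable (G r)"
    and eqU: "AE w in \<mu>. \<forall>r\<in>{0..1}. U w r = w r - (LBINT s:{0..r}. vdot s (U w))"
    using U by (auto simp: strong_solution_def)
  have "(\<lambda>w. U (B w) r) \<in> borel_measurable (aug_filtration \<mu> B r)" if r: "0 \<le> r" "r \<le> 1" for r
    by (rule measurable_compose[OF measurable_comp_aug[OF acB] adU[OF r]]) (auto intro: aug_eval)
  moreover have "AE w in \<mu>. \<forall>r\<in>{0..1}. U (B w) r = B w r - (LBINT s:{0..r}. vdot s (U (B w)))"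
    using abs_cont_map_AE[OF acB eqU] by (simp only: AE_completion_iff)
  ultimately show ?thesis
    using abs_cont_map_comp[OF acB acU] by (auto simp: strong_solution_def)
qed

end

section \<open>Factorization through the driving process\<close>

text \<open>The Doob-Dynkin factorization modulo null sets. A null set added by the augmentation
  need not be a preimage under \<open>B\<close>, so equality can only hold almost
  everywhere.\<close>

lemma aug_sets_factor:
  fixes \<mu> :: "('n::finite) wpath measure"
  assumes sets_\<mu>: "sets \<mu> = sets wiener_algebra" and B: "B \<in> space \<mu> \<rightarrow> space \<mu>"
    and A: "A \<in> sets (aug_filtration \<mu> B r)"
  shows "\<exists>C\<in>sets (completion \<mu>). AE w in \<mu>. w \<in> A \<longleftrightarrow> B w \<in> C"
  using A unfolding sets_aug
proof (induction rule: sigma_sets.induct)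
  case (Basic A)
  then show ?case
  proof
    assume "A \<in> {(\<lambda>w. B w s) -` A \<inter> space \<mu> | s A. s \<in> {0..r} \<and> A \<in> sets borel}"
    then obtain s D where D: "D \<in> sets borel" "A = (\<lambda>w. B w s) -` D \<inter> space \<mu>" by auto
    have "(\<lambda>w. w s) -` D \<inter> space \<mu> \<in> sets \<mu>"
      by (rule measurable_sets[OF measurable_wpath_eval[OF sets_\<mu>] D(1)])
    moreover have "AE w in \<mu>. w \<in> A \<longleftrightarrow> B w \<in> (\<lambda>w. w s) -` D \<inter> space \<mu>"
      using B by (intro AE_I2) (auto simp: D(2))
    ultimately show ?thesis by (intro bexI[of _ "(\<lambda>w. w s) -` D \<inter> space \<mu>"] sets_completionI_sets)
  next
    assume "A \<in> null_sets (completion \<mu>)"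
    from AE_not_in[OF this] have "AE w in \<mu>. w \<in> A \<longleftrightarrow> B w \<in> {}" by (simp add: AE_completion_iff)
    then show ?thesis by (intro bexI[of _ "{}"]) auto
  qed
next
  case Empty
  then show ?case by (intro bexI[of _ "{}"]) auto
next
  case (Compl A)
  then obtain C where C: "C \<in> sets (completion \<mu>)" "AE w in \<mu>. w \<in> A \<longleftrightarrow> B w \<in> C" by blast
  have "AE w in \<mu>. w \<in> space \<mu> - A \<longleftrightarrow> B w \<in> space (completion \<mu>) - C"
    using C(2) AE_space by eventually_elim (use B in auto)
  then show ?case using sets.compl_sets[OF C(1)] by blast
next
  case (Union A)
  have "\<forall>i. \<exists>C. C \<in> sets (completion \<mu>) \<and> (AE w in \<mu>. w \<in> A i \<longleftrightarrow> B w \<in> C)"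
    using Union.IH by (simp only: Bex_def simp_thms)
  from choice[OF this] obtain C where "\<forall>i. C i \<in> sets (completion \<mu>) \<and> (AE w in \<mu>. w \<in> A i \<longleftrightarrow> B w \<in> C i)" ..
  then have C: "\<And>i. C i \<in> sets (completion \<mu>)" "\<And>i. AE w in \<mu>. w \<in> A i \<longleftrightarrow> B w \<in> C i" by simp_all
  have "AE w in \<mu>. \<forall>i. w \<in> A i \<longleftrightarrow> B w \<in> C i" using C(2) by (simp add: AE_all_countable)
  then have "AE w in \<mu>. w \<in> (\<Union>i. A i) \<longleftrightarrow> B w \<in> (\<Union>i. C i)" by eventually_elim auto
  moreover have "(\<Union>i. C i) \<in> sets (completion \<mu>)" using C(1) by auto
  ultimately show ?case by blast
qed

text \<open>Each simple approximation takes finitely many values, so its level sets factor outside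
  one null set; the functional on the driving path is the limit of the factored simple
  functions.\<close>

lemma aug_measurable_factor:
  fixes \<mu> :: "('n::finite) wpath measure" and f :: "'n wpath \<Rightarrow> 'b::euclidean_space"
  assumes sets_\<mu>: "sets \<mu> = sets wiener_algebra" and B: "B \<in> space \<mu> \<rightarrow> space \<mu>"
    and f: "f \<in> borel_measurable (aug_filtration \<mu> B r)"
  shows "\<exists>g\<in>borel_measurable (completion \<mu>). AE w in \<mu>. f w = g (B w)"
proof -
  let ?N = "aug_filtration \<mu> B r"
  obtain F where F: "\<And>i. simple_function ?N (F i)" "\<And>x. x \<in> space ?N \<Longrightarrow> (\<lambda>i. F i x) \<longlonglongrightarrow> f x"
    using borel_measurable_implies_sequence_metric[OF f, of 0] by blast
  have "\<exists>g\<in>borel_measurable (completion \<mu>). AE w in \<mu>. F i w = g (B w)" for i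
  proof -
    let ?I = "F i ` space \<mu>"
    have fin: "finite ?I" using simple_functionD(1)[OF F(1)[of i]] by simp
    have "\<forall>y. \<exists>C. C \<in> sets (completion \<mu>) \<and> (AE w in \<mu>. w \<in> F i -` {y} \<inter> space \<mu> \<longleftrightarrow> B w \<in> C)"
    proof
      fix y
      have "F i -` {y} \<inter> space \<mu> \<in> sets ?N" using simple_functionD(2)[OF F(1)[of i], of "{y}"] by simp
      from aug_sets_factor[OF sets_\<mu> B this]
      show "\<exists>C. C \<in> sets (completion \<mu>) \<and> (AE w in \<mu>. w \<in> F i -` {y} \<inter> space \<mu> \<longleftrightarrow> B w \<in> C)"
        by (simp only: Bex_def)
    qed
    from choice[OF this] obtain C where "\<forall>y. C y \<in> sets (completion \<mu>) \<and> (AE w in \<mu>. w \<in> F i -` {y} \<inter> space \<mu> \<longleftrightarrow> B w \<in> C y)" ..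
    then have C: "\<And>y. C y \<in> sets (completion \<mu>)" "\<And>y. AE w in \<mu>. w \<in> F i -` {y} \<inter> space \<mu> \<longleftrightarrow> B w \<in> C y"
      by simp_all
    define g where "g w = (\<Sum>y\<in>?I. indicat_real (C y) w *\<^sub>R y)" for w
    have "g \<in> borel_measurable (completion \<mu>)"
      unfolding g_def using C(1) by (intro borel_measurable_sum borel_measurable_scaleR) auto
    moreover have "AE w in \<mu>. \<forall>y\<in>?I. w \<in> F i -` {y} \<inter> space \<mu> \<longleftrightarrow> B w \<in> C y"
      using C(2) by (intro AE_finite_allI[OF fin])
    then have "AE w in \<mu>. F i w = g (B w)"
      using AE_space
    proof eventually_elim
      case (elim w)
      have "g (B w) = (\<Sum>y\<in>?I. if y = F i w then y else 0)"
        unfolding g_def using elim by (intro sum.cong refl) (auto simp: indicator_def)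
      also have "\<dots> = F i w" using elim(2) fin by (simp add: sum.delta')
      finally show ?case ..
    qed
    ultimately show ?thesis by blast
  qed
  then have "\<forall>i. \<exists>g. g \<in> borel_measurable (completion \<mu>) \<and> (AE w in \<mu>. F i w = g (B w))"
    by (simp only: Bex_def simp_thms)
  from choice[OF this] obtain g where "\<forall>i. g i \<in> borel_measurable (completion \<mu>) \<and> (AE w in \<mu>. F i w = g i (B w))" ..
  then have g: "\<And>i. g i \<in> borel_measurable (completion \<mu>)" "\<And>i. AE w in \<mu>. F i w = g i (B w)" by simp_all
  have "AE w in \<mu>. \<forall>i. F i w = g i (B w)" using g(2) by (simp add: AE_all_countable)
  then have "AE w in \<mu>. f w = lim (\<lambda>i. g i (B w))"
    using AE_space
  proof eventually_elim
    case (elim w)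
    then show ?case using limI[OF F(2)[of w]] by simp
  qed
  moreover have "(\<lambda>w. lim (\<lambda>i. g i w)) \<in> borel_measurable (completion \<mu>)"
    using g(1) by (rule borel_measurable_lim_metric)
  ultimately show ?thesis by (intro bexI[of _ "\<lambda>w. lim (\<lambda>i. g i w)"]) auto
qed

section \<open>Paths determined by their values at rational times\<close>

definition rat01 :: "nat \<Rightarrow> real" where
  "rat01 = from_nat_into (\<rat> \<inter> {0..1})"

lemma range_rat01: "range rat01 = \<rat> \<inter> {0..1}"
proof -
  have "(0::real) \<in> \<rat> \<inter> {0..1}" by simp
  then show ?thesis unfolding rat01_def
    by (intro range_from_nat_into countable_Int1 countable_rat) auto
qed

lemma closure_range_rat01: "closure (range rat01) = {0..1}"
proof
  show "closure (range rat01) \<subseteq> {0..1}" by (rule closure_minimal) (auto simp: range_rat01)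
  have "{0<..<1::real} \<subseteq> {0<..<1} \<inter> closure \<rat>" by (simp add: Rats_closure_real)
  also have "\<dots> \<subseteq> closure ({0<..<1} \<inter> \<rat>)" by (rule open_Int_closure_subset) simp
  also have "\<dots> \<subseteq> closure (range rat01)" unfolding range_rat01 by (rule closure_mono) auto
  finally have "closure {0<..<1::real} \<subseteq> closure (range rat01)" by (intro closure_minimal) auto
  then show "{0..1} \<subseteq> closure (range rat01)" by simp
qed

lemma rat01_sequence:
  assumes "0 \<le> r" "r \<le> 1"
  obtains \<sigma> where "(\<lambda>n. rat01 (\<sigma> n)) \<longlonglongrightarrow> r"
proof -
  have "r \<in> closure (range rat01)" using assms closure_range_rat01 by simp
  then obtain x where x: "\<And>n. x n \<in> range rat01" "x \<longlonglongrightarrow> r" by (auto simp: closure_sequential)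
  then have "\<forall>n. \<exists>i. x n = rat01 i" by blast
  then obtain \<sigma> where "\<And>n. x n = rat01 (\<sigma> n)" by metis
  then have "x = (\<lambda>n. rat01 (\<sigma> n))" by auto
  then show ?thesis using x(2) that by simp
qed

lemma rat01_range: "rat01 i \<in> {0..1}"
  using range_rat01 by blast

lemma wpath_rat01_tendsto:
  assumes p: "p \<in> wiener_paths" and r: "0 \<le> r" "r \<le> 1" and \<sigma>: "(\<lambda>n. rat01 (\<sigma> n)) \<longlonglongrightarrow> r"
  shows "(\<lambda>n. p (rat01 (\<sigma> n))) \<longlonglongrightarrow> p r"
proof (rule continuous_on_tendsto_compose[OF _ \<sigma>])
  show "continuous_on {0..1} p" using p by (simp add: wiener_paths_def)
qed (use r rat01_range in auto)

lemma wpath_eqI: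
  assumes p: "p \<in> wiener_paths" and p': "p' \<in> wiener_paths" and eq: "\<And>i. p (rat01 i) = p' (rat01 i)"
  shows "p = p'"
proof
  fix r
  show "p r = p' r"
  proof (cases "r \<in> {0..1}")
    case True
    then obtain \<sigma> where \<sigma>: "(\<lambda>n. rat01 (\<sigma> n)) \<longlonglongrightarrow> r" using rat01_sequence by auto
    then show ?thesis
      using wpath_rat01_tendsto[OF p _ _ \<sigma>] wpath_rat01_tendsto[OF p' _ _ \<sigma>] True
      by (simp add: eq LIMSEQ_unique)
  next
    case False
    have "p r = 0" "p' r = 0" using p p' False unfolding wiener_paths_def by blast+
    then show ?thesis by simp
  qed
qed

text \<open>The left-hand side is a countable condition, hence measurable in \<open>z\<close>.\<close>

lemma wpath_extension:
  fixes z :: "nat \<Rightarrow> real ^ 'n::finite"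
  defines "P \<equiv> (\<forall>m::nat. \<exists>k::nat. \<forall>i j. dist (rat01 i) (rat01 j) < 1 / real (Suc k) \<longrightarrow> dist (z i) (z j) < 1 / real (Suc m)) \<and> (\<forall>i. rat01 i = 0 \<longrightarrow> z i = 0)"
  shows "P \<longleftrightarrow> (\<exists>p\<in>wiener_paths. \<forall>i. p (rat01 i) = z i)"
proof
  assume P
  define h where "h x = z (SOME i. rat01 i = x)" for x
  have uc: "\<exists>d>0. \<forall>i j. dist (rat01 i) (rat01 j) < d \<longrightarrow> dist (z i) (z j) < e" if e: "e > 0" for e
  proof -
    obtain m :: nat where m: "1 / real (Suc m) < e" using nat_approx_posE[OF e] by auto
    obtain k :: nat where "\<forall>i j. dist (rat01 i) (rat01 j) < 1 / real (Suc k) \<longrightarrow> dist (z i) (z j) < 1 / real (Suc m)"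
      using \<open>P\<close> unfolding P_def by blast
    then show ?thesis using m by (intro exI[of _ "1 / real (Suc k)"]) (auto intro: less_trans)
  qed
  have zz: "z i = z j" if "rat01 i = rat01 j" for i j
  proof (rule ccontr)
    assume "z i \<noteq> z j"
    then have "dist (z i) (z j) > 0" by simp
    from uc[OF this] that show False by force
  qed
  have h: "h (rat01 i) = z i" for i
    unfolding h_def by (rule zz) (rule someI, rule refl)
  have "uniformly_continuous_on (range rat01) h"
    unfolding uniformly_continuous_on_def
  proof (intro allI impI)
    fix e :: real assume "e > 0"
    from uc[OF this] obtain d where "d > 0" "\<forall>i j. dist (rat01 i) (rat01 j) < d \<longrightarrow> dist (z i) (z j) < e" by blast
    then show "\<exists>d>0. \<forall>x\<in>range rat01. \<forall>x'\<in>range rat01. dist x' x < d \<longrightarrow> dist (h x') (h x) < e"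
      by (intro exI[of _ d]) (auto simp: h)
  qed
  then obtain g where g: "uniformly_continuous_on (closure (range rat01)) g" "\<And>x. x \<in> range rat01 \<Longrightarrow> h x = g x"
    by (rule uniformly_continuous_on_extension_on_closure) blast
  define p where "p r = (if r \<in> {0..1} then g r else 0)" for r
  have "continuous_on {0..1} g" using g(1) closure_range_rat01 uniformly_continuous_imp_continuous by auto
  then have "continuous_on {0..1} p" by (rule continuous_on_eq) (simp add: p_def)
  moreover have pz: "p (rat01 i) = z i" for i
    using g(2)[of "rat01 i"] rat01_range[of i] by (simp add: p_def h)
  moreover have "p 0 = 0"
  proof -
    have "0 \<in> range rat01" by (simp add: range_rat01)
    then obtain i where "rat01 i = 0" by (metis imageE)
    then show ?thesis using pz[of i] \<open>P\<close> unfolding P_def by simp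
  qed
  ultimately show "\<exists>p\<in>wiener_paths. \<forall>i. p (rat01 i) = z i"
    by (intro bexI[of _ p]) (auto simp: wiener_paths_def p_def)
next
  assume "\<exists>p\<in>wiener_paths. \<forall>i. p (rat01 i) = z i"
  then obtain p where p: "p \<in> wiener_paths" "\<And>i. p (rat01 i) = z i" by blast
  have "uniformly_continuous_on {0..1} p"
    using p(1) by (intro compact_uniformly_continuous) (auto simp: wiener_paths_def)
  then have uc: "\<exists>d>0. \<forall>x\<in>{0..1}. \<forall>x'\<in>{0..1}. dist x' x < d \<longrightarrow> dist (p x') (p x) < e" if "e > 0" for e
    using that unfolding uniformly_continuous_on_def by blast
  have "\<exists>k::nat. \<forall>i j. dist (rat01 i) (rat01 j) < 1 / real (Suc k) \<longrightarrow> dist (z i) (z j) < 1 / real (Suc m)" for m :: nat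
  proof -
    obtain d where d: "d > 0" "\<forall>x\<in>{0..1}. \<forall>x'\<in>{0..1}. dist x' x < d \<longrightarrow> dist (p x') (p x) < 1 / real (Suc m)"
      using uc[of "1 / real (Suc m)"] by auto
    obtain k :: nat where "1 / real (Suc k) < d" using nat_approx_posE[OF d(1)] by auto
    then have "dist (z i) (z j) < 1 / real (Suc m)" if "dist (rat01 i) (rat01 j) < 1 / real (Suc k)" for i j
      using d(2)[rule_format, OF rat01_range rat01_range, of i j] that unfolding p(2) by (meson less_trans)
    then show ?thesis by blast
  qed
  moreover have "z i = 0" if "rat01 i = 0" for i using p(1) p(2)[of i] that by (simp add: wiener_paths_def)
  ultimately show P unfolding P_def by blast
qed

text \<open>Factorization works for one time at a time and yields countably many vector-valued
  functionals, which need not fit together into a path everywhere. Where they do, the path is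
  unique; elsewhere the zero path is a harmless default. Evaluations are measurable as limits along
  rational times.\<close>

lemma wpath_assemble:
  fixes z :: "nat \<Rightarrow> 'a \<Rightarrow> real ^ 'n::finite" and \<mu> :: "'n wpath measure"
  assumes sets_\<mu>: "sets \<mu> = sets wiener_algebra" and z [measurable]: "\<And>i. z i \<in> borel_measurable N"
  shows "\<exists>U\<in>N \<rightarrow>\<^sub>M \<mu>. \<forall>w. \<forall>p\<in>wiener_paths. (\<forall>i. p (rat01 i) = z i w) \<longrightarrow> U w = p"
proof -
  define P where "P w \<longleftrightarrow> (\<forall>m::nat. \<exists>k::nat. \<forall>i j. dist (rat01 i) (rat01 j) < 1 / real (Suc k) \<longrightarrow> dist (z i w) (z j w) < 1 / real (Suc m)) \<and> (\<forall>i. rat01 i = 0 \<longrightarrow> z i w = 0)" for w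
  have Pm [measurable]: "Measurable.pred N P" unfolding P_def[abs_def] by measurable
  have P_iff: "P w \<longleftrightarrow> (\<exists>p\<in>wiener_paths. \<forall>i. p (rat01 i) = z i w)" for w
    unfolding P_def by (rule wpath_extension)
  define U where "U w = (if P w then SOME p. p \<in> wiener_paths \<and> (\<forall>i. p (rat01 i) = z i w) else (\<lambda>_. 0))" for w
  have UP: "U w \<in> wiener_paths \<and> (\<forall>i. U w (rat01 i) = z i w)" if "P w" for w
  proof -
    have "\<exists>p. p \<in> wiener_paths \<and> (\<forall>i. p (rat01 i) = z i w)" using that P_iff by blast
    from someI_ex[OF this] that show ?thesis by (simp add: U_def)
  qed
  have Upath: "U w \<in> wiener_paths" for w
    using UP[of w] by (cases "P w") (auto simp: U_def wiener_paths_def)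
  have "U \<in> N \<rightarrow>\<^sub>M \<mu>"
  proof (rule measurable_wpathI[OF sets_\<mu> Upath])
    fix r :: real assume r: "0 \<le> r" "r \<le> 1"
    then obtain \<sigma> where \<sigma>: "(\<lambda>n. rat01 (\<sigma> n)) \<longlonglongrightarrow> r" by (rule rat01_sequence)
    show "(\<lambda>w. U w r) \<in> borel_measurable N"
    proof (rule borel_measurable_LIMSEQ_metric)
      show "(\<lambda>w. if P w then z (\<sigma> n) w else 0) \<in> borel_measurable N" for n by measurable
      fix w
      show "(\<lambda>n. if P w then z (\<sigma> n) w else 0) \<longlonglongrightarrow> U w r"
        using wpath_rat01_tendsto[OF Upath r \<sigma>, of w] UP[of w] by (cases "P w") (auto simp: U_def)
    qed
  qed
  moreover have "U w = p" if "p \<in> wiener_paths" "\<forall>i. p (rat01 i) = z i w" for w p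
  proof -
    have "P w" using that P_iff by blast
    then show ?thesis using UP[of w] that by (intro wpath_eqI) auto
  qed
  ultimately show ?thesis by blast
qed

section \<open>From a strong solution to an inverse\<close>

context ito_drift
begin

text \<open>An identity that holds along \<open>X\<close> holds almost everywhere for the law of
  \<open>X\<close>, provided the set where it holds is measurable. Testing paths at rational times
  makes that set a countable intersection.\<close>

lemma AE_law_wpath_eq:
  assumes X: "abs_cont_map \<mu> X" and Y: "Y \<in> M \<rightarrow>\<^sub>M \<mu>" and law: "distr M M X = N" and eq: "AE w in M. Y (X w) = X w"
  shows "AE w in N. Y w = w"
proof -
  have XM: "X \<in> M \<rightarrow>\<^sub>M M" by (rule abs_cont_map_measurable_completion[OF X])
  note ev = eval_measurable measurable_wpathD(1)[OF sets_\<mu> Y]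
  have eqi: "Y w = w \<longleftrightarrow> (\<forall>i. Y w (rat01 i) = w (rat01 i))" if "w \<in> space \<mu>" for w
    using measurable_wpathD(2)[OF sets_\<mu> Y, of w] that space_wpath[OF sets_\<mu>] wpath_eqI[of "Y w" w] by auto
  have "{w\<in>space M. Y w (rat01 i) = w (rat01 i)} \<in> sets M" for i
  proof -
    have "(\<lambda>w. Y w (rat01 i) - w (rat01 i)) \<in> borel_measurable M"
      by (intro borel_measurable_diff ev)
    from measurable_sets[OF this, of "{0}"] show ?thesis by (simp add: vimage_def Int_def conj_commute)
  qed
  then have m: "{w\<in>space M. \<forall>i. Y w (rat01 i) = w (rat01 i)} \<in> sets M"
    by (rule sets.sets_Collect_countable_All)
  have "AE w in M. \<forall>i. Y (X w) (rat01 i) = X w (rat01 i)"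
    using eq by eventually_elim simp
  then have "AE w in distr M M X. \<forall>i. Y w (rat01 i) = w (rat01 i)"
    using AE_distr_iff[OF XM m] by simp
  moreover have "AE w in distr M M X. w \<in> space \<mu>" using AE_space[of "distr M M X"] by simp
  ultimately have "AE w in distr M M X. Y w = w"
    by eventually_elim (simp add: eqi)
  then show ?thesis by (simp only: law)
qed

theorem strong_solution_imp_ae_invertible:
  assumes B: "B \<in> M \<rightarrow>\<^sub>M \<mu>" and law_B: "distr M \<mu> B = \<mu>" and X: "strong_solution \<mu> vdot B X"
  shows "ae_invertible \<mu> V"
proof -
  have ac: "abs_cont_map \<mu> X" and adX: "\<And>r. 0 \<le> r \<Longrightarrow> r \<le> 1 \<Longrightarrow> (\<lambda>w. X w r) \<in> borel_measurable (aug_filtration \<mu> B r)"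
    and eqX: "AE w in \<mu>. \<forall>r\<in>{0..1}. X w r = B w r - (LBINT s:{0..r}. vdot s (X w))"
    using X by (auto simp: strong_solution_def)
  have Xm: "X \<in> M \<rightarrow>\<^sub>M \<mu>" using ac by (simp add: abs_cont_map_def)
  have law_B1: "distr M \<mu> B = density \<mu> (\<lambda>_. 1)" by (simp add: law_B density_1)
  have acB: "abs_cont_map \<mu> B" by (rule abs_cont_map_density[OF B _ law_B1]) simp
  have law_BM: "distr M M B = M"
    using distr_completion_density[OF B _ law_B1] by (simp add: density_1)
  have law_XM: "distr M M X = \<nu>"
    by (rule distr_completion_density[OF Xm _ strong_solution_law[OF B law_B X]]) (use L_measurable in simp)
  have Xp: "X w \<in> wiener_paths" and Bp: "B w \<in> wiener_paths" if "w \<in> space \<mu>" for w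
    using measurable_wpathD(2)[OF sets_\<mu> Xm, of w] measurable_wpathD(2)[OF sets_\<mu> B, of w] that by auto
  have VX: "AE w in \<mu>. V (X w) = B w"
    using eqX AE_space
  proof eventually_elim
    case (elim w)
    have "X w \<in> space \<mu>" using Xp[OF elim(2)] space_wpath[OF sets_\<mu>] by simp
    then have "V (X w) \<in> wiener_paths" by (rule V_path)
    then show ?case
    proof (rule wpath_eqI[OF _ Bp[OF elim(2)]])
      show "V (X w) (rat01 i) = B w (rat01 i)" for i
        using elim(1) rat01_range[of i] V_eval[of "rat01 i" "X w"] by auto
    qed
  qed
  \<comment> \<open>Adaptedness of \<open>X\<close> to the filtration of \<open>B\<close> enters
    here: every value of \<open>X\<close> is a functional of the path of \<open>B\<close>.\<close>
  have "\<exists>g\<in>borel_measurable M. AE w in \<mu>. X w (rat01 i) = g (B w)" for i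
    using aug_measurable_factor[OF sets_\<mu> _ adX] Bp space_wpath[OF sets_\<mu>] rat01_range[of i] by auto
  then have "\<forall>i. \<exists>g. g \<in> borel_measurable M \<and> (AE w in \<mu>. X w (rat01 i) = g (B w))"
    by (simp only: Bex_def simp_thms)
  from choice[OF this] obtain g where "\<forall>i. g i \<in> borel_measurable M \<and> (AE w in \<mu>. X w (rat01 i) = g i (B w))" ..
  then have g: "\<And>i. g i \<in> borel_measurable M" "\<And>i. AE w in \<mu>. X w (rat01 i) = g i (B w)" by simp_all
  obtain U where U: "U \<in> M \<rightarrow>\<^sub>M \<mu>" "\<And>w p. p \<in> wiener_paths \<Longrightarrow> (\<forall>i. p (rat01 i) = g i w) \<Longrightarrow> U w = p"
    using wpath_assemble[OF sets_\<mu>, of g M] g(1) by blast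
  have "AE w in \<mu>. \<forall>i. X w (rat01 i) = g i (B w)" using g(2) by (simp add: AE_all_countable)
  then have UB: "AE w in \<mu>. U (B w) = X w"
    using AE_space by eventually_elim (rule U(2)[OF Xp])
  have BM: "B \<in> M \<rightarrow>\<^sub>M M" by (rule abs_cont_map_measurable_completion[OF acB])
  \<comment> \<open>Since \<open>U \<circ> B = X\<close> almost everywhere and \<open>B\<close> has
    law \<mu>, the law of \<open>U\<close> is that of \<open>X\<close>.\<close>
  have acU: "abs_cont_map \<mu> U"
  proof (rule abs_cont_mapI[OF U(1)])
    fix N assume N: "N \<in> null_sets \<mu>"
    have m: "U -` N \<inter> space \<mu> \<in> sets M" using measurable_sets[OF U(1), of N] N by auto
    have "AE w in M. X w \<notin> N" using abs_cont_map_AE[OF ac AE_not_in[OF N]] .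
    then have "AE w in M. B w \<notin> U -` N \<inter> space \<mu>"
      using AE_completion[OF UB] by eventually_elim auto
    then have "AE w in distr M M B. w \<notin> U -` N \<inter> space \<mu>"
    proof (subst AE_distr_iff[OF BM])
      show "{w \<in> space M. w \<notin> U -` N \<inter> space \<mu>} \<in> sets M"
        using sets.compl_sets[OF m] by (simp add: set_diff_eq)
    qed
    then have "AE w in M. w \<notin> U -` N \<inter> space \<mu>" by (simp only: law_BM)
    then show "emeasure M (U -` N \<inter> space \<mu>) = 0"
      using AE_iff_null_sets[OF m] by (simp only: null_setsD1)
  qed
  have VM: "V \<in> M \<rightarrow>\<^sub>M M" and UM: "U \<in> M \<rightarrow>\<^sub>M M"
    by (auto intro: abs_cont_map_measurable_completion abs_cont_V acU)
  \<comment> \<open>The identity holds along \<open>X\<close>, hence for its law \<nu>. That this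
    law is all of \<nu>, equivalent to \<mu>, is what turns a one-sided identity on the range of
    \<open>X\<close> into one almost everywhere.\<close>
  have "AE w in \<nu>. U (V w) = w"
  proof (rule AE_law_wpath_eq[OF ac measurable_compose[OF VM U(1)] law_XM])
    show "AE w in M. U (V (X w)) = X w"
      using AE_completion[OF VX] AE_completion[OF UB] by eventually_elim simp
  qed
  then have "AE w in \<mu>. U (V w) = w" by (simp only: AE_\<nu> AE_completion_iff)
  moreover have "AE w in M. V (U w) = w"
  proof (rule AE_law_wpath_eq[OF acB measurable_compose[OF UM V_measurable] law_BM])
    show "AE w in M. V (U (B w)) = B w"
      using AE_completion[OF VX] AE_completion[OF UB] by eventually_elim simp
  qed
  then have "AE w in \<mu>. V (U w) = w" by (simp only: AE_completion_iff)
  ultimately show ?thesis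
    unfolding ae_invertible_def using abs_cont_V acU by blast
qed

end

theorem theorem12:
  fixes \<mu> :: "('n::finite) wpath measure"
    and L \<phi> :: "'n wpath \<Rightarrow> real"
    and vdot :: "real \<Rightarrow> 'n wpath \<Rightarrow> real ^ 'n"
    and V T B :: "'n wpath \<Rightarrow> 'n wpath"
    and \<epsilon> :: real
  assumes "wiener_measure \<mu>"
    and "\<epsilon> > 0"
    and "L \<in> borel_measurable \<mu>"
    and "integrable \<mu> (\<lambda>w. \<bar>L w\<bar> powr (1 + \<epsilon>))"
    and "AE w in \<mu>. L w > 0"
    and "(\<integral>w. L w \<partial>\<mu>) = 1"
    and "adapted_drift \<mu> vdot"
    and "is_rho \<mu> vdot L"
    and "V = drift_shift vdot"
    and "monge_transport_map \<mu> (density \<mu> (\<lambda>w. ennreal (L w))) \<phi> T"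
    and "B = V \<circ> T"
  shows "(\<not> ae_invertible \<mu> V \<longleftrightarrow> \<not> (\<exists>U. strong_solution \<mu> vdot (\<lambda>w. w) U)) \<and>
         (\<not> (\<exists>U. strong_solution \<mu> vdot (\<lambda>w. w) U) \<longleftrightarrow> \<not> (\<exists>X. strong_solution \<mu> vdot B X))"
proof -
  obtain J t k \<xi> where "ito_drift \<mu> vdot L J t k \<xi>"
    using ito_drift_exists assms by blast
  then interpret ito_drift \<mu> vdot L J t k \<xi> .
  have T: "T \<in> completion \<mu> \<rightarrow>\<^sub>M \<mu>" and law_T: "distr (completion \<mu>) \<mu> T = density \<mu> (\<lambda>w. ennreal (L w))"
    using assms(10) by (auto simp: monge_transport_map_def unique_monge_solution_def transports_def)
  have Lm: "(\<lambda>w. ennreal (L w)) \<in> borel_measurable \<mu>" using assms(3) by simp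
  \<comment> \<open>\<open>V\<close> is measurable on the completion, so \<open>T\<close> must be
    measurable into it; this holds because the law \<nu> of \<open>T\<close> is absolutely
    continuous.\<close>
  have TM: "T \<in> completion \<mu> \<rightarrow>\<^sub>M completion \<mu>"
    by (rule abs_cont_map_measurable_completion[OF abs_cont_map_density[OF T Lm law_T]])
  have B_eq: "B = (\<lambda>w. drift_shift vdot (T w))" using assms by auto
  have B: "B \<in> completion \<mu> \<rightarrow>\<^sub>M \<mu>"
    unfolding B_eq by (rule measurable_compose[OF TM V_measurable])
  have "distr (completion \<mu>) \<mu> B = distr (distr (completion \<mu>) (completion \<mu>) T) \<mu> (drift_shift vdot)"
    unfolding B_eq by (subst distr_distr[OF V_measurable TM]) (simp add: comp_def)
  also have "\<dots> = \<mu>"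
    unfolding distr_completion_density[OF T Lm law_T] by (rule distr_V)
  finally have law_B: "distr (completion \<mu>) \<mu> B = \<mu>" .
  show ?thesis
    using ae_invertible_imp_strong_solution strong_solution_comp[OF B law_B] strong_solution_imp_ae_invertible[OF B law_B]
    unfolding assms(9) by blast
qed

end
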